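(* Let $(\phi_i)_{i\ge 1}$ be non-negative reals with $\sum_{i=1}^{\infty}\phi_i=1$ and $\sum_{i=1}^{\infty} i\phi_i=m<+\infty$. Let $(a_n)_{n\ge1}$ be non-negative reals with $a_n<1$ for all $n$ and $n(1-a_n)\to\lambda$ as $n\to+\infty$ for some $\lambda>0$. Let $(\varepsilon_k)_{k\ge0}$ be i.i.d. centered real random variables with $\mathbb{E}[\varepsilon_k^2]=1$. For each $n$ let $y^n_0=\varepsilon_0$, $y^n_k=\varepsilon_k+\sum_{i=1}^{k}a_n\phi_i\,y^n_{k-i}$ for $k\ge1$, and for $t\in[0,1]$ let $$Z^n_t=\frac{1-a_n}{\sqrt n}\Big(\sum_{j=0}^{\lfloor nt\rfloor}y^n_j+(nt-\lfloor nt\rfloor)\,y^n_{\lfloor nt\rfloor+1}\Big).$$ Then, as $n\to+\infty$, the processes $(Z^n_t)_{t\in[0,1]}$ converge in law to the process $(Z_t)_{t\in[0,1]}$ defined by $$Z_t=\int_0^t\big(1-e^{-\frac{\lambda}{m}(t-s)}\big)\,dW_s=\int_0^t\int_0^s\frac{\lambda}{m}e^{-\frac{\lambda}{m}(s-u)}\,dW_u\,ds,$$ where $W$ is a standard Brownian motion.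
   Context: The processes $Z^n$ have continuous paths (they are linear interpolations), and convergence in law is understood as weak convergence of the laws of $Z^n$ on the space $C([0,1])$ of continuous real functions on $[0,1]$ with the uniform topology. The variables $\varepsilon_k$ do not depend on $n$. *)

theory Defs
  imports "HOL-Probability.Probability"
begin

section \<open>Convergence in law in C([0,1])\<close>

text \<open>The library function space consists of functions that are \<^const>\<open>undefined\<close> outside
  \<open>[0,1]\<close>, hence the use of \<^const>\<open>restrict\<close> in the path map below.\<close>

definition C01 :: "(real \<Rightarrow> real) metric" where
  "C01 = cfunspace (top_of_set {0..1}) euclidean_metric"

definition borel_C01 :: "(real \<Rightarrow> real) measure" where
  "borel_C01 = sigma (mspace C01) {U. openin (mtopology_of C01) U}"

definition path01 :: "(real \<Rightarrow> 'a \<Rightarrow> real) \<Rightarrow> 'a \<Rightarrow> real \<Rightarrow> real" where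
  "path01 Z \<omega> = restrict (\<lambda>t. Z t \<omega>) {0..1}"

definition law_C01 :: "'a measure \<Rightarrow> (real \<Rightarrow> 'a \<Rightarrow> real) \<Rightarrow> (real \<Rightarrow> real) measure" where
  "law_C01 M Z = distr M borel_C01 (path01 Z)"

definition weak_conv_C01 :: "(nat \<Rightarrow> (real \<Rightarrow> real) measure) \<Rightarrow> (real \<Rightarrow> real) measure \<Rightarrow> bool" where
  "weak_conv_C01 \<mu> \<nu> \<longleftrightarrow>
     (\<forall>F. continuous_map (mtopology_of C01) euclideanreal F \<and> bounded (F ` mspace C01) \<longrightarrow>
        (\<lambda>n. integral\<^sup>L (\<mu> n) F) \<longlonglongrightarrow> integral\<^sup>L \<nu> F)"

text \<open>The measurability conditions ensure that the laws are the genuine image measures: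
  \<^const>\<open>distr\<close> is not meaningful for non-measurable maps.\<close>

definition converges_in_law_C01 ::
    "'a measure \<Rightarrow> (nat \<Rightarrow> real \<Rightarrow> 'a \<Rightarrow> real) \<Rightarrow> 'b measure \<Rightarrow> (real \<Rightarrow> 'b \<Rightarrow> real) \<Rightarrow> bool" where
  "converges_in_law_C01 M Zs N Z \<longleftrightarrow>
     (\<forall>n. path01 (Zs n) \<in> measurable M borel_C01) \<and>
     path01 Z \<in> measurable N borel_C01 \<and>
     weak_conv_C01 (\<lambda>n. law_C01 M (Zs n)) (law_C01 N Z)"


section \<open>Brownian motion and the Wiener integral\<close>

definition std_brownian_motion :: "'b measure \<Rightarrow> (real \<Rightarrow> 'b \<Rightarrow> real) \<Rightarrow> bool" where
  "std_brownian_motion N W \<longleftrightarrow>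
     prob_space N \<and>
     (\<forall>t\<ge>0. W t \<in> borel_measurable N) \<and>
     (AE \<omega> in N. W 0 \<omega> = 0) \<and>
     (AE \<omega> in N. continuous_on {0..} (\<lambda>t. W t \<omega>)) \<and>
     (\<forall>s t. 0 \<le> s \<and> s < t \<longrightarrow>
        distributed N lborel (\<lambda>\<omega>. W t \<omega> - W s \<omega>) (normal_density 0 (sqrt (t - s)))) \<and>
     (\<forall>k (p :: nat \<Rightarrow> real). 0 \<le> p 0 \<and> (\<forall>i<k. p i < p (Suc i)) \<longrightarrow>
        prob_space.indep_vars N (\<lambda>_. borel) (\<lambda>i \<omega>. W (p (Suc i)) \<omega> - W (p i) \<omega>) {..<k})"

definition step_fun :: "nat \<Rightarrow> (nat \<Rightarrow> real) \<Rightarrow> (nat \<Rightarrow> real) \<Rightarrow> real \<Rightarrow> real" where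
  "step_fun k p c s = (\<Sum>i<k. c i * indicator {p i<..p (Suc i)} s)"

definition step_integral ::
    "(real \<Rightarrow> 'b \<Rightarrow> real) \<Rightarrow> nat \<Rightarrow> (nat \<Rightarrow> real) \<Rightarrow> (nat \<Rightarrow> real) \<Rightarrow> 'b \<Rightarrow> real" where
  "step_integral W k p c \<omega> = (\<Sum>i<k. c i * (W (p (Suc i)) \<omega> - W (p i) \<omega>))"

text \<open>The Wiener integral of a deterministic square-integrable \<open>f\<close> over \<open>[a,b]\<close> is the limit in
  \<open>L\<^sup>2(N)\<close> of the integrals of step functions that converge to \<open>f\<close> in \<open>L\<^sup>2([a,b])\<close>. It is determined
  up to almost sure equality, hence a predicate. Square-integrability of \<open>f\<close> and of \<open>I\<close> is
  implied, as the nonnegative integrals below are eventually finite.\<close>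

definition has_wiener_integral ::
    "'b measure \<Rightarrow> (real \<Rightarrow> 'b \<Rightarrow> real) \<Rightarrow> real \<Rightarrow> real \<Rightarrow> (real \<Rightarrow> real) \<Rightarrow> ('b \<Rightarrow> real) \<Rightarrow> bool" where
  "has_wiener_integral N W a b f I \<longleftrightarrow>
     set_borel_measurable lborel {a..b} f \<and> I \<in> borel_measurable N \<and>
     (\<exists>(k :: nat \<Rightarrow> nat) (p :: nat \<Rightarrow> nat \<Rightarrow> real) (c :: nat \<Rightarrow> nat \<Rightarrow> real).
        (\<forall>n. a \<le> p n 0 \<and> p n (k n) \<le> b \<and> (\<forall>i<k n. p n i \<le> p n (Suc i))) \<and>
        (\<lambda>n. \<integral>\<^sup>+ s\<in>{a..b}. ennreal ((f s - step_fun (k n) (p n) (c n) s)\<^sup>2) \<partial>lborel) \<longlonglongrightarrow> 0 \<and>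
        (\<lambda>n. \<integral>\<^sup>+ \<omega>. ennreal ((I \<omega> - step_integral W (k n) (p n) (c n) \<omega>)\<^sup>2) \<partial>N) \<longlonglongrightarrow> 0)"

text \<open>A continuous version on \<open>[0,1]\<close> of the process \<open>t \<mapsto> \<integral>\<^sub>0\<^sup>t K t s dW\<^sub>s\<close>.\<close>

definition continuous_wiener_process ::
    "'b measure \<Rightarrow> (real \<Rightarrow> 'b \<Rightarrow> real) \<Rightarrow> (real \<Rightarrow> real \<Rightarrow> real) \<Rightarrow> (real \<Rightarrow> 'b \<Rightarrow> real) \<Rightarrow> bool" where
  "continuous_wiener_process N W K X \<longleftrightarrow>
     (\<forall>\<omega>\<in>space N. continuous_on {0..1} (\<lambda>t. X t \<omega>)) \<and>
     (\<forall>t\<in>{0..1}. has_wiener_integral N W 0 t (K t) (X t))"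


section \<open>The autoregressive sequences and their rescaled partial sums\<close>

fun ar_seq :: "real \<Rightarrow> (nat \<Rightarrow> real) \<Rightarrow> (nat \<Rightarrow> real) \<Rightarrow> nat \<Rightarrow> real" where
  "ar_seq a \<phi> e 0 = e 0"
| "ar_seq a \<phi> e (Suc k) = e (Suc k) + (\<Sum>i\<in>{1..Suc k}. a * \<phi> i * ar_seq a \<phi> e (Suc k - i))"

definition rescaled_process ::
    "(nat \<Rightarrow> real) \<Rightarrow> (nat \<Rightarrow> real) \<Rightarrow> (nat \<Rightarrow> 'a \<Rightarrow> real) \<Rightarrow> nat \<Rightarrow> real \<Rightarrow> 'a \<Rightarrow> real" where
  "rescaled_process a \<phi> \<epsilon> n t \<omega> =
     (let y = ar_seq (a n) \<phi> (\<lambda>k. \<epsilon> k \<omega>); k = nat \<lfloor>real n * t\<rfloor>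
      in (1 - a n) / sqrt (real n) * ((\<Sum>j\<le>k. y j) + (real n * t - real k) * y (k + 1)))"

end

theory Submission
  imports Defs
begin

text \<open>Write \<open>y\<close> as the convolution of \<open>\<epsilon>\<close> with the impulse response \<open>\<psi>\<close> of the recursion, so that the partial
  sums of \<open>y\<close> have the weights \<open>q\<^sub>k = (1 - a) (\<psi>\<^sub>0 + \<dots> + \<psi>\<^sub>k)\<close>. The renewal identity
  \<open>a \<Sum>\<^sub>i T\<^sub>i \<psi>\<^sub>k\<^sub>-\<^sub>i = 1 - q\<^sub>k\<close>, where \<open>T\<^sub>i = \<Sum>\<^sub>j\<^sub>>\<^sub>i \<phi>\<^sub>j\<close> has total mass \<open>m\<close>, turns into an approximate integral
  equation for \<open>q\<close>, and a discrete Gronwall argument gives \<open>q\<^sub>k \<approx> 1 - exp (- (l/m) k/n)\<close> uniformly in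
  \<open>k \<le> n\<close>. Grouping \<open>\<epsilon>\<close> into \<open>K\<close> blocks, \<open>Z\<^sup>n\<^sub>t\<close> is within \<open>O(1/K)\<close> in \<open>L\<^sup>2\<close> of a fixed linear function of the
  independent normalised block sums, which converge jointly to Gaussian variables by the one-dimensional
  central limit theorem.

  No maximal inequality is needed for tightness: \<open>\<psi> \<le> 1\<close> makes the slopes of the piecewise linear path
  \<open>Z\<^sup>n\<close> bounded in \<open>L\<^sup>2\<close>, so the 1/2-Hoelder seminorm of \<open>Z\<^sup>n\<close> has bounded mean and \<open>Z\<^sup>n\<close> is uniformly close to
  its Bernstein polynomials. On the Brownian side integration by parts gives the pathwise formula
  \<open>Z\<^sub>t = \<integral>\<^sub>0\<^sup>t (l/m) exp (- (l/m) (t - s)) W\<^sub>s ds\<close>.\<close>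

section \<open>The space of continuous functions\<close>

text \<open>Bernstein polynomials serve twice. They depend continuously on finitely many values of a
  path, which turns pointwise measurability into measurability in C([0,1]); and they reduce a
  functional of the path to a function of k + 1 values, at an error uniform in n. The degree k is
  fixed first, then the number K of blocks (the block error carries a factor k + 1), and n tends to
  infinity last. The slopes are \<open>(1 - a n) * sqrt n * y\<close>, where \<open>1 - a n\<close>
  is of order 1/n and y has variance at most of order n. For a plain rescaled random walk they would
  be of order sqrt n; here the limit is itself absolutely continuous. The joint limit of the blocks
  needs no multivariate central limit theorem: independence makes the joint law a power of one law,
  and one-dimensional Skorohod representations can be put side by side. The Gaussian vector is
  realised by increments of the given W, so the linear functions become Riemann-Stieltjes sums whose
  pathwise limit is Z.\<close>

lemma mspace_C01: "mspace C01 = {f \<in> extensional {0..1}. continuous_on {0..1} f}"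
proof -
  \<comment> \<open>The function space consists of bounded maps; on the compact interval boundedness
    is automatic, so only extensionality and continuity remain.\<close>
  have "Met_TC.mbounded (f ` {0..1})" if "continuous_on {0..1} f" for f :: "real \<Rightarrow> real"
  proof -
    have "bounded (f ` {0..1})"
      using that compact_continuous_image compact_imp_bounded by blast
    then show ?thesis
      unfolding Met_TC.mbounded_def Met_TC.mcball_def bounded_def by blast
  qed
  then show ?thesis by (auto simp: C01_def)
qed

lemma restrict_in_C01 [simp]:
  "continuous_on {0..1} f \<Longrightarrow> restrict f {0..1} \<in> mspace C01"
  by (auto simp: mspace_C01 intro: continuous_on_eq)

lemma mdist_C01_le:
  assumes "0 \<le> b" "\<And>t. t \<in> {0..1} \<Longrightarrow> \<bar>f t - g t\<bar> \<le> b"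
  shows "mdist C01 f g \<le> b"
  unfolding C01_def by (rule mdist_cfunspace_le) (use assms in \<open>auto simp: dist_real_def\<close>)

lemma mspace_C01_nonempty: "mspace C01 \<noteq> {}"
  using restrict_in_C01[of "\<lambda>_. 0"] by (metis continuous_on_const empty_iff)

lemma openin_C01_iff:
  "openin (mtopology_of C01) U \<longleftrightarrow> U \<subseteq> mspace C01 \<and>
     (\<forall>x\<in>U. \<exists>r>0. \<forall>y\<in>mspace C01. mdist C01 x y < r \<longrightarrow> y \<in> U)"
proof -
  interpret Metric_space "mspace C01" "mdist C01" by (rule Metric_space_mspace_mdist)
  show ?thesis
    unfolding mtopology_of_def openin_mtopology mball_def by (intro conj_cong refl ball_cong) blast
qed

lemma space_borel_C01 [simp]: "space borel_C01 = mspace C01"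
  by (simp add: borel_C01_def space_measure_of_conv)

lemma openin_sets_borel_C01: "openin (mtopology_of C01) U \<Longrightarrow> U \<in> sets borel_C01"
  unfolding borel_C01_def by (subst sets_measure_of) (auto simp: openin_C01_iff)

lemma continuous_map_borel_C01:
  assumes "continuous_map (mtopology_of C01) euclideanreal F"
  shows "F \<in> borel_measurable borel_C01"
proof (rule borel_measurableI)
  fix S :: "real set" assume "open S"
  then have "openin (mtopology_of C01) {x \<in> topspace (mtopology_of C01). F x \<in> S}"
    using assms by (intro openin_continuous_map_preimage) auto
  then show "F -` S \<inter> space borel_C01 \<in> sets borel_C01"
    by (intro openin_sets_borel_C01) (auto simp: vimage_def Int_def conj_commute)
qed

section \<open>Bernstein polynomials of paths\<close>

definition bernstein_path :: "nat \<Rightarrow> (nat \<Rightarrow> real) \<Rightarrow> real \<Rightarrow> real" where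
  "bernstein_path k x = restrict (\<lambda>t. \<Sum>i\<le>k. x i * Bernstein k i t) {0..1}"

abbreviation bernstein_op :: "nat \<Rightarrow> (real \<Rightarrow> real) \<Rightarrow> real \<Rightarrow> real" where
  "bernstein_op k f \<equiv> bernstein_path k (\<lambda>i. f (real i / real k))"

lemma bernstein_path_in_C01 [simp]: "bernstein_path k x \<in> mspace C01"
  unfolding bernstein_path_def Bernstein_def by (intro restrict_in_C01 continuous_intros)

lemma bernstein_path_cong: "(\<And>i. i \<le> k \<Longrightarrow> x i = y i) \<Longrightarrow> bernstein_path k x = bernstein_path k y"
  by (auto simp: bernstein_path_def intro!: restrict_ext sum.cong)

lemma Bernstein_le_1:
  assumes "0 \<le> t" "t \<le> 1" "i \<le> k"
  shows "Bernstein k i t \<le> 1"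
  using member_le_sum[of i "{..k}" "\<lambda>i. Bernstein k i t"] assms by (auto intro: Bernstein_nonneg)

text \<open>The basis polynomials have values between 0 and 1 on the interval. Taking a node vector
  rather than a function as argument makes the map Lipschitz in finitely many coordinates, which
  yields both its measurability and the continuity of functionals composed with it.\<close>

lemma mdist_bernstein_path:
  "mdist C01 (bernstein_path k x) (bernstein_path k y) \<le> (\<Sum>i\<le>k. \<bar>x i - y i\<bar>)"
proof (rule mdist_C01_le)
  fix t :: real assume t: "t \<in> {0..1}"
  have "\<bar>bernstein_path k x t - bernstein_path k y t\<bar> = \<bar>\<Sum>i\<le>k. (x i - y i) * Bernstein k i t\<bar>"
    using t by (simp add: bernstein_path_def sum_subtractf left_diff_distrib)
  also have "\<dots> \<le> (\<Sum>i\<le>k. \<bar>(x i - y i) * Bernstein k i t\<bar>)" by (rule sum_abs)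
  also have "\<dots> \<le> (\<Sum>i\<le>k. \<bar>x i - y i\<bar>)"
    using t Bernstein_le_1 Bernstein_nonneg
    by (intro sum_mono) (auto simp: abs_mult intro!: mult_left_le)
  finally show "\<bar>bernstein_path k x t - bernstein_path k y t\<bar> \<le> (\<Sum>i\<le>k. \<bar>x i - y i\<bar>)" .
qed (simp add: sum_nonneg)

lemma open_vimage_bernstein_path:
  assumes "openin (mtopology_of C01) V"
  shows "open {x. bernstein_path k x \<in> V}"
proof (subst open_subopen, intro ballI)
  fix x assume "x \<in> {x. bernstein_path k x \<in> V}"
  then obtain r where r: "r > 0" "\<And>y. y \<in> mspace C01 \<Longrightarrow> mdist C01 (bernstein_path k x) y < r \<Longrightarrow> y \<in> V"
    using assms unfolding openin_C01_iff by blast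
  define T where "T = {y. (\<Sum>i\<le>k. \<bar>x i - y i\<bar>) < r}"
  have in_V: "bernstein_path k y \<in> V" if "(\<Sum>i\<le>k. \<bar>x i - y i\<bar>) < r" for y
    by (rule r(2)) (use mdist_bernstein_path[of k x y] that in auto)
  have "continuous_on UNIV (\<lambda>y :: nat \<Rightarrow> real. \<Sum>i\<le>k. \<bar>x i - y i\<bar>)"
    by (intro continuous_intros continuous_on_product_coordinates)
  then have "open T" unfolding T_def by (intro open_Collect_less continuous_on_const)
  moreover have "T \<subseteq> {x. bernstein_path k x \<in> V}"
    using in_V by (auto simp: T_def)
  ultimately show "\<exists>T. open T \<and> x \<in> T \<and> T \<subseteq> {x. bernstein_path k x \<in> V}"
    using r(1) by (intro exI[of _ T]) (auto simp: T_def)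
qed

lemma bernstein_path_measurable:
  assumes "\<And>i. i \<le> k \<Longrightarrow> Y i \<in> borel_measurable M"
  shows "(\<lambda>\<omega>. bernstein_path k (\<lambda>i. Y i \<omega>)) \<in> measurable M borel_C01"
proof -
  \<comment> \<open>Coordinates beyond \<open>k\<close> do not enter the polynomial but would have
    to be measurable in the product space; they are set to 0.\<close>
  define Y' where "Y' \<omega> = (\<lambda>i. if i \<le> k then Y i \<omega> else 0)" for \<omega>
  have "Y' \<in> borel_measurable M"
  proof (rule measurable_coordinatewise_then_product)
    fix i show "(\<lambda>\<omega>. Y' \<omega> i) \<in> borel_measurable M"
      using assms by (cases "i \<le> k") (auto simp: Y'_def)
  qed
  then have "{\<omega> \<in> space M. bernstein_path k (Y' \<omega>) \<in> V} \<in> sets M" if "openin (mtopology_of C01) V" for V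
    using measurable_sets[OF _ borel_open[OF open_vimage_bernstein_path[OF that, of k]], of Y' M]
    by (simp add: vimage_def Int_def conj_commute)
  moreover have "bernstein_path k (\<lambda>i. Y i \<omega>) = bernstein_path k (Y' \<omega>)" for \<omega>
    by (rule bernstein_path_cong) (simp add: Y'_def)
  ultimately show ?thesis
    unfolding borel_C01_def
    by (intro measurable_measure_of) (auto simp: openin_C01_iff vimage_def Int_def conj_commute)
qed

lemma path01_in_C01: "continuous_on {0..1} (\<lambda>t. Z t \<omega>) \<Longrightarrow> path01 Z \<omega> \<in> mspace C01"
  by (simp add: path01_def)

lemma bernstein_path_tendsto:
  assumes "continuous_on {0..1} f"
  shows "(\<lambda>k. mdist C01 (restrict f {0..1}) (bernstein_op k f)) \<longlonglongrightarrow> 0"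
proof (rule LIMSEQ_I)
  fix e :: real assume "e > 0"
  then obtain K where K: "\<And>k t. K \<le> k \<Longrightarrow> t \<in> {0..1} \<Longrightarrow>
      \<bar>f t - (\<Sum>i\<le>k. f (real i / real k) * Bernstein k i t)\<bar> < e/2"
    using Bernstein_Weierstrass[OF assms, of "e/2"] by (metis half_gt_zero)
  have "mdist C01 (restrict f {0..1}) (bernstein_op k f) \<le> e/2" if "k \<ge> K" for k
    using K[OF that] \<open>e > 0\<close> by (intro mdist_C01_le) (auto simp: bernstein_path_def less_imp_le)
  then show "\<exists>no. \<forall>k\<ge>no. norm (mdist C01 (restrict f {0..1}) (bernstein_op k f) - 0) < e"
    using \<open>e > 0\<close> by (intro exI[of _ K]) (fastforce simp: abs_of_nonneg)
qed

text \<open>The path is the limit of its Bernstein paths, each of which depends on finitely many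
  measurable values. This treats preimages of open sets directly, without describing the Borel sets
  of C([0,1]) by evaluations.\<close>

lemma path01_measurable:
  assumes Z: "\<And>t. t \<in> {0..1} \<Longrightarrow> Z t \<in> borel_measurable M"
    and cont: "\<And>\<omega>. \<omega> \<in> space M \<Longrightarrow> continuous_on {0..1} (\<lambda>t. Z t \<omega>)"
  shows "path01 Z \<in> measurable M borel_C01"
  unfolding borel_C01_def
proof (rule measurable_measure_of)
  show "path01 Z \<in> space M \<rightarrow> mspace C01" using path01_in_C01[OF cont] by auto
  fix U assume "U \<in> {U. openin (mtopology_of C01) U}"
  then have U: "openin (mtopology_of C01) U" by simp
  define P where "P k \<omega> = bernstein_op k (\<lambda>t. Z t \<omega>)" for k \<omega>
  have P: "P k \<in> measurable M borel_C01" for k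
    unfolding P_def by (intro bernstein_path_measurable Z) (auto simp: divide_le_eq_1)
  \<comment> \<open>An interior of \<open>U\<close> with a margin: a ball of some radius strictly
    above \<open>1 / (j + 1)\<close> stays in \<open>U\<close>. The strict excess is what makes
    \<open>V j\<close> open.\<close>
  define V where "V j = {f \<in> mspace C01. \<exists>s>inverse (real (Suc j)). \<forall>y\<in>mspace C01. mdist C01 f y < s \<longrightarrow> y \<in> U}" for j
  have "openin (mtopology_of C01) (V j)" for j
    unfolding openin_C01_iff
  proof (intro conjI ballI)
    fix f assume "f \<in> V j"
    then obtain s where f: "f \<in> mspace C01" and s: "s > inverse (real (Suc j))"
      "\<forall>y\<in>mspace C01. mdist C01 f y < s \<longrightarrow> y \<in> U" by (auto simp: V_def)
    define r where "r = (s - inverse (real (Suc j))) / 2"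
    have half: "(u - v) / 2 > 0 \<and> u - (u - v) / 2 > v" if "u > v" for u v :: real
      using that by (simp add: field_simps)
    have r: "r > 0" "s - r > inverse (real (Suc j))" using half[OF s(1)] by (auto simp only: r_def)
    have "g \<in> V j" if g: "g \<in> mspace C01" "mdist C01 f g < r" for g
    proof -
      have "y \<in> U" if "y \<in> mspace C01" "mdist C01 g y < s - r" for y
        using mdist_triangle[OF f g(1) that(1)] that g(2) s(2) by auto
      then show ?thesis using r(2) g(1) by (auto simp: V_def)
    qed
    with r(1) show "\<exists>r>0. \<forall>y\<in>mspace C01. mdist C01 f y < r \<longrightarrow> y \<in> V j" by blast
  qed (auto simp: V_def)
  then have meas: "P k -` V j \<inter> space M \<in> sets M" for k j
    using measurable_sets[OF P openin_sets_borel_C01] by blast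
  \<comment> \<open>Eventual membership of the approximants in the open set \<open>U\<close> would
    not put their limit in \<open>U\<close>; a margin \<open>1 / (j + 1)\<close> common to all large
    \<open>k\<close> does.\<close>
  have iff: "path01 Z \<omega> \<in> U \<longleftrightarrow> (\<exists>j N. \<forall>k\<ge>N. P k \<omega> \<in> V j)" if \<omega>: "\<omega> \<in> space M" for \<omega>
  proof
    let ?p = "path01 Z \<omega>"
    have lim: "(\<lambda>k. mdist C01 ?p (P k \<omega>)) \<longlonglongrightarrow> 0"
      using bernstein_path_tendsto[OF cont[OF \<omega>]] by (simp add: path01_def P_def)
    have p: "?p \<in> mspace C01" "P k \<omega> \<in> mspace C01" for k
      using path01_in_C01[of Z, OF cont[OF \<omega>]] by (auto simp: P_def)
    {
      assume "?p \<in> U"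
      then obtain s where s: "s > 0" "\<forall>y\<in>mspace C01. mdist C01 ?p y < s \<longrightarrow> y \<in> U"
        using U unfolding openin_C01_iff by blast
      obtain j where j: "inverse (real (Suc j)) < s / 2" using reals_Archimedean[of "s/2"] s by auto
      obtain N where N: "\<And>k. k \<ge> N \<Longrightarrow> mdist C01 ?p (P k \<omega>) < s / 2"
        using order_tendstoD(2)[OF lim, of "s/2"] s by (auto simp: eventually_sequentially)
      have "P k \<omega> \<in> V j" if "k \<ge> N" for k
      proof -
        have "y \<in> U" if y: "y \<in> mspace C01" "mdist C01 (P k \<omega>) y < s/2" for y
          using mdist_triangle[OF p(1) p(2) y(1), of k] N[OF \<open>k \<ge> N\<close>] y s(2) by auto
        then have "\<forall>y\<in>mspace C01. mdist C01 (P k \<omega>) y < s/2 \<longrightarrow> y \<in> U" by blast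
        then show ?thesis using j p(2)[of k] unfolding V_def by blast
      qed
      then show "\<exists>j N. \<forall>k\<ge>N. P k \<omega> \<in> V j" by blast
    next
      assume "\<exists>j N. \<forall>k\<ge>N. P k \<omega> \<in> V j"
      then obtain j N where N: "\<And>k. k \<ge> N \<Longrightarrow> P k \<omega> \<in> V j" by blast
      obtain N' where N': "\<And>k. k \<ge> N' \<Longrightarrow> mdist C01 ?p (P k \<omega>) < inverse (real (Suc j))"
        using order_tendstoD(2)[OF lim, of "inverse (real (Suc j))"] by (auto simp: eventually_sequentially)
      have "mdist C01 (P (max N N') \<omega>) ?p < inverse (real (Suc j))"
        using N'[of "max N N'"] by (simp add: mdist_commute)
      with N[of "max N N'"] p show "?p \<in> U" by (fastforce simp: V_def)
    }
  qed
  have "path01 Z -` U \<inter> space M = (\<Union>j. \<Union>N. \<Inter>k\<in>{N..}. P k -` V j \<inter> space M)"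
  proof (rule set_eqI)
    fix \<omega>
    show "\<omega> \<in> path01 Z -` U \<inter> space M \<longleftrightarrow> \<omega> \<in> (\<Union>j. \<Union>N. \<Inter>k\<in>{N..}. P k -` V j \<inter> space M)"
      using iff[of \<omega>] by (cases "\<omega> \<in> space M") (simp_all, simp add: Ball_def)
  qed
  also have "\<dots> \<in> sets M" by (intro sets.countable_UN'' sets.countable_INT' image_subsetI meas) auto
  finally show "path01 Z -` U \<inter> space M \<in> sets M" .
qed (auto simp: openin_C01_iff)

section \<open>Reduction to bounded Lipschitz functionals\<close>

definition bounded_lipschitz :: "((real \<Rightarrow> real) \<Rightarrow> real) \<Rightarrow> real \<Rightarrow> real \<Rightarrow> bool" where
  "bounded_lipschitz F L b \<longleftrightarrow> 0 \<le> L \<and> 0 \<le> b \<and> (\<forall>x\<in>mspace C01. \<bar>F x\<bar> \<le> b) \<and>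
     (\<forall>x\<in>mspace C01. \<forall>y\<in>mspace C01. \<bar>F x - F y\<bar> \<le> L * mdist C01 x y)"

lemma bounded_lipschitz_measurable:
  assumes "bounded_lipschitz F L b"
  shows "F \<in> borel_measurable borel_C01"
proof (rule continuous_map_borel_C01)
  have "Lipschitz_continuous_map C01 euclidean_metric F"
    using assms by (auto simp: Lipschitz_continuous_map_def bounded_lipschitz_def dist_real_def)
  from Lipschitz_continuous_imp_continuous_map[OF this]
  show "continuous_map (mtopology_of C01) euclideanreal F" by simp
qed

text \<open>The Pasch-Hausdorff envelope: for \<open>F\<close> bounded below it is the largest
  \<open>j\<close>-Lipschitz function below \<open>F\<close> on the space.\<close>

definition lipschitz_envelope :: "((real \<Rightarrow> real) \<Rightarrow> real) \<Rightarrow> nat \<Rightarrow> (real \<Rightarrow> real) \<Rightarrow> real" where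
  "lipschitz_envelope F j x = (INF y\<in>mspace C01. F y + real j * mdist C01 x y)"

lemma
  assumes F: "\<And>x. x \<in> mspace C01 \<Longrightarrow> 0 \<le> F x \<and> F x \<le> b"
  shows lipschitz_envelope_le: "x \<in> mspace C01 \<Longrightarrow> lipschitz_envelope F j x \<le> F x"
    and lipschitz_envelope_nonneg: "x \<in> mspace C01 \<Longrightarrow> 0 \<le> lipschitz_envelope F j x"
    and lipschitz_envelope_bounded_lipschitz: "bounded_lipschitz (lipschitz_envelope F j) (real j) b"
proof -
  have bdd: "bdd_below ((\<lambda>y. F y + real j * mdist C01 x y) ` mspace C01)" for x
    using F by (intro bdd_belowI2[of _ 0]) (simp add: add_nonneg_nonneg)
  show le: "lipschitz_envelope F j x \<le> F x" if "x \<in> mspace C01" for x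
    unfolding lipschitz_envelope_def using cINF_lower[OF bdd that, of x] mdist_zero[OF that that] by simp
  show ge: "0 \<le> lipschitz_envelope F j x" if "x \<in> mspace C01" for x
    unfolding lipschitz_envelope_def by (intro cINF_greatest mspace_C01_nonempty) (use F in \<open>simp add: add_nonneg_nonneg\<close>)
  have lip: "lipschitz_envelope F j x \<le> lipschitz_envelope F j y + real j * mdist C01 x y"
    if x: "x \<in> mspace C01" and y: "y \<in> mspace C01" for x y
  proof -
    have "lipschitz_envelope F j x - real j * mdist C01 x y \<le> F z + real j * mdist C01 y z" if z: "z \<in> mspace C01" for z
    proof -
      have "lipschitz_envelope F j x \<le> F z + real j * mdist C01 x z"
        unfolding lipschitz_envelope_def by (rule cINF_lower[OF bdd z])
      also have "\<dots> \<le> F z + real j * (mdist C01 x y + mdist C01 y z)"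
        using mdist_triangle[OF x y z] by (simp add: mult_left_mono)
      finally show ?thesis by (simp add: algebra_simps)
    qed
    then have "lipschitz_envelope F j x - real j * mdist C01 x y \<le> lipschitz_envelope F j y"
      unfolding lipschitz_envelope_def[of F j y] by (intro cINF_greatest mspace_C01_nonempty)
    then show ?thesis by simp
  qed
  have "0 \<le> b" using F mspace_C01_nonempty by (metis all_not_in_conv order_trans)
  moreover have "\<bar>lipschitz_envelope F j x\<bar> \<le> b" if "x \<in> mspace C01" for x
    using le[OF that] ge[OF that] F[OF that] by auto
  moreover have "\<bar>lipschitz_envelope F j x - lipschitz_envelope F j y\<bar> \<le> real j * mdist C01 x y"
    if "x \<in> mspace C01" "y \<in> mspace C01" for x y
    using lip[of x y] lip[of y x] that by (simp add: mdist_commute abs_le_iff)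
  ultimately show "bounded_lipschitz (lipschitz_envelope F j) (real j) b" by (simp add: bounded_lipschitz_def)
qed

lemma lipschitz_envelope_tendsto:
  assumes F: "\<And>x. x \<in> mspace C01 \<Longrightarrow> 0 \<le> F x \<and> F x \<le> b"
    and cont: "continuous_map (mtopology_of C01) euclideanreal F" and x: "x \<in> mspace C01"
  shows "(\<lambda>j. lipschitz_envelope F j x) \<longlonglongrightarrow> F x"
proof (rule LIMSEQ_I)
  fix e :: real assume e: "e > 0"
  have "openin (mtopology_of C01) {y \<in> topspace (mtopology_of C01). F y \<in> {F x - e/2<..}}"
    using cont by (intro openin_continuous_map_preimage) auto
  then obtain r where r: "r > 0" "\<And>y. y \<in> mspace C01 \<Longrightarrow> mdist C01 x y < r \<Longrightarrow> F x - e/2 < F y"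
    using x e unfolding openin_C01_iff by auto
  \<comment> \<open>Points at distance at least \<open>r\<close> are penalised by more than
    \<open>F x\<close>, and \<open>F\<close> is nonnegative, so they cannot push the infimum below
    \<open>F x\<close>; nearer points are covered by continuity.\<close>
  obtain J where J: "real J > F x / r" using reals_Archimedean2 by blast
  have "F x - e/2 \<le> lipschitz_envelope F j x" if "j \<ge> J" for j
    unfolding lipschitz_envelope_def
  proof (intro cINF_greatest mspace_C01_nonempty)
    fix y assume y: "y \<in> mspace C01"
    show "F x - e/2 \<le> F y + real j * mdist C01 x y"
    proof (cases "mdist C01 x y < r")
      case True
      have "0 \<le> real j * mdist C01 x y" by simp
      with r(2)[OF y True] show ?thesis by linarith
    next
      case False
      have "F x < real J * r" using J r(1) by (simp add: field_simps)
      also have "\<dots> \<le> real j * mdist C01 x y" using that False r(1) by (intro mult_mono) auto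
      finally show ?thesis using F[OF y] e by linarith
    qed
  qed
  moreover have "lipschitz_envelope F j x \<le> F x" for j by (rule lipschitz_envelope_le[OF F x])
  ultimately show "\<exists>no. \<forall>n\<ge>no. norm (lipschitz_envelope F n x - F x) < e"
    using e unfolding real_norm_def by (intro exI[of _ J]) (smt (verit) field_sum_of_halves)
qed

text \<open>Envelopes lie below a nonnegative functional and converge to it, so their limits give an
  asymptotic lower bound for its integrals. Applying this to \<open>b + F\<close> and
  \<open>b - F\<close> bounds the integrals of \<open>F\<close> on both sides.\<close>

lemma weak_conv_C01I:
  assumes \<mu>: "\<And>n. prob_space (\<mu> n)" "\<And>n. sets (\<mu> n) = sets borel_C01"
    and \<nu>: "prob_space \<nu>" "sets \<nu> = sets borel_C01"
    and lim: "\<And>F L b. bounded_lipschitz F L b \<Longrightarrow> (\<lambda>n. integral\<^sup>L (\<mu> n) F) \<longlonglongrightarrow> integral\<^sup>L \<nu> F"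
  shows "weak_conv_C01 \<mu> \<nu>"
proof -
  have sp: "space (\<mu> n) = mspace C01" "space \<nu> = mspace C01" for n
    using \<mu>(2)[THEN sets_eq_imp_space_eq] \<nu>(2)[THEN sets_eq_imp_space_eq] by auto
  have mb: "F \<in> borel_measurable (\<mu> n)" "F \<in> borel_measurable \<nu>"
    if "F \<in> borel_measurable borel_C01" for F :: "(real \<Rightarrow> real) \<Rightarrow> real" and n
    using that \<mu>(2)[of n] \<nu>(2) by (simp_all cong: measurable_cong_sets)
  have int: "integrable (\<mu> n) F" "integrable \<nu> F"
    if "F \<in> borel_measurable borel_C01" "\<And>x. x \<in> mspace C01 \<Longrightarrow> \<bar>F x\<bar> \<le> b" for F :: "(real \<Rightarrow> real) \<Rightarrow> real" and b n
  proof -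
    interpret m: prob_space "\<mu> n" by (rule \<mu>)
    interpret v: prob_space \<nu> by (rule \<nu>)
    show "integrable (\<mu> n) F" "integrable \<nu> F"
      using mb[OF that(1)] that(2) sp
      by (auto intro!: m.integrable_const_bound[where B=b] v.integrable_const_bound[where B=b])
  qed
  have low: "\<forall>\<^sub>F n in sequentially. integral\<^sup>L \<nu> F - e < integral\<^sup>L (\<mu> n) F"
    if F: "\<And>x. x \<in> mspace C01 \<Longrightarrow> 0 \<le> F x \<and> F x \<le> b"
      and cont: "continuous_map (mtopology_of C01) euclideanreal F" and e: "e > 0" for F b e
  proof -
    interpret v: prob_space \<nu> by (rule \<nu>)
    have Fm: "F \<in> borel_measurable borel_C01" by (rule continuous_map_borel_C01[OF cont])
    note env = lipschitz_envelope_bounded_lipschitz[OF F]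
    have envb: "\<bar>lipschitz_envelope F j x\<bar> \<le> b" if "x \<in> mspace C01" for j x
      using env that by (auto simp: bounded_lipschitz_def)
    have "(\<lambda>j. integral\<^sup>L \<nu> (lipschitz_envelope F j)) \<longlonglongrightarrow> integral\<^sup>L \<nu> F"
    proof (rule integral_dominated_convergence[where w="\<lambda>_. b"])
      show "F \<in> borel_measurable \<nu>" "lipschitz_envelope F j \<in> borel_measurable \<nu>" for j
        using mb(2)[OF Fm] mb(2)[OF bounded_lipschitz_measurable[OF env]] by auto
      show "AE x in \<nu>. (\<lambda>j. lipschitz_envelope F j x) \<longlonglongrightarrow> F x"
        by (rule AE_I2) (use lipschitz_envelope_tendsto[OF F cont] sp in simp)
      show "AE x in \<nu>. norm (lipschitz_envelope F j x) \<le> b" for j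
        by (rule AE_I2) (use envb sp in simp)
    qed simp
    then have "\<forall>\<^sub>F j in sequentially. integral\<^sup>L \<nu> F - e / 2 < integral\<^sup>L \<nu> (lipschitz_envelope F j)"
      using e by (intro order_tendstoD) auto
    then obtain j where j: "integral\<^sup>L \<nu> F - e / 2 < integral\<^sup>L \<nu> (lipschitz_envelope F j)"
      by (auto simp: eventually_sequentially)
    have "\<forall>\<^sub>F n in sequentially. integral\<^sup>L \<nu> (lipschitz_envelope F j) - e / 2 < integral\<^sup>L (\<mu> n) (lipschitz_envelope F j)"
      by (rule order_tendstoD(1)[OF lim[OF env]]) (use e in auto)
    then show ?thesis
    proof eventually_elim
      case (elim n)
      have "integral\<^sup>L (\<mu> n) (lipschitz_envelope F j) \<le> integral\<^sup>L (\<mu> n) F"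
      proof (rule integral_mono)
        show "integrable (\<mu> n) (lipschitz_envelope F j)" using int(1)[OF bounded_lipschitz_measurable[OF env] envb] .
        show "integrable (\<mu> n) F" by (rule int(1)[OF Fm, of b]) (use F in fastforce)
      qed (use lipschitz_envelope_le[OF F] sp in auto)
      with elim j show ?case by argo
    qed
  qed
  show ?thesis
    unfolding weak_conv_C01_def
  proof (intro allI impI)
    fix F assume "continuous_map (mtopology_of C01) euclideanreal F \<and> bounded (F ` mspace C01)"
    then obtain b where cont: "continuous_map (mtopology_of C01) euclideanreal F"
      and b: "\<And>x. x \<in> mspace C01 \<Longrightarrow> \<bar>F x\<bar> \<le> b" by (auto simp: bounded_iff)
    have Fm: "F \<in> borel_measurable borel_C01" by (rule continuous_map_borel_C01[OF cont])
    have s1: "integral\<^sup>L (\<mu> n) (\<lambda>x. b + F x) = b + integral\<^sup>L (\<mu> n) F"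
         "integral\<^sup>L (\<mu> n) (\<lambda>x. b - F x) = b - integral\<^sup>L (\<mu> n) F" for n
    proof -
      interpret m: prob_space "\<mu> n" by (rule \<mu>)
      show "integral\<^sup>L (\<mu> n) (\<lambda>x. b + F x) = b + integral\<^sup>L (\<mu> n) F"
         "integral\<^sup>L (\<mu> n) (\<lambda>x. b - F x) = b - integral\<^sup>L (\<mu> n) F"
        using int(1)[OF Fm b] by (simp_all add: m.prob_space)
    qed
    have s2: "integral\<^sup>L \<nu> (\<lambda>x. b + F x) = b + integral\<^sup>L \<nu> F"
         "integral\<^sup>L \<nu> (\<lambda>x. b - F x) = b - integral\<^sup>L \<nu> F"
    proof -
      interpret m: prob_space \<nu> by (rule \<nu>)
      show "integral\<^sup>L \<nu> (\<lambda>x. b + F x) = b + integral\<^sup>L \<nu> F"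
         "integral\<^sup>L \<nu> (\<lambda>x. b - F x) = b - integral\<^sup>L \<nu> F"
        using int(2)[OF Fm b] by (simp_all add: m.prob_space)
    qed
    show "(\<lambda>n. integral\<^sup>L (\<mu> n) F) \<longlonglongrightarrow> integral\<^sup>L \<nu> F"
    proof (rule LIMSEQ_I)
      fix e :: real assume e: "e > 0"
      have "\<forall>\<^sub>F n in sequentially. integral\<^sup>L \<nu> (\<lambda>x. b + F x) - e < integral\<^sup>L (\<mu> n) (\<lambda>x. b + F x)"
      proof (rule low[where b="2*b"])
        show "0 \<le> b + F x \<and> b + F x \<le> 2 * b" if "x \<in> mspace C01" for x
          using b[OF that] by linarith
        show "continuous_map (mtopology_of C01) euclideanreal (\<lambda>x. b + F x)"
          by (intro continuous_map_add cont) simp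
      qed (rule e)
      moreover have "\<forall>\<^sub>F n in sequentially. integral\<^sup>L \<nu> (\<lambda>x. b - F x) - e < integral\<^sup>L (\<mu> n) (\<lambda>x. b - F x)"
      proof (rule low[where b="2*b"])
        show "0 \<le> b - F x \<and> b - F x \<le> 2 * b" if "x \<in> mspace C01" for x
          using b[OF that] by linarith
        show "continuous_map (mtopology_of C01) euclideanreal (\<lambda>x. b - F x)"
          by (intro continuous_map_diff cont) simp
      qed (rule e)
      ultimately have "\<forall>\<^sub>F n in sequentially. norm (integral\<^sup>L (\<mu> n) F - integral\<^sup>L \<nu> F) < e"
        by eventually_elim (unfold s1 s2 real_norm_def, linarith)
      then show "\<exists>no. \<forall>n\<ge>no. norm (integral\<^sup>L (\<mu> n) F - integral\<^sup>L \<nu> F) < e"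
        by (simp add: eventually_sequentially)
    qed
  qed
qed

section \<open>The renewal equation\<close>

text \<open>Under the kernel hypotheses and for \<open>a < 1\<close>, this is the renewal sequence
  of the defective law \<open>a * \<phi>\<close>.\<close>

definition impulse_response :: "real \<Rightarrow> (nat \<Rightarrow> real) \<Rightarrow> nat \<Rightarrow> real" where
  "impulse_response a \<phi> = ar_seq a \<phi> (\<lambda>k. if k = 0 then 1 else 0)"

text \<open>The mass of \<open>\<phi>\<close> beyond \<open>k\<close> when the total mass is 1;
  written with a finite sum so that the renewal identities are finite algebra.\<close>

definition tail_mass :: "(nat \<Rightarrow> real) \<Rightarrow> nat \<Rightarrow> real" where
  "tail_mass \<phi> k = 1 - (\<Sum>i<k. \<phi> (Suc i))"

text \<open>For a probability kernel and \<open>0 \<le> a < 1\<close>, the distribution function of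
  a sum of a geometric number of independent variables with law \<open>\<phi>\<close>. This explains
  its values in the unit interval and its exponential limit as \<open>a\<close> tends to 1 (Renyi's
  theorem).\<close>

definition step_response :: "real \<Rightarrow> (nat \<Rightarrow> real) \<Rightarrow> nat \<Rightarrow> real" where
  "step_response a \<phi> k = (1 - a) * (\<Sum>i\<le>k. impulse_response a \<phi> i)"

lemma sum_convolution_partial:
  fixes f g :: "nat \<Rightarrow> real"
  shows "(\<Sum>k\<le>n. \<Sum>i\<le>k. f i * g (k - i)) = (\<Sum>i\<le>n. f i * (\<Sum>j\<le>n - i. g j))"
proof (induction n)
  case (Suc n)
  have "(\<Sum>i\<le>Suc n. f i * (\<Sum>j\<le>Suc n - i. g j))
      = (\<Sum>i\<le>n. f i * ((\<Sum>j\<le>n - i. g j) + g (Suc n - i))) + f (Suc n) * g 0"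
    by (simp add: Suc_diff_le)
  also have "\<dots> = (\<Sum>i\<le>n. f i * (\<Sum>j\<le>n - i. g j)) + (\<Sum>i\<le>Suc n. f i * g (Suc n - i))"
    by (simp add: distrib_left sum.distrib)
  finally show ?case using Suc by simp
qed simp

lemma ar_seq_Suc_shift:
  "ar_seq a \<phi> e (Suc k) = e (Suc k) + a * (\<Sum>i\<le>k. \<phi> (Suc i) * ar_seq a \<phi> e (k - i))"
proof -
  have "(\<Sum>i\<in>{1..Suc k}. a * \<phi> i * ar_seq a \<phi> e (Suc k - i))
      = (\<Sum>i\<in>{0..k}. a * \<phi> (Suc i) * ar_seq a \<phi> e (k - i))"
    using sum.shift_bounds_cl_Suc_ivl[of "\<lambda>i. a * \<phi> i * ar_seq a \<phi> e (Suc k - i)" 0 k]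
    by simp
  then show ?thesis by (simp add: sum_distrib_left mult.assoc atLeast0AtMost)
qed

declare ar_seq.simps(2) [simp del]

lemma impulse_response_0 [simp]: "impulse_response a \<phi> 0 = 1"
  by (simp add: impulse_response_def)

lemma impulse_response_Suc:
  "impulse_response a \<phi> (Suc k) = a * (\<Sum>i\<le>k. \<phi> (Suc i) * impulse_response a \<phi> (k - i))"
  unfolding impulse_response_def by (subst ar_seq_Suc_shift) simp

text \<open>The recursion is linear and homogeneous in time, so shifted impulse responses superpose;
  the induction step only exchanges the two sums over a triangle.\<close>

lemma ar_seq_eq_convolution:
  "ar_seq a \<phi> e k = (\<Sum>j\<le>k. impulse_response a \<phi> (k - j) * e j)"
proof (induction k rule: less_induct)
  case (less k)
  show ?case
  proof (cases k)
    case (Suc n)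
    have "(\<Sum>i\<le>n. \<phi> (Suc i) * ar_seq a \<phi> e (n - i))
        = (\<Sum>i\<le>n. \<Sum>j\<le>n - i. \<phi> (Suc i) * impulse_response a \<phi> (n - i - j) * e j)"
      using less Suc by (intro sum.cong) (auto simp: sum_distrib_left mult.assoc)
    also have "\<dots> = (\<Sum>(i,j)\<in>{(i,j). i + j \<le> n}. \<phi> (Suc i) * impulse_response a \<phi> (n - i - j) * e j)"
      by (subst sum.Sigma) (auto intro!: sum.cong)
    also have "\<dots> = (\<Sum>(j,i)\<in>{(j,i). j + i \<le> n}. \<phi> (Suc i) * impulse_response a \<phi> (n - j - i) * e j)"
      by (rule sum.reindex_bij_witness[where i=prod.swap and j=prod.swap])
         (auto simp: add.commute diff_commute)
    also have "\<dots> = (\<Sum>j\<le>n. \<Sum>i\<le>n - j. \<phi> (Suc i) * impulse_response a \<phi> (n - j - i) * e j)"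
      by (subst sum.Sigma) (auto intro!: sum.cong)
    finally have "a * (\<Sum>i\<le>n. \<phi> (Suc i) * ar_seq a \<phi> e (n - i))
        = (\<Sum>j\<le>n. impulse_response a \<phi> (Suc (n - j)) * e j)"
      by (simp add: impulse_response_Suc sum_distrib_left sum_distrib_right mult.assoc)
    then show ?thesis
      unfolding Suc by (subst ar_seq_Suc_shift) (simp add: Suc_diff_le)
  qed simp
qed

lemma sum_ar_seq:
  "(\<Sum>k\<le>n. ar_seq a \<phi> e k) = (\<Sum>j\<le>n. (\<Sum>i\<le>n - j. impulse_response a \<phi> i) * e j)"
  using sum_convolution_partial[of e "impulse_response a \<phi>" n]
  by (simp add: ar_seq_eq_convolution mult.commute)

text \<open>Since \<open>tail_mass \<phi> (Suc i) = tail_mass \<phi> i - \<phi> (Suc i)\<close>,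
  passing from \<open>k\<close> to \<open>Suc k\<close> changes the sum by the new impulse response
  minus the convolution in its recursion. Probabilistically, the event that the geometric sum
  exceeds \<open>k\<close> is split by the last partial sum not exceeding \<open>k\<close>.\<close>

lemma renewal_identity:
  "a * (\<Sum>i\<le>k. tail_mass \<phi> i * impulse_response a \<phi> (k - i)) = 1 - step_response a \<phi> k"
proof (induction k)
  case (Suc k)
  have "(\<Sum>i\<le>Suc k. tail_mass \<phi> i * impulse_response a \<phi> (Suc k - i))
      = impulse_response a \<phi> (Suc k) + (\<Sum>i\<le>k. tail_mass \<phi> (Suc i) * impulse_response a \<phi> (k - i))"
    by (subst sum.atMost_Suc_shift) (simp add: tail_mass_def)
  also have "(\<Sum>i\<le>k. tail_mass \<phi> (Suc i) * impulse_response a \<phi> (k - i))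
      = (\<Sum>i\<le>k. tail_mass \<phi> i * impulse_response a \<phi> (k - i)) - (\<Sum>i\<le>k. \<phi> (Suc i) * impulse_response a \<phi> (k - i))"
    by (simp add: tail_mass_def left_diff_distrib sum_subtractf sum.distrib distrib_right)
  finally have eq: "(\<Sum>i\<le>Suc k. tail_mass \<phi> i * impulse_response a \<phi> (Suc k - i)) = impulse_response a \<phi> (Suc k)
      + ((\<Sum>i\<le>k. tail_mass \<phi> i * impulse_response a \<phi> (k - i)) - (\<Sum>i\<le>k. \<phi> (Suc i) * impulse_response a \<phi> (k - i)))" .
  have "step_response a \<phi> (Suc k) = step_response a \<phi> k + (1 - a) * impulse_response a \<phi> (Suc k)"
    by (simp add: step_response_def distrib_left)
  then show ?case
    unfolding eq using Suc impulse_response_Suc[of a \<phi> k]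
    by (simp add: distrib_left right_diff_distrib left_diff_distrib)
qed (simp add: tail_mass_def step_response_def)

text \<open>Summing \<open>renewal_identity\<close> over time turns impulse responses into step
  responses. The tail weights have short memory on the scale \<open>n\<close>, so the left side is
  nearly \<open>a * m * step_response a \<phi> k\<close>: a discrete form of
  \<open>m q' = l (1 - q)\<close>.\<close>

lemma renewal_identity_sum:
  "a * (\<Sum>i\<le>k. tail_mass \<phi> i * step_response a \<phi> (k - i)) = (1 - a) * (\<Sum>i\<le>k. 1 - step_response a \<phi> i)"
proof -
  have "(\<Sum>j\<le>k. 1 - step_response a \<phi> j) = a * (\<Sum>j\<le>k. \<Sum>i\<le>j. tail_mass \<phi> i * impulse_response a \<phi> (j - i))"
    by (simp add: renewal_identity[symmetric] sum_distrib_left)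
  also have "\<dots> = a * (\<Sum>i\<le>k. tail_mass \<phi> i * (\<Sum>j\<le>k - i. impulse_response a \<phi> j))"
    by (subst sum_convolution_partial) simp
  finally show ?thesis
    by (simp add: step_response_def sum_distrib_left mult_ac)
qed

section \<open>Probability kernels with finite mean\<close>

locale kernel =
  fixes \<phi> :: "nat \<Rightarrow> real" and m :: real
  assumes nonneg: "\<And>i. i \<ge> 1 \<Longrightarrow> \<phi> i \<ge> 0"
    and sums1: "(\<lambda>i. \<phi> (Suc i)) sums 1"
    and mean: "(\<lambda>i. real (Suc i) * \<phi> (Suc i)) sums m"
begin

lemma tail_mass_nonneg: "0 \<le> tail_mass \<phi> k"
  using sum_le_suminf[of "\<lambda>i. \<phi> (Suc i)" "{..<k}"] sums1 nonneg
  by (auto simp: tail_mass_def sums_iff)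

lemma sum_le_1: "(\<Sum>i<k. \<phi> (Suc i)) \<le> 1"
  using tail_mass_nonneg[of k] by (simp add: tail_mass_def)

lemma m_ge_1: "1 \<le> m"
  by (rule sums_le[OF _ sums1 mean]) (use mult_right_mono[of 1 "real (Suc _)" "\<phi> (Suc _)"] nonneg in simp)

lemma tail_mass_sums: "tail_mass \<phi> sums m"
proof -
  \<comment> \<open>Summation by parts: the partial sums differ from those of the mean by a boundary
    term, which must be shown to vanish.\<close>
  have eq: "(\<Sum>i<n. tail_mass \<phi> i) = (\<Sum>i<n. real (Suc i) * \<phi> (Suc i)) + real n * tail_mass \<phi> n" for n
    by (induction n) (auto simp: tail_mass_def algebra_simps)
  \<comment> \<open>The boundary term is at most the tail of the convergent mean series, because
    every index in that tail has weight at least \<open>n\<close>.\<close>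
  have tail_le: "real n * tail_mass \<phi> n \<le> m - (\<Sum>i<n. real (Suc i) * \<phi> (Suc i))" for n
  proof (rule LIMSEQ_le)
    show "(\<lambda>k. real n * ((\<Sum>i<k. \<phi> (Suc i)) - (\<Sum>i<n. \<phi> (Suc i)))) \<longlonglongrightarrow> real n * tail_mass \<phi> n"
      unfolding tail_mass_def by (intro tendsto_intros) (use sums1 in \<open>simp add: sums_def\<close>)
    show "(\<lambda>k. (\<Sum>i<k. real (Suc i) * \<phi> (Suc i)) - (\<Sum>i<n. real (Suc i) * \<phi> (Suc i)))
        \<longlonglongrightarrow> m - (\<Sum>i<n. real (Suc i) * \<phi> (Suc i))"
      by (intro tendsto_intros) (use mean in \<open>simp add: sums_def\<close>)
    have "real n * ((\<Sum>i<k. \<phi> (Suc i)) - (\<Sum>i<n. \<phi> (Suc i)))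
        \<le> (\<Sum>i<k. real (Suc i) * \<phi> (Suc i)) - (\<Sum>i<n. real (Suc i) * \<phi> (Suc i))" if "k \<ge> n" for k
    proof -
      have split: "(\<Sum>i<k. f i) - (\<Sum>i<n. f i) = (\<Sum>i=n..<k. f i)" for f :: "nat \<Rightarrow> real"
        using sum_diff_nat_ivl[of 0 n k f] that by (simp add: atLeast0LessThan)
      show ?thesis unfolding split sum_distrib_left
        by (intro sum_mono mult_right_mono) (auto intro: nonneg)
    qed
    then show "\<exists>N. \<forall>k\<ge>N. real n * ((\<Sum>i<k. \<phi> (Suc i)) - (\<Sum>i<n. \<phi> (Suc i)))
        \<le> (\<Sum>i<k. real (Suc i) * \<phi> (Suc i)) - (\<Sum>i<n. real (Suc i) * \<phi> (Suc i))" by blast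
  qed
  have lim0: "(\<lambda>n. m - (\<Sum>i<n. real (Suc i) * \<phi> (Suc i))) \<longlonglongrightarrow> m - m"
    by (intro tendsto_intros) (use mean in \<open>simp add: sums_def\<close>)
  have "(\<lambda>n. real n * tail_mass \<phi> n) \<longlonglongrightarrow> 0"
    by (rule tendsto_sandwich[OF _ _ tendsto_const])
       (use tail_le tail_mass_nonneg lim0 in \<open>auto simp: always_eventually\<close>)
  then have "(\<lambda>n. (\<Sum>i<n. real (Suc i) * \<phi> (Suc i)) + real n * tail_mass \<phi> n) \<longlonglongrightarrow> m + 0"
    by (intro tendsto_add) (use mean in \<open>simp_all add: sums_def\<close>)
  then show ?thesis by (simp add: sums_def eq)
qed

text \<open>Each new value is \<open>a\<close> times a combination of earlier ones with nonnegative
  weights of total at most 1.\<close>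

lemma impulse_response_bounds:
  assumes "0 \<le> a" "a \<le> 1"
  shows "0 \<le> impulse_response a \<phi> k \<and> impulse_response a \<phi> k \<le> 1"
proof (induction k rule: less_induct)
  case (less k)
  show ?case
  proof (cases k)
    case (Suc n)
    have *: "0 \<le> impulse_response a \<phi> (n - i)" "impulse_response a \<phi> (n - i) \<le> 1" for i
      using less[of "n - i"] Suc by auto
    have "(\<Sum>i\<le>n. \<phi> (Suc i) * impulse_response a \<phi> (n - i)) \<le> (\<Sum>i\<le>n. \<phi> (Suc i) * 1)"
      by (intro sum_mono mult_left_mono) (use * nonneg in auto)
    also have "\<dots> \<le> 1" using sum_le_1[of "Suc n"] by (simp add: lessThan_Suc_atMost)
    finally have 1: "(\<Sum>i\<le>n. \<phi> (Suc i) * impulse_response a \<phi> (n - i)) \<le> 1" .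
    have "0 \<le> (\<Sum>i\<le>n. \<phi> (Suc i) * impulse_response a \<phi> (n - i))"
      by (intro sum_nonneg mult_nonneg_nonneg) (use * nonneg in auto)
    with 1 show ?thesis unfolding Suc impulse_response_Suc
      using assms by (auto intro: mult_le_one)
  qed simp
qed

lemma step_response_bounds:
  assumes "0 \<le> a" "a \<le> 1"
  shows "0 \<le> step_response a \<phi> k" "step_response a \<phi> k \<le> 1"
proof -
  note ib = impulse_response_bounds[OF assms]
  show "0 \<le> step_response a \<phi> k"
    unfolding step_response_def using ib assms by (intro mult_nonneg_nonneg sum_nonneg) auto
  \<comment> \<open>The upper bound is the nonnegativity of the left side of
    \<open>renewal_identity\<close>.\<close>
  have "0 \<le> a * (\<Sum>i\<le>k. tail_mass \<phi> i * impulse_response a \<phi> (k - i))"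
    using ib assms tail_mass_nonneg by (intro mult_nonneg_nonneg sum_nonneg) auto
  then show "step_response a \<phi> k \<le> 1" by (simp add: renewal_identity)
qed

lemma step_response_Suc_diff:
  assumes "0 \<le> a" "a \<le> 1"
  shows "0 \<le> step_response a \<phi> (Suc k) - step_response a \<phi> k" "step_response a \<phi> (Suc k) - step_response a \<phi> k \<le> 1 - a"
proof -
  have "step_response a \<phi> (Suc k) - step_response a \<phi> k = (1 - a) * impulse_response a \<phi> (Suc k)"
    by (simp add: step_response_def algebra_simps)
  then show "0 \<le> step_response a \<phi> (Suc k) - step_response a \<phi> k" "step_response a \<phi> (Suc k) - step_response a \<phi> k \<le> 1 - a"
    using impulse_response_bounds[OF assms, of "Suc k"] assms by (auto simp: mult_left_le)
qed

lemma step_response_diff: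
  assumes "0 \<le> a" "a \<le> 1" "i \<le> k"
  shows "\<bar>step_response a \<phi> (k - i) - step_response a \<phi> k\<bar> \<le> (1 - a) * real i"
proof -
  have "0 \<le> step_response a \<phi> (j + i) - step_response a \<phi> j \<and> step_response a \<phi> (j + i) - step_response a \<phi> j \<le> (1 - a) * real i" for j
  proof (induction i)
    case (Suc i)
    then show ?case using step_response_Suc_diff[OF assms(1,2), of "j + i"] by (simp add: algebra_simps)
  qed simp
  from this[of "k - i"] assms(3) show ?thesis by simp
qed

lemma step_response_le:
  assumes "0 \<le> a" "a \<le> 1"
  shows "step_response a \<phi> k \<le> (1 - a) * real (Suc k)"
  using step_response_diff[OF assms, of k k] step_response_bounds[OF assms, of k]
  by (simp add: step_response_def algebra_simps)

text \<open>The cost of replacing \<open>step_response a \<phi> (k - i)\<close> by its value at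
  \<open>k\<close> under the tail weights. The Lipschitz bound \<open>(1 - a) * i\<close> alone
  would call for a second moment of \<open>\<phi>\<close>; the minimum with 1 keeps the series
  summable under a finite mean.\<close>

definition renewal_err :: "real \<Rightarrow> real" where
  "renewal_err a = (\<Sum>i. tail_mass \<phi> i * min 1 ((1 - a) * real i))"

lemma renewal_err_summable:
  assumes "0 \<le> a" "a \<le> 1"
  shows "summable (\<lambda>i. tail_mass \<phi> i * min 1 ((1 - a) * real i))"
proof (rule summable_comparison_test'[of "tail_mass \<phi>" 0])
  show "summable (tail_mass \<phi>)" using tail_mass_sums by (simp add: sums_iff)
  show "norm (tail_mass \<phi> n * min 1 ((1 - a) * real n)) \<le> tail_mass \<phi> n" for n
    using tail_mass_nonneg[of n] assms by (simp add: abs_mult mult_left_le)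
qed

lemma renewal_approx:
  assumes "0 < a" "a \<le> 1"
  shows "\<bar>m * step_response a \<phi> k - (1 - a) / a * (\<Sum>i\<le>k. 1 - step_response a \<phi> i)\<bar> \<le> renewal_err a"
proof -
  \<comment> \<open>Beyond \<open>k\<close> the convolution is continued by 0. The Lipschitz bound
    persists there, since \<open>step_response a \<phi> k \<le> (1 - a) * (k + 1) \<le> (1 - a) *
    i\<close> for \<open>i > k\<close>.\<close>
  define x where "x i = (if i \<le> k then step_response a \<phi> (k - i) else 0)" for i
  have a: "0 \<le> a" using assms by simp
  note b = step_response_bounds[OF a assms(2)]
  have "(\<lambda>i. if i \<in> {..k} then tail_mass \<phi> i * step_response a \<phi> (k - i) else 0) sums (\<Sum>i\<le>k. tail_mass \<phi> i * step_response a \<phi> (k - i))"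
    by (rule sums_If_finite_set) simp
  then have s1: "(\<lambda>i. tail_mass \<phi> i * x i) sums (\<Sum>i\<le>k. tail_mass \<phi> i * step_response a \<phi> (k - i))"
    by (rule back_subst[where P="\<lambda>f. f sums _"]) (auto simp: x_def)
  have s2: "(\<lambda>i. tail_mass \<phi> i * (step_response a \<phi> k - x i)) sums
      (m * step_response a \<phi> k - (\<Sum>i\<le>k. tail_mass \<phi> i * step_response a \<phi> (k - i)))"
    using sums_diff[OF sums_mult2[OF tail_mass_sums, of "step_response a \<phi> k"] s1] by (simp add: right_diff_distrib)
  have le: "\<bar>tail_mass \<phi> i * (step_response a \<phi> k - x i)\<bar> \<le> tail_mass \<phi> i * min 1 ((1 - a) * real i)" for i
  proof -
    have "\<bar>step_response a \<phi> k - x i\<bar> \<le> 1"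
      using b[of k] b[of "k - i"] by (auto simp: x_def)
    moreover have "\<bar>step_response a \<phi> k - x i\<bar> \<le> (1 - a) * real i"
    proof (cases "i \<le> k")
      case True then show ?thesis using step_response_diff[OF a assms(2) True] by (simp add: x_def abs_minus_commute)
    next
      case False
      have "step_response a \<phi> k \<le> (1 - a) * real (Suc k)" by (rule step_response_le[OF a assms(2)])
      also have "\<dots> \<le> (1 - a) * real i" using False assms by (intro mult_left_mono) auto
      finally show ?thesis using False b[of k] by (simp add: x_def)
    qed
    ultimately show ?thesis using tail_mass_nonneg[of i] by (simp add: abs_mult mult_left_mono)
  qed
  have "\<bar>m * step_response a \<phi> k - (\<Sum>i\<le>k. tail_mass \<phi> i * step_response a \<phi> (k - i))\<bar> \<le> renewal_err a"
    unfolding sums_unique[OF s2] renewal_err_def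
    using norm_suminf_le[of "\<lambda>i. tail_mass \<phi> i * (step_response a \<phi> k - x i)", OF _ renewal_err_summable[OF a assms(2)]] le
    by auto
  moreover have "(1 - a) / a * (\<Sum>i\<le>k. 1 - step_response a \<phi> i) = (\<Sum>i\<le>k. tail_mass \<phi> i * step_response a \<phi> (k - i))"
    using renewal_identity_sum[where a=a and \<phi>=\<phi> and k=k] assms by (simp add: field_simps)
  ultimately show ?thesis by simp
qed

text \<open>Dominated convergence for series: each term vanishes as \<open>a n\<close> tends to 1,
  and the summable tail weights dominate.\<close>

lemma renewal_err_tendsto_0:
  assumes a: "\<And>n. n \<ge> 1 \<Longrightarrow> 0 \<le> a n \<and> a n < 1" and lim: "a \<longlonglongrightarrow> 1"
  shows "(\<lambda>n. renewal_err (a n)) \<longlonglongrightarrow> 0"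
proof -
  have "(\<lambda>n. \<Sum>i. tail_mass \<phi> i * min 1 ((1 - a n) * real i)) \<longlonglongrightarrow> (\<Sum>i. 0::real)"
  proof (rule tannerys_theorem[THEN conjunct2, THEN conjunct2])
    show "((\<lambda>n. tail_mass \<phi> k * min 1 ((1 - a n) * real k)) \<longlongrightarrow> 0) sequentially" for k
    proof -
      have "(\<lambda>n. tail_mass \<phi> k * min 1 ((1 - a n) * real k)) \<longlonglongrightarrow> tail_mass \<phi> k * min 1 ((1 - 1) * real k)"
        by (intro tendsto_intros lim)
      then show ?thesis by simp
    qed
    show "eventually (\<lambda>(k,n). norm (tail_mass \<phi> k * min 1 ((1 - a n) * real k)) \<le> tail_mass \<phi> k)
        (at_top \<times>\<^sub>F sequentially)"
      unfolding eventually_prod_sequentially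
    proof (intro exI[of _ 1] allI impI)
      fix k n :: nat assume "1 \<le> n"
      with a[of n] show "case (k, n) of (k, n) \<Rightarrow> norm (tail_mass \<phi> k * min 1 ((1 - a n) * real k)) \<le> tail_mass \<phi> k"
        using tail_mass_nonneg[of k] by (simp add: abs_mult mult_left_le)
    qed
    show "summable (tail_mass \<phi>)" using tail_mass_sums by (simp add: sums_iff)
  qed simp
  then show ?thesis by (simp add: renewal_err_def)
qed

end

section \<open>Exponential limit of the step response\<close>

lemma discrete_gronwall:
  fixes d :: "nat \<Rightarrow> real"
  assumes "\<And>k. k \<le> n \<Longrightarrow> d k \<le> \<eta> + c * (\<Sum>i<k. d i)" "0 \<le> c" "k \<le> n"
  shows "d k \<le> \<eta> * (1 + c) ^ k"
proof -
  \<comment> \<open>The induction bounds the whole right side of the hypothesis, which dominates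
    \<open>d k\<close> and reproduces itself with factor \<open>1 + c\<close>.\<close>
  have "\<eta> + c * (\<Sum>i<k. d i) \<le> \<eta> * (1 + c) ^ k" using assms(3)
  proof (induction k)
    case (Suc k)
    have "\<eta> + c * (\<Sum>i<Suc k. d i) = (\<eta> + c * (\<Sum>i<k. d i)) + c * d k" by (simp add: algebra_simps)
    also have "\<dots> \<le> (\<eta> + c * (\<Sum>i<k. d i)) + c * (\<eta> + c * (\<Sum>i<k. d i))"
      using assms(1)[of k] Suc.prems assms(2) by (intro add_mono mult_left_mono) auto
    also have "\<dots> = (1 + c) * (\<eta> + c * (\<Sum>i<k. d i))" by (simp add: algebra_simps)
    also have "\<dots> \<le> (1 + c) * (\<eta> * (1 + c) ^ k)"
      using Suc assms(2) by (intro mult_left_mono) auto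
    finally show ?case by (simp add: mult_ac)
  qed simp
  with assms(1)[OF assms(3)] show ?thesis by linarith
qed

lemma exp_riemann_sum:
  fixes x :: real
  assumes "0 \<le> x"
  shows "\<bar>(1 - exp (- x * real k)) - x * (\<Sum>i\<le>k. exp (- x * real i))\<bar> \<le> x"
proof -
  define r where "r = exp (- x)"
  have e: "exp (- x * real i) = r ^ i" for i
    by (simp add: r_def exp_of_nat_mult[symmetric] mult.commute)
  have r: "0 \<le> r" "1 - x \<le> r" by (auto simp: r_def exp_ge_add_one_self[of "-x", simplified])
  have r2: "x * r \<le> 1 - r"
  proof -
    have "(1 + x) * exp (- x) \<le> exp x * exp (- x)" by (intro mult_right_mono exp_ge_add_one_self) auto
    then show ?thesis by (simp add: r_def exp_minus algebra_simps)
  qed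
  \<comment> \<open>The sum is a left Riemann sum of the decreasing function
    \<open>x * exp (- x * s)\<close> over \<open>[0, k + 1]\<close>; without its first term
    \<open>x\<close> it is a right Riemann sum over \<open>[0, k]\<close>. The middle conjunct at
    \<open>k\<close> gives the first one at \<open>Suc k\<close>.\<close>
  have "1 - r ^ k \<le> x * (\<Sum>i\<le>k. r ^ i) \<and> 1 - r ^ Suc k \<le> x * (\<Sum>i\<le>k. r ^ i)
      \<and> x * (\<Sum>i\<le>k. r ^ i) - x \<le> 1 - r ^ k"
  proof (induction k)
    case (Suc k)
    have "(1 - x) * r ^ Suc k \<le> r * r ^ Suc k" "x * r * r ^ k \<le> (1 - r) * r ^ k"
      "0 \<le> x * r ^ Suc k"
      using r r2 assms by (auto intro!: mult_right_mono mult_nonneg_nonneg simp del: power_Suc)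
    then show ?case using Suc by (simp add: algebra_simps)
  qed (use assms r in auto)
  then show ?thesis unfolding e by linarith
qed

context kernel
begin

text \<open>The limit \<open>1 - exp (- \<beta> s)\<close> satisfies the same integral equation up
  to a Riemann error, so the difference obeys a linear inequality with small forcing. Gronwall over
  at most \<open>n\<close> steps of size of order \<open>\<beta> / n\<close> costs only a bounded
  factor.\<close>

theorem step_response_tendsto_uniformly:
  fixes a :: "nat \<Rightarrow> real"
  assumes a: "\<And>n. n \<ge> 1 \<Longrightarrow> 0 \<le> a n \<and> a n < 1" and l: "l > 0"
    and lim: "(\<lambda>n. real n * (1 - a n)) \<longlonglongrightarrow> l" and e: "e > 0"
  shows "\<forall>\<^sub>F n in sequentially. \<forall>k\<le>n. \<bar>step_response (a n) \<phi> k - (1 - exp (- (l / m) * (real k / real n)))\<bar> \<le> e"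
proof -
  define \<beta> where "\<beta> = l / m"
  have m: "m > 0" using m_ge_1 by simp
  have \<beta>: "\<beta> > 0" using l m by (simp add: \<beta>_def)
  have mb: "m * \<beta> = l" using m by (simp add: \<beta>_def)
  have inv0: "(\<lambda>n. 1 / real n) \<longlonglongrightarrow> 0" by (rule lim_1_over_n)
  have a1: "a \<longlonglongrightarrow> 1"
  proof -
    have "(\<lambda>n. 1 - (real n * (1 - a n)) * (1 / real n)) \<longlonglongrightarrow> 1 - l * 0"
      by (intro tendsto_intros lim inv0)
    then have "(\<lambda>n. 1 - (real n * (1 - a n)) * (1 / real n)) \<longlonglongrightarrow> 1" by simp
    then show ?thesis
      by (rule Lim_transform_eventually) (rule eventually_sequentiallyI[of 1], simp)
  qed
  \<comment> \<open>The three sources of error, divided by \<open>m\<close>: the coefficient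
    \<open>(1 - a n) / a n\<close> against \<open>l / n\<close>, summed over at most
    \<open>n + 1\<close> terms of size at most 1; the renewal error; and the Riemann error
    \<open>m * x = l / n\<close>.\<close>
  define \<eta> where "\<eta> n = (\<bar>real n * (1 - a n) / a n - l\<bar> * (1 + 1 / real n) + renewal_err (a n) + l / real n) / m" for n
  have "(\<lambda>n. (\<bar>real n * (1 - a n) / a n - l\<bar> * (1 + 1 / real n) + renewal_err (a n) + l * (1 / real n)) / m)
      \<longlonglongrightarrow> (\<bar>l / 1 - l\<bar> * (1 + 0) + 0 + l * 0) / m"
    using m by (intro tendsto_intros lim inv0 a1 renewal_err_tendsto_0 a) auto
  then have \<eta>0: "\<eta> \<longlonglongrightarrow> 0" by (simp add: \<eta>_def[abs_def])
  have "(\<lambda>n. 2 * \<eta> n * exp (2 * \<beta>)) \<longlonglongrightarrow> 2 * 0 * exp (2 * \<beta>)" by (intro tendsto_intros \<eta>0)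
  then have "\<forall>\<^sub>F n in sequentially. 2 * \<eta> n * exp (2 * \<beta>) < e" using e by (intro order_tendstoD(2)) auto
  moreover have "\<forall>\<^sub>F n in sequentially. a n > 0" using order_tendstoD(1)[OF a1, of 0] by simp
  \<comment> \<open>This smallness lets the diagonal term \<open>x * d k\<close> be absorbed on the
    left below; it is the origin of the factors 2 in front of \<open>\<eta> n\<close> and
    \<open>\<beta>\<close>.\<close>
  moreover have "\<forall>\<^sub>F n in sequentially. \<beta> / real n < 1/2"
  proof -
    have "(\<lambda>n. \<beta> * (1 / real n)) \<longlonglongrightarrow> \<beta> * 0" by (intro tendsto_intros inv0)
    then show ?thesis using order_tendstoD(2)[of "\<lambda>n. \<beta> * (1 / real n)" 0 sequentially "1/2"] by simp
  qed
  ultimately show ?thesis using eventually_ge_at_top[of 1]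
  proof eventually_elim
    case (elim n)
    define x where "x = \<beta> / real n"
    have x: "0 \<le> x" "x \<le> 1/2" using elim \<beta> by (auto simp: x_def)
    have an: "0 < a n" "a n \<le> 1" "0 \<le> a n" using elim a[of n] by auto
    define g where "g k = 1 - exp (- x * real k)" for k
    define d where "d k = \<bar>step_response (a n) \<phi> k - g k\<bar>" for k
    have main: "d k \<le> \<eta> n + x * (\<Sum>i\<le>k. d i)" if "k \<le> n" for k
    proof -
      let ?R = "\<Sum>i\<le>k. 1 - step_response (a n) \<phi> i" and ?G = "\<Sum>i\<le>k. 1 - g i"
      let ?c = "(1 - a n) / a n"
      have 1: "\<bar>m * step_response (a n) \<phi> k - ?c * ?R\<bar> \<le> renewal_err (a n)"
        by (rule renewal_approx[OF an(1,2)])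
      have "\<bar>g k - x * ?G\<bar> \<le> x" using exp_riemann_sum[OF x(1), of k] by (simp add: g_def)
      then have 2: "\<bar>m * g k - m * x * ?G\<bar> \<le> m * x"
      proof -
        have "m * g k - m * x * ?G = m * (g k - x * ?G)" by (simp add: right_diff_distrib)
        with \<open>\<bar>g k - x * ?G\<bar> \<le> x\<close> m show ?thesis by (simp add: abs_mult)
      qed
      have "?R - ?G = (\<Sum>i\<le>k. g i - step_response (a n) \<phi> i)" by (simp add: sum_subtractf)
      then have "\<bar>?R - ?G\<bar> \<le> (\<Sum>i\<le>k. d i)"
        unfolding d_def using sum_abs[of "\<lambda>i. g i - step_response (a n) \<phi> i" "{..k}"] by (simp add: abs_minus_commute)
      then have 3: "\<bar>m * x * (?R - ?G)\<bar> \<le> m * x * (\<Sum>i\<le>k. d i)"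
        using m x by (simp add: abs_mult mult_left_mono)
      have R: "\<bar>?R\<bar> \<le> real (Suc k)"
      proof -
        have "\<bar>?R\<bar> \<le> (\<Sum>i\<le>k. \<bar>1 - step_response (a n) \<phi> i\<bar>)" by (rule sum_abs)
        also have "\<dots> \<le> (\<Sum>i\<le>k. 1)"
          using step_response_bounds[OF an(3,2)] by (intro sum_mono) (simp add: abs_le_iff)
        finally show ?thesis by simp
      qed
      have 4: "\<bar>(?c - m * x) * ?R\<bar> \<le> \<bar>real n * (1 - a n) / a n - l\<bar> * (1 + 1 / real n)"
      proof -
        have "?c - m * x = (real n * (1 - a n) / a n - l) / real n"
          using elim mb by (simp add: x_def field_simps)
        then have "\<bar>(?c - m * x) * ?R\<bar> = \<bar>real n * (1 - a n) / a n - l\<bar> * (\<bar>?R\<bar> / real n)"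
          by (simp add: abs_mult)
        also have "\<dots> \<le> \<bar>real n * (1 - a n) / a n - l\<bar> * (1 + 1 / real n)"
          using R that elim by (intro mult_left_mono) (auto simp: field_simps)
        finally show ?thesis .
      qed
      have tri: "\<bar>X\<bar> \<le> a + b + c + d" if "X = A - B + C + D" "\<bar>A\<bar> \<le> a" "\<bar>B\<bar> \<le> b" "\<bar>C\<bar> \<le> c" "\<bar>D\<bar> \<le> d"
        for X A B C D a b c d :: real using that by linarith
      \<comment> \<open>Both functions are compared with their integral equations. The remaining
        difference splits into a change of integrand, which feeds the Gronwall sum, and a change of
        coefficient.\<close>
      have "m * (step_response (a n) \<phi> k - g k) = (m * step_response (a n) \<phi> k - ?c * ?R) - (m * g k - m * x * ?G)
          + m * x * (?R - ?G) + (?c - m * x) * ?R" by (simp add: algebra_simps)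
      then have "\<bar>m * (step_response (a n) \<phi> k - g k)\<bar> \<le> renewal_err (a n) + m * x + m * x * (\<Sum>i\<le>k. d i)
          + \<bar>real n * (1 - a n) / a n - l\<bar> * (1 + 1 / real n)"
        by (rule tri[OF _ 1 2 3 4])
      then have "m * d k \<le> renewal_err (a n) + m * x + m * x * (\<Sum>i\<le>k. d i)
          + \<bar>real n * (1 - a n) / a n - l\<bar> * (1 + 1 / real n)"
        using m by (simp add: d_def abs_mult)
      also have "\<dots> = m * (\<eta> n + x * (\<Sum>i\<le>k. d i))"
        using m mb by (simp add: \<eta>_def x_def field_simps)
      finally show ?thesis using m by simp
    qed
    have "d k \<le> 2 * \<eta> n + 2 * x * (\<Sum>i<k. d i)" if "k \<le> n" for k
    proof -
      have "d k \<le> \<eta> n + x * (\<Sum>i<k. d i) + x * d k"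
        using main[OF that] by (simp add: lessThan_Suc_atMost[symmetric] distrib_left)
      moreover have "x * d k \<le> 1/2 * d k" using x by (intro mult_right_mono) (auto simp: d_def)
      ultimately show ?thesis by linarith
    qed
    then have gr: "d k \<le> 2 * \<eta> n * (1 + 2 * x) ^ k" if "k \<le> n" for k
      using discrete_gronwall[of n d "2 * \<eta> n" "2 * x" k] x that by auto
    have \<eta>n: "0 \<le> \<eta> n" using gr[of 0] by (simp add: d_def)
    show ?case
    proof (intro allI impI)
      fix k assume k: "k \<le> n"
      have "d k \<le> 2 * \<eta> n * (1 + 2 * x) ^ k" by (rule gr[OF k])
      also have "\<dots> \<le> 2 * \<eta> n * exp (2 * x) ^ k"
        using \<eta>n x by (intro mult_left_mono power_mono exp_ge_add_one_self) auto
      also have "exp (2 * x) ^ k = exp (2 * x * real k)" by (simp add: exp_of_nat_mult[symmetric] mult_ac)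
      also have "2 * \<eta> n * exp (2 * x * real k) \<le> 2 * \<eta> n * exp (2 * \<beta>)"
        using \<eta>n k elim \<beta> by (intro mult_left_mono) (auto simp: x_def field_simps)
      finally have "d k \<le> e" using elim by linarith
      then show "\<bar>step_response (a n) \<phi> k - (1 - exp (- (l / m) * (real k / real n)))\<bar> \<le> e"
        by (simp add: d_def g_def x_def \<beta>_def)
    qed
  qed
qed

end

section \<open>The rescaled process\<close>

text \<open>At \<open>real n * t - real j\<close> this is the fraction of the cell from
  \<open>j / n\<close> to \<open>(j + 1) / n\<close> that lies to the left of \<open>t\<close>; the
  interpolation becomes a sum over a range that does not depend on \<open>t\<close>.\<close>

definition clamp01 :: "real \<Rightarrow> real" where
  "clamp01 x = max 0 (min 1 x)"

lemma sum_clamp01: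
  fixes z :: "nat \<Rightarrow> real"
  assumes x: "0 \<le> x" "x \<le> real n"
  shows "(\<Sum>j<n. z j * clamp01 (x - real j))
       = (\<Sum>j<nat \<lfloor>x\<rfloor>. z j) + (x - real (nat \<lfloor>x\<rfloor>)) * z (nat \<lfloor>x\<rfloor>)"
proof -
  define k where "k = nat \<lfloor>x\<rfloor>"
  have k: "real k \<le> x" "x < real k + 1" using x by (auto simp: k_def)
  have kn: "k \<le> n" using k x by linarith
  have 1: "clamp01 (x - real j) = 1" if "j < k" for j
  proof -
    have "real j + 1 \<le> real k" using that by linarith
    with k show ?thesis by (simp add: clamp01_def min_def max_def)
  qed
  have 2: "clamp01 (x - real j) = 0" if "j > k" for j
  proof -
    have "real k + 1 \<le> real j" using that by linarith
    with k show ?thesis by (simp add: clamp01_def min_def max_def)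
  qed
  have 3: "clamp01 (x - real k) = x - real k" using k by (simp add: clamp01_def)
  show ?thesis
  proof (cases "k < n")
    case True
    have "(\<Sum>j<n. z j * clamp01 (x - real j)) = (\<Sum>j<Suc k. z j * clamp01 (x - real j))"
      using True 2 by (intro sum.mono_neutral_right) auto
    then show ?thesis using 1 3 by (simp add: k_def[symmetric] mult.commute)
  next
    \<comment> \<open>At the right end the floor is \<open>n\<close> itself; the interpolation term
      \<open>z n\<close> lies outside the sum, but its coefficient is 0.\<close>
    case False
    then have "x = real n" "k = n" using kn k x by auto
    then show ?thesis using 1 by (simp add: k_def[symmetric])
  qed
qed

lemma rescaled_process_eq:
  assumes "t \<in> {0..1}"
  shows "rescaled_process a \<phi> \<epsilon> n t \<omega> = (1 - a n) / sqrt (real n) *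
    (ar_seq (a n) \<phi> (\<lambda>k. \<epsilon> k \<omega>) 0
      + (\<Sum>j<n. ar_seq (a n) \<phi> (\<lambda>k. \<epsilon> k \<omega>) (Suc j) * clamp01 (real n * t - real j)))"
proof -
  have "real n * t \<le> real n" using assms by (simp add: mult_left_le)
  with assms show ?thesis
    unfolding rescaled_process_def Let_def
    by (subst sum_clamp01) (auto simp: lessThan_Suc_atMost[symmetric] sum.lessThan_Suc_shift simp del: sum.lessThan_Suc)
qed

lemma continuous_on_rescaled_process: "continuous_on {0..1} (\<lambda>t. rescaled_process a \<phi> \<epsilon> n t \<omega>)"
  by (subst continuous_on_cong[OF refl rescaled_process_eq], assumption)
     (simp only: clamp01_def, intro continuous_intros)

text \<open>On a cell of length \<open>1 / n\<close> the slope is \<open>(1 - a n) * sqrt n\<close>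
  times a value of the sequence; averaging its square over the \<open>n\<close> cells gives the
  square of this quantity.\<close>

definition slope_norm :: "(nat \<Rightarrow> real) \<Rightarrow> (nat \<Rightarrow> real) \<Rightarrow> (nat \<Rightarrow> 'a \<Rightarrow> real) \<Rightarrow> nat \<Rightarrow> 'a \<Rightarrow> real" where
  "slope_norm a \<phi> \<epsilon> n \<omega> = \<bar>1 - a n\<bar> * sqrt (\<Sum>j<n. (ar_seq (a n) \<phi> (\<lambda>k. \<epsilon> k \<omega>) (Suc j))\<^sup>2)"

text \<open>The path is absolutely continuous, so Cauchy--Schwarz bounds its 1/2-Hoelder seminorm by the
  \<open>L\<^sup>2\<close> norm of its derivative.\<close>
lemma rescaled_process_holder:
  assumes st: "s \<in> {0..1}" "t \<in> {0..1}" and n: "n \<ge> 1"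
  shows "\<bar>rescaled_process a \<phi> \<epsilon> n t \<omega> - rescaled_process a \<phi> \<epsilon> n s \<omega>\<bar>
     \<le> slope_norm a \<phi> \<epsilon> n \<omega> * sqrt \<bar>t - s\<bar>"
  using st
proof (induction s t rule: linorder_wlog)
  case (sym s t)
  then show ?case by (simp add: abs_minus_commute)
next
  case (le s t)
  define y where "y = (\<lambda>j. ar_seq (a n) \<phi> (\<lambda>k. \<epsilon> k \<omega>) (Suc j))"
  define w where "w j = clamp01 (real n * t - real j) - clamp01 (real n * s - real j)" for j
  have "real n * s \<le> real n * t" using le by (simp add: mult_left_mono)
  then have w: "0 \<le> w j" "w j \<le> 1" for j
    unfolding w_def clamp01_def by linarith+
  have "(\<Sum>j<n. clamp01 (real n * t - real j)) = real n * t" if "t \<in> {0..1}" for t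
    using sum_clamp01[of "real n * t" n "\<lambda>_. 1"] that by (simp add: mult_left_le)
  then have sw: "(\<Sum>j<n. w j) = real n * (t - s)"
    using le by (simp add: w_def sum_subtractf right_diff_distrib)
  have "(\<Sum>j<n. y j * w j)\<^sup>2 \<le> (\<Sum>j<n. (y j)\<^sup>2) * (\<Sum>j<n. (w j)\<^sup>2)"
    by (rule Cauchy_Schwarz_ineq_sum)
  also have "\<dots> \<le> (\<Sum>j<n. (y j)\<^sup>2) * (real n * (t - s))"
    unfolding sw[symmetric] using w
    by (intro mult_left_mono sum_mono sum_nonneg) (auto simp: power2_eq_square mult_left_le)
  finally have "\<bar>\<Sum>j<n. y j * w j\<bar> \<le> sqrt (\<Sum>j<n. (y j)\<^sup>2) * (sqrt (real n) * sqrt (t - s))"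
    using real_le_rsqrt by (fastforce simp: real_sqrt_mult dest: real_sqrt_le_mono)
  then have "\<bar>(1 - a n) / sqrt (real n)\<bar> * \<bar>\<Sum>j<n. y j * w j\<bar>
      \<le> \<bar>(1 - a n) / sqrt (real n)\<bar> * (sqrt (\<Sum>j<n. (y j)\<^sup>2) * (sqrt (real n) * sqrt (t - s)))"
    by (rule mult_left_mono) simp
  also have "\<dots> = slope_norm a \<phi> \<epsilon> n \<omega> * sqrt \<bar>t - s\<bar>"
    using n le by (simp add: slope_norm_def y_def)
  moreover have "rescaled_process a \<phi> \<epsilon> n t \<omega> - rescaled_process a \<phi> \<epsilon> n s \<omega>
      = (1 - a n) / sqrt (real n) * (\<Sum>j<n. y j * w j)"
    using le by (simp only: rescaled_process_eq y_def w_def right_diff_distrib sum_subtractf)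
      (simp add: algebra_simps)
  ultimately show ?case by (simp add: abs_mult)
qed

text \<open>The Bernstein value at \<open>t\<close> is the mean of \<open>f\<close> at a binomial
  frequency with mean \<open>t\<close> and variance \<open>t * (1 - t) / k\<close>. The parameter
  \<open>\<delta>\<close> separates small from large deviations, so that the variance suffices to
  control the modulus \<open>sqrt\<close>.\<close>

lemma bernstein_holder:
  assumes f: "\<And>s t. s \<in> {0..1} \<Longrightarrow> t \<in> {0..1} \<Longrightarrow> \<bar>f t - f s\<bar> \<le> H * sqrt \<bar>t - s\<bar>"
    and k: "k \<ge> 1" and \<delta>: "\<delta> > 0" and H: "0 \<le> H"
  shows "mdist C01 (restrict f {0..1}) (bernstein_op k f) \<le> H * (\<delta> + 1 / (real k * \<delta> ^ 3))"
proof (rule mdist_C01_le)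
  fix t :: real assume t: "t \<in> {0..1}"
  have var: "(\<Sum>i\<le>k. (t - real i / real k)\<^sup>2 * Bernstein k i t) = t * (1 - t) / real k"
  proof -
    have *: "\<And>a b x::real. (a - b)\<^sup>2 * x = a * (a - 1) * x + (1 - 2 * b) * a * x + b * b * x"
      by (simp add: algebra_simps power2_eq_square)
    have "(\<Sum>i\<le>k. (real i - real k * t)\<^sup>2 * Bernstein k i t) = real k * t * (1 - t)"
      apply (simp add: * sum.distrib)
      apply (simp flip: sum_distrib_left add: mult.assoc)
      apply (simp add: algebra_simps power2_eq_square)
      done
    then have "(\<Sum>i\<le>k. (real i - real k * t)\<^sup>2 * Bernstein k i t) / (real k)\<^sup>2 = t * (1 - t) / real k"
      by (simp add: power2_eq_square)
    moreover have "(t - real i / real k)\<^sup>2 = (real i - real k * t)\<^sup>2 / (real k)\<^sup>2" for i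
    proof -
      have "t - real i / real k = - ((real i - real k * t) / real k)" using k by (simp add: field_simps)
      then show ?thesis by (simp only: power2_minus power_divide)
    qed
    ultimately show ?thesis by (simp add: sum_divide_distrib)
  qed
  \<comment> \<open>If \<open>sqrt u > \<delta>\<close>, multiplying \<open>sqrt u\<close> by
    \<open>(sqrt u / \<delta>) ^ 3\<close> only enlarges it; the power 3 is chosen to produce the
    square that the variance controls.\<close>
  have sqrt_le: "sqrt u \<le> \<delta> + u\<^sup>2 / \<delta> ^ 3" if "u \<ge> 0" for u
  proof (cases "sqrt u \<le> \<delta>")
    case True
    have "0 \<le> u\<^sup>2 / \<delta> ^ 3" using \<delta> by simp
    with True show ?thesis by linarith
  next
    case False
    have "sqrt u * \<delta> ^ 3 \<le> sqrt u * sqrt u ^ 3" using False \<delta> that by (intro mult_left_mono power_mono) auto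
    also have "\<dots> = (sqrt u ^ 2) ^ 2" by (simp only: power_Suc[symmetric] power_mult[symmetric]) simp
    also have "\<dots> = u\<^sup>2" using that by simp
    finally have "sqrt u \<le> u\<^sup>2 / \<delta> ^ 3" using \<delta> by (simp add: field_simps)
    then show ?thesis using \<delta> by simp
  qed
  have B: "Bernstein k i t \<ge> 0" for i using t by (intro Bernstein_nonneg) auto
  have "\<bar>f t - (\<Sum>i\<le>k. f (real i / real k) * Bernstein k i t)\<bar>
      = \<bar>\<Sum>i\<le>k. (f t - f (real i / real k)) * Bernstein k i t\<bar>"
    by (simp add: left_diff_distrib sum_subtractf sum_distrib_left[symmetric])
  also have "\<dots> \<le> (\<Sum>i\<le>k. \<bar>(f t - f (real i / real k)) * Bernstein k i t\<bar>)" by (rule sum_abs)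
  also have "\<dots> \<le> (\<Sum>i\<le>k. H * (\<delta> + (t - real i / real k)\<^sup>2 / \<delta> ^ 3) * Bernstein k i t)"
  proof (intro sum_mono)
    fix i assume "i \<in> {..k}"
    then have "\<bar>f t - f (real i / real k)\<bar> \<le> H * sqrt \<bar>t - real i / real k\<bar>"
      using t k by (intro f) (auto simp: divide_le_eq_1)
    also have "\<dots> \<le> H * (\<delta> + \<bar>t - real i / real k\<bar>\<^sup>2 / \<delta> ^ 3)" using H by (intro mult_left_mono sqrt_le) auto
    finally show "\<bar>(f t - f (real i / real k)) * Bernstein k i t\<bar>
        \<le> H * (\<delta> + (t - real i / real k)\<^sup>2 / \<delta> ^ 3) * Bernstein k i t"
      using B by (simp add: abs_mult mult_right_mono)
  qed
  also have "\<dots> = H * (\<delta> * (\<Sum>i\<le>k. Bernstein k i t) + (\<Sum>i\<le>k. (t - real i / real k)\<^sup>2 * Bernstein k i t) / \<delta> ^ 3)"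
    unfolding sum_distrib_left sum_divide_distrib sum.distrib[symmetric]
    by (intro sum.cong) (simp_all add: field_simps)
  also have "\<dots> = H * (\<delta> + t * (1 - t) / real k / \<delta> ^ 3)"
    unfolding var sum_Bernstein by simp
  also have "\<dots> \<le> H * (\<delta> + 1 / real k / \<delta> ^ 3)"
    using t k \<delta> H by (intro mult_left_mono add_left_mono divide_right_mono) (auto intro!: mult_le_one)
  finally show "\<bar>restrict f {0..1} t - bernstein_op k f t\<bar> \<le> H * (\<delta> + 1 / (real k * \<delta> ^ 3))"
    using t by (simp add: bernstein_path_def)
qed (use \<delta> H in auto)

section \<open>Mean bounds for functionals of random paths\<close>

lemma (in prob_space) expectation_abs_le:
  fixes X :: "'a \<Rightarrow> real"
  assumes X: "X \<in> borel_measurable M" "integrable M (\<lambda>x. (X x)\<^sup>2)" "expectation (\<lambda>x. (X x)\<^sup>2) \<le> c\<^sup>2" and c: "c > 0"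
  shows "integrable M (\<lambda>x. \<bar>X x\<bar>)" "expectation (\<lambda>x. \<bar>X x\<bar>) \<le> c"
proof -
  \<comment> \<open>The arithmetic-geometric mean inequality replaces Cauchy-Schwarz and gives
    integrability as well; at a second moment of \<open>c\<^sup>2\<close> it yields exactly
    \<open>c\<close>.\<close>
  have le: "\<bar>X x\<bar> \<le> ((X x)\<^sup>2 / c + c) / 2" for x
  proof -
    have "0 \<le> (\<bar>X x\<bar> - c)\<^sup>2" by simp
    then have "2 * c * \<bar>X x\<bar> \<le> (X x)\<^sup>2 + c\<^sup>2" by (simp add: power2_diff mult_ac)
    then show ?thesis using c by (simp add: field_simps power2_eq_square)
  qed
  have int: "integrable M (\<lambda>x. ((X x)\<^sup>2 / c + c) / 2)" using X(2) by simp
  show 1: "integrable M (\<lambda>x. \<bar>X x\<bar>)"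
  proof (rule Bochner_Integration.integrable_bound[OF int])
    have "norm \<bar>X x\<bar> \<le> norm (((X x)\<^sup>2 / c + c) / 2)" for x
      unfolding real_norm_def using le[of x] by linarith
    then show "AE x in M. norm \<bar>X x\<bar> \<le> norm (((X x)\<^sup>2 / c + c) / 2)" by simp
  qed (use X(1) in simp)
  have "expectation (\<lambda>x. \<bar>X x\<bar>) \<le> expectation (\<lambda>x. ((X x)\<^sup>2 / c + c) / 2)"
    by (rule integral_mono[OF 1 int le])
  also have "\<dots> = (expectation (\<lambda>x. (X x)\<^sup>2) / c + c) / 2" using X(2) by (simp add: prob_space)
  also have "\<dots> \<le> (c\<^sup>2 / c + c) / 2" using X(3) c by (intro divide_right_mono add_mono) auto
  finally show "expectation (\<lambda>x. \<bar>X x\<bar>) \<le> c" using c by (simp add: power2_eq_square)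
qed

lemma (in prob_space) bounded_lipschitz_integrable:
  assumes "bounded_lipschitz F L b" "X \<in> measurable M borel_C01"
  shows "integrable M (\<lambda>\<omega>. F (X \<omega>))"
proof (rule integrable_const_bound[where B=b])
  show "(\<lambda>\<omega>. F (X \<omega>)) \<in> borel_measurable M"
    using measurable_compose[OF assms(2) bounded_lipschitz_measurable[OF assms(1)]] .
  show "AE \<omega> in M. norm (F (X \<omega>)) \<le> b"
    using assms measurable_space[OF assms(2)] by (auto simp: bounded_lipschitz_def)
qed

text \<open>The distance is integrated through a majorant \<open>D\<close>, so that measurability of
  the distance itself is never in question.\<close>

lemma (in prob_space) bounded_lipschitz_expectation_diff:
  assumes F: "bounded_lipschitz F L b" and X: "X \<in> measurable M borel_C01" "X' \<in> measurable M borel_C01"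
    and D: "integrable M D" "\<And>\<omega>. \<omega> \<in> space M \<Longrightarrow> mdist C01 (X \<omega>) (X' \<omega>) \<le> D \<omega>"
  shows "\<bar>expectation (\<lambda>\<omega>. F (X \<omega>)) - expectation (\<lambda>\<omega>. F (X' \<omega>))\<bar> \<le> L * expectation D"
proof -
  note int = bounded_lipschitz_integrable[OF F X(1)] bounded_lipschitz_integrable[OF F X(2)]
  have "\<bar>expectation (\<lambda>\<omega>. F (X \<omega>)) - expectation (\<lambda>\<omega>. F (X' \<omega>))\<bar> = \<bar>expectation (\<lambda>\<omega>. F (X \<omega>) - F (X' \<omega>))\<bar>"
    using int by simp
  also have "\<dots> \<le> expectation (\<lambda>\<omega>. \<bar>F (X \<omega>) - F (X' \<omega>)\<bar>)" by (rule integral_abs_bound)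
  also have "\<dots> \<le> expectation (\<lambda>\<omega>. L * D \<omega>)"
  proof (rule integral_mono)
    fix \<omega> assume \<omega>: "\<omega> \<in> space M"
    have "X \<omega> \<in> mspace C01" "X' \<omega> \<in> mspace C01" using X[THEN measurable_space, OF \<omega>] by auto
    then have "\<bar>F (X \<omega>) - F (X' \<omega>)\<bar> \<le> L * mdist C01 (X \<omega>) (X' \<omega>)" using F by (simp add: bounded_lipschitz_def)
    also have "\<dots> \<le> L * D \<omega>" using F D(2)[OF \<omega>] by (intro mult_left_mono) (auto simp: bounded_lipschitz_def)
    finally show "\<bar>F (X \<omega>) - F (X' \<omega>)\<bar> \<le> L * D \<omega>" .
  qed (use int D in auto)
  finally show ?thesis using D by simp
qed

locale white_noise = prob_space M for M :: "'a measure" +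
  fixes \<epsilon> :: "nat \<Rightarrow> 'a \<Rightarrow> real"
  assumes indep: "indep_vars (\<lambda>_. borel) \<epsilon> UNIV"
    and integrable: "\<And>k. integrable M (\<epsilon> k)" "\<And>k. integrable M (\<lambda>\<omega>. (\<epsilon> k \<omega>)\<^sup>2)"
    and centered: "\<And>k. expectation (\<epsilon> k) = 0"
    and unit_variance: "\<And>k. expectation (\<lambda>\<omega>. (\<epsilon> k \<omega>)\<^sup>2) = 1"
begin

lemma noise_measurable [measurable]: "\<epsilon> k \<in> borel_measurable M"
  using integrable(1) by auto

lemma noise_product:
  "integrable M (\<lambda>\<omega>. \<epsilon> i \<omega> * \<epsilon> j \<omega>)"
  "expectation (\<lambda>\<omega>. \<epsilon> i \<omega> * \<epsilon> j \<omega>) = (if i = j then 1 else 0)"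
proof -
  have "integrable M (\<lambda>\<omega>. \<epsilon> i \<omega> * \<epsilon> j \<omega>) \<and> expectation (\<lambda>\<omega>. \<epsilon> i \<omega> * \<epsilon> j \<omega>) = (if i = j then 1 else 0)"
  proof (cases "i = j")
    case True
    then show ?thesis using integrable(2)[of j] unit_variance[of j] by (simp add: power2_eq_square)
  next
    case False
    have ind: "indep_vars (\<lambda>_. borel) \<epsilon> {i, j}" by (rule indep_vars_subset[OF indep]) simp
    have "integrable M (\<lambda>\<omega>. \<Prod>k\<in>{i,j}. \<epsilon> k \<omega>)"
      by (rule indep_vars_integrable[OF _ ind]) (use integrable in auto)
    moreover have "expectation (\<lambda>\<omega>. \<Prod>k\<in>{i,j}. \<epsilon> k \<omega>) = (\<Prod>k\<in>{i,j}. expectation (\<epsilon> k))"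
      by (rule indep_vars_lebesgue_integral[OF _ ind]) (use integrable in auto)
    ultimately show ?thesis using False by (simp add: centered)
  qed
  then show "integrable M (\<lambda>\<omega>. \<epsilon> i \<omega> * \<epsilon> j \<omega>)"
    "expectation (\<lambda>\<omega>. \<epsilon> i \<omega> * \<epsilon> j \<omega>) = (if i = j then 1 else 0)" by auto
qed

lemma noise_sum_sq:
  assumes "finite J"
  shows "integrable M (\<lambda>\<omega>. (\<Sum>j\<in>J. c j * \<epsilon> j \<omega>)\<^sup>2)"
    "expectation (\<lambda>\<omega>. (\<Sum>j\<in>J. c j * \<epsilon> j \<omega>)\<^sup>2) = (\<Sum>j\<in>J. (c j)\<^sup>2)"
proof -
  have eq: "(\<Sum>j\<in>J. c j * \<epsilon> j \<omega>)\<^sup>2 = (\<Sum>i\<in>J. \<Sum>j\<in>J. (c i * c j) * (\<epsilon> i \<omega> * \<epsilon> j \<omega>))" for \<omega>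
    unfolding power2_eq_square sum_product by (intro sum.cong) (auto simp: mult_ac)
  show "integrable M (\<lambda>\<omega>. (\<Sum>j\<in>J. c j * \<epsilon> j \<omega>)\<^sup>2)"
    unfolding eq by (intro Bochner_Integration.integrable_sum integrable_mult_right noise_product)
  have "expectation (\<lambda>\<omega>. (\<Sum>j\<in>J. c j * \<epsilon> j \<omega>)\<^sup>2) = (\<Sum>i\<in>J. \<Sum>j\<in>J. (c i * c j) * (if i = j then 1 else 0))"
    unfolding eq
    by (simp only: Bochner_Integration.integral_sum Bochner_Integration.integrable_sum
        integrable_mult_right noise_product integral_mult_right_zero)
  also have "\<dots> = (\<Sum>i\<in>J. (c i)\<^sup>2)"
    using assms by (simp add: if_distrib[of "(*) _"] power2_eq_square cong: if_cong)
  finally show "expectation (\<lambda>\<omega>. (\<Sum>j\<in>J. c j * \<epsilon> j \<omega>)\<^sup>2) = (\<Sum>j\<in>J. (c j)\<^sup>2)" .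
qed

lemma ar_seq_measurable [measurable]: "(\<lambda>\<omega>. ar_seq a \<phi> (\<lambda>k. \<epsilon> k \<omega>) j) \<in> borel_measurable M"
  unfolding ar_seq_eq_convolution by measurable

lemma rescaled_process_measurable [measurable]: "rescaled_process a \<phi> \<epsilon> n t \<in> borel_measurable M"
  unfolding rescaled_process_def Let_def by measurable

end

locale rescaled_ar = white_noise M \<epsilon> + kernel \<phi> m for M :: "'a measure" and \<epsilon> and \<phi> m +
  fixes a :: "nat \<Rightarrow> real" and l :: real
  assumes a: "\<And>n. n \<ge> 1 \<Longrightarrow> 0 \<le> a n \<and> a n < 1" and l: "l > 0"
    and lim: "(\<lambda>n. real n * (1 - a n)) \<longlonglongrightarrow> l"
begin

abbreviation Zn :: "nat \<Rightarrow> real \<Rightarrow> 'a \<Rightarrow> real" where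
  "Zn n t \<omega> \<equiv> rescaled_process a \<phi> \<epsilon> n t \<omega>"

lemma path_Zn_measurable: "path01 (rescaled_process a \<phi> \<epsilon> n) \<in> measurable M borel_C01"
  by (intro path01_measurable rescaled_process_measurable continuous_on_rescaled_process)

text \<open>The second moment is the sum of the squared impulse responses, each at most 1. Its
  linear growth is harmless because it will be multiplied by \<open>(1 - a n)\<^sup>2\<close>, which
  is of order \<open>1 / n\<^sup>2\<close>, before summation over \<open>n\<close> indices.\<close>

lemma ar_seq_sq:
  assumes "n \<ge> 1"
  shows "integrable M (\<lambda>\<omega>. (ar_seq (a n) \<phi> (\<lambda>k. \<epsilon> k \<omega>) j)\<^sup>2)"
    "expectation (\<lambda>\<omega>. (ar_seq (a n) \<phi> (\<lambda>k. \<epsilon> k \<omega>) j)\<^sup>2) \<le> real (Suc j)"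
proof -
  show "integrable M (\<lambda>\<omega>. (ar_seq (a n) \<phi> (\<lambda>k. \<epsilon> k \<omega>) j)\<^sup>2)"
    unfolding ar_seq_eq_convolution by (rule noise_sum_sq) simp
  have "(impulse_response (a n) \<phi> i)\<^sup>2 \<le> 1" for i
    using impulse_response_bounds[of "a n" i] a[OF assms] by (auto simp: power_le_one)
  then have "(\<Sum>i\<le>j. (impulse_response (a n) \<phi> (j - i))\<^sup>2) \<le> (\<Sum>i\<le>j. 1)" by (intro sum_mono)
  then show "expectation (\<lambda>\<omega>. (ar_seq (a n) \<phi> (\<lambda>k. \<epsilon> k \<omega>) j)\<^sup>2) \<le> real (Suc j)"
    unfolding ar_seq_eq_convolution by (subst noise_sum_sq) simp_all
qed

lemma slope_norm_bound:
  "\<forall>\<^sub>F n in sequentially. integrable M (\<lambda>\<omega>. \<bar>slope_norm a \<phi> \<epsilon> n \<omega>\<bar>)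
     \<and> expectation (\<lambda>\<omega>. \<bar>slope_norm a \<phi> \<epsilon> n \<omega>\<bar>) \<le> 2 * (l + 1)"
proof -
  have "\<forall>\<^sub>F n in sequentially. real n * (1 - a n) < l + 1"
    using order_tendstoD(2)[OF lim, of "l + 1"] by simp
  then show ?thesis using eventually_ge_at_top[of 1]
  proof eventually_elim
    case (elim n)
    have sq: "(slope_norm a \<phi> \<epsilon> n \<omega>)\<^sup>2 = (1 - a n)\<^sup>2 * (\<Sum>j<n. (ar_seq (a n) \<phi> (\<lambda>k. \<epsilon> k \<omega>) (Suc j))\<^sup>2)" for \<omega>
      by (simp add: slope_norm_def power_mult_distrib sum_nonneg)
    have int: "integrable M (\<lambda>\<omega>. (slope_norm a \<phi> \<epsilon> n \<omega>)\<^sup>2)"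
      unfolding sq by (intro integrable_mult_right Bochner_Integration.integrable_sum ar_seq_sq elim)
    have "expectation (\<lambda>\<omega>. (slope_norm a \<phi> \<epsilon> n \<omega>)\<^sup>2)
        = (1 - a n)\<^sup>2 * (\<Sum>j<n. expectation (\<lambda>\<omega>. (ar_seq (a n) \<phi> (\<lambda>k. \<epsilon> k \<omega>) (Suc j))\<^sup>2))"
      unfolding sq using ar_seq_sq(1) elim by (subst integral_mult_right_zero, subst Bochner_Integration.integral_sum) auto
    also have "\<dots> \<le> (1 - a n)\<^sup>2 * (\<Sum>j<n. 4 * real n)"
    proof (intro mult_left_mono sum_mono)
      fix j assume "j \<in> {..<n}"
      \<comment> \<open>The sharper bound \<open>n + 1\<close> holds; the constant 4 makes the total
        a perfect square.\<close>
      then have "real (Suc (Suc j)) \<le> 4 * real n" by auto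
      then show "expectation (\<lambda>\<omega>. (ar_seq (a n) \<phi> (\<lambda>k. \<epsilon> k \<omega>) (Suc j))\<^sup>2) \<le> 4 * real n"
        using ar_seq_sq(2)[of n "Suc j"] elim by linarith
    qed simp
    also have "\<dots> = (2 * (real n * (1 - a n)))\<^sup>2" by (simp add: power2_eq_square)
    also have "\<dots> \<le> (2 * (l + 1))\<^sup>2" using elim a[of n] by (intro power_mono) auto
    finally have E: "expectation (\<lambda>\<omega>. (slope_norm a \<phi> \<epsilon> n \<omega>)\<^sup>2) \<le> (2 * (l + 1))\<^sup>2" .
    have meas: "slope_norm a \<phi> \<epsilon> n \<in> borel_measurable M"
      unfolding slope_norm_def[abs_def] by measurable
    show ?case using expectation_abs_le[OF meas int E] l by simp
  qed
qed

text \<open>The Hoelder constant of the path is random but has bounded mean, and the Bernstein error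
  is linear in it. The bound is free of \<open>n\<close> and becomes small by taking
  \<open>\<delta>\<close> small and then \<open>k\<close> large.\<close>

lemma tightness:
  assumes F: "bounded_lipschitz F L b" and k: "k \<ge> 1" and \<delta>: "\<delta> > 0"
  shows "\<forall>\<^sub>F n in sequentially. \<bar>expectation (\<lambda>\<omega>. F (path01 (rescaled_process a \<phi> \<epsilon> n) \<omega>))
      - expectation (\<lambda>\<omega>. F (bernstein_op k (\<lambda>t. Zn n t \<omega>)))\<bar>
      \<le> L * (2 * (l + 1) * (\<delta> + 1 / (real k * \<delta> ^ 3)))"
  using slope_norm_bound eventually_ge_at_top[of 1]
proof eventually_elim
  case (elim n)
  let ?c = "\<delta> + 1 / (real k * \<delta> ^ 3)"
  have c: "0 \<le> ?c" using \<delta> by simp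
  have "\<bar>expectation (\<lambda>\<omega>. F (path01 (rescaled_process a \<phi> \<epsilon> n) \<omega>))
      - expectation (\<lambda>\<omega>. F (bernstein_op k (\<lambda>t. Zn n t \<omega>)))\<bar>
      \<le> L * expectation (\<lambda>\<omega>. \<bar>slope_norm a \<phi> \<epsilon> n \<omega>\<bar> * ?c)"
  proof (rule bounded_lipschitz_expectation_diff[OF F path_Zn_measurable])
    show "(\<lambda>\<omega>. bernstein_op k (\<lambda>t. Zn n t \<omega>)) \<in> measurable M borel_C01"
      by (intro bernstein_path_measurable rescaled_process_measurable)
    show "mdist C01 (path01 (rescaled_process a \<phi> \<epsilon> n) \<omega>) (bernstein_op k (\<lambda>t. Zn n t \<omega>))
        \<le> \<bar>slope_norm a \<phi> \<epsilon> n \<omega>\<bar> * ?c" for \<omega>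
      unfolding path01_def
      by (rule bernstein_holder[OF order_trans[OF rescaled_process_holder] k \<delta>])
         (use elim in \<open>auto intro!: mult_right_mono\<close>)
  qed (use elim in auto)
  also have "\<dots> = L * (expectation (\<lambda>\<omega>. \<bar>slope_norm a \<phi> \<epsilon> n \<omega>\<bar>) * ?c)"
    using elim by simp
  also have "\<dots> \<le> L * (2 * (l + 1) * ?c)"
    using elim F c by (intro mult_left_mono mult_right_mono) (auto simp: bounded_lipschitz_def)
  finally show ?case .
qed

end

section \<open>Approximation by block sums\<close>

lemma exp_minus_lipschitz:
  fixes x y :: real
  assumes "0 \<le> x" "0 \<le> y"
  shows "\<bar>exp (- x) - exp (- y)\<bar> \<le> \<bar>x - y\<bar>"
  using assms
proof (induction x y rule: linorder_wlog)
  case (le x y)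
  have "exp (- x) - exp (- y) = exp (- x) * (1 - exp (- (y - x)))"
    by (simp add: right_diff_distrib exp_add[symmetric])
  also have "\<dots> \<le> 1 * (y - x)"
  proof (rule mult_mono)
    show "1 - exp (- (y - x)) \<le> y - x" using exp_ge_add_one_self[of "- (y - x)"] by linarith
  qed (use le in auto)
  finally show ?case using le by simp
qed (simp add: abs_minus_commute)

lemma floor_bounds:
  assumes "t \<in> {0..1}"
  shows "real (nat \<lfloor>real n * t\<rfloor>) \<le> real n * t" "real n * t < real (nat \<lfloor>real n * t\<rfloor>) + 1"
    "nat \<lfloor>real n * t\<rfloor> \<le> n"
proof -
  have "0 \<le> real n * t" "real n * t \<le> real n" using assms by (auto simp: mult_left_le)
  then show "real (nat \<lfloor>real n * t\<rfloor>) \<le> real n * t" "real n * t < real (nat \<lfloor>real n * t\<rfloor>) + 1"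
    "nat \<lfloor>real n * t\<rfloor> \<le> n" by (linarith+)
qed

lemma block_count_ratio:
  assumes "K \<ge> 1"
  shows "(\<lambda>n. real n / real (K * (n div K))) \<longlonglongrightarrow> 1"
proof (rule tendsto_sandwich)
  have le: "K * (n div K) \<le> n" "n - K \<le> K * (n div K)" for n
  proof -
    have "K * (n div K) + n mod K = n" "n mod K < K" using assms by auto
    then show "K * (n div K) \<le> n" "n - K \<le> K * (n div K)" by linarith+
  qed
  have pos: "real (K * (n div K)) > 0" if "n \<ge> 2 * K" for n
  proof -
    have "n - K \<ge> 1" using that assms by simp
    then have "K * (n div K) \<ge> 1" using le(2)[of n] by linarith
    then show ?thesis by (simp del: of_nat_mult)
  qed
  show "\<forall>\<^sub>F n in sequentially. 1 \<le> real n / real (K * (n div K))"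
    using eventually_ge_at_top[of "2 * K"]
  proof eventually_elim
    case (elim n)
    then show ?case using pos[of n] le(1)[of n] by (simp add: le_divide_eq_1 del: of_nat_mult)
  qed
  show "\<forall>\<^sub>F n in sequentially. real n / real (K * (n div K)) \<le> 1 + real K / (real n - real K)"
    using eventually_ge_at_top[of "2 * K"]
  proof eventually_elim
    case (elim n)
    have *: "real n - real K > 0" using elim assms by auto
    have "real n - real K \<le> real (K * (n div K))" using le(2)[of n] elim by linarith
    then have "real n / real (K * (n div K)) \<le> real n / (real n - real K)"
      using * pos[OF elim] by (intro divide_left_mono mult_pos_pos) auto
    also have "\<dots> = 1 + real K / (real n - real K)" using * by (simp add: field_simps)
    finally show ?case .
  qed
  have "filterlim (\<lambda>n. real n - real K) at_top sequentially"
    using filterlim_tendsto_add_at_top[OF tendsto_const[of "- real K"] filterlim_real_sequentially] by simp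
  then have "(\<lambda>n. real K / (real n - real K)) \<longlonglongrightarrow> 0"
    by (intro tendsto_divide_0[OF tendsto_const] filterlim_at_top_imp_at_infinity)
  then have "(\<lambda>n. 1 + real K / (real n - real K)) \<longlonglongrightarrow> 1 + 0" by (intro tendsto_intros)
  then show "(\<lambda>n. 1 + real K / (real n - real K)) \<longlonglongrightarrow> 1" by simp
qed simp

definition (in white_noise) block :: "nat \<Rightarrow> nat \<Rightarrow> 'a \<Rightarrow> real" where
  "block N i \<omega> = (\<Sum>j\<in>{i * N..<i * N + N}. \<epsilon> j \<omega>) / sqrt (real N)"

context rescaled_ar
begin

definition \<beta> :: real where "\<beta> = l / m"

text \<open>Truncation at 0 makes the kernel vanish for noise later than \<open>t\<close>, so sums
  may run over all blocks, and keeps it Lipschitz across 0.\<close>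

definition limit_kernel :: "real \<Rightarrow> real" where "limit_kernel s = 1 - exp (- (\<beta> * max 0 s))"

lemma \<beta>_pos: "\<beta> > 0"
  using l m_ge_1 by (simp add: \<beta>_def)

lemma limit_kernel_bounds: "0 \<le> limit_kernel s" "limit_kernel s \<le> 1"
  using \<beta>_pos by (auto simp: limit_kernel_def)

lemma limit_kernel_nonpos: "s \<le> 0 \<Longrightarrow> limit_kernel s = 0"
  by (simp add: limit_kernel_def)

lemma limit_kernel_lipschitz: "\<bar>limit_kernel s - limit_kernel t\<bar> \<le> \<beta> * \<bar>s - t\<bar>"
proof -
  have "\<bar>limit_kernel s - limit_kernel t\<bar> = \<bar>exp (- (\<beta> * max 0 s)) - exp (- (\<beta> * max 0 t))\<bar>"
    by (simp add: limit_kernel_def abs_minus_commute)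
  also have "\<dots> \<le> \<bar>\<beta> * max 0 s - \<beta> * max 0 t\<bar>"
    using \<beta>_pos by (intro exp_minus_lipschitz) auto
  also have "\<dots> = \<beta> * \<bar>max 0 s - max 0 t\<bar>"
    using \<beta>_pos by (simp add: right_diff_distrib[symmetric] abs_mult)
  also have "\<dots> \<le> \<beta> * \<bar>s - t\<bar>" using \<beta>_pos by (intro mult_left_mono) auto
  finally show ?thesis .
qed

text \<open>The coefficient of \<open>\<epsilon> j\<close> in \<open>sqrt n * Zn n t\<close>. The
  index \<open>Suc k\<close> enters only through the interpolation; at \<open>t = 1\<close> it is
  \<open>Suc n\<close>, with coefficient 0.\<close>

definition ar_weight :: "nat \<Rightarrow> real \<Rightarrow> nat \<Rightarrow> real" where
  "ar_weight n t j = (let k = nat \<lfloor>real n * t\<rfloor> in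
     (if j \<le> k then step_response (a n) \<phi> (k - j) else 0)
     + (real n * t - real k) * (1 - a n) * (if j \<le> Suc k then impulse_response (a n) \<phi> (Suc k - j) else 0))"

lemma Zn_eq:
  assumes t: "t \<in> {0..1}"
  shows "Zn n t \<omega> = (\<Sum>j\<le>Suc n. ar_weight n t j / sqrt (real n) * \<epsilon> j \<omega>)"
proof -
  define k where "k = nat \<lfloor>real n * t\<rfloor>"
  have k: "k \<le> n" using floor_bounds[OF t] by (simp add: k_def)
  define c where "c = real n * t - real k"
  have 1: "(\<Sum>j\<le>k. (\<Sum>i\<le>k - j. impulse_response (a n) \<phi> i) * \<epsilon> j \<omega>)
      = (\<Sum>j\<le>Suc n. (if j \<le> k then (\<Sum>i\<le>k - j. impulse_response (a n) \<phi> i) else 0) * \<epsilon> j \<omega>)"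
    using k by (intro sum.mono_neutral_cong_left) auto
  have 2: "(\<Sum>j\<le>Suc k. impulse_response (a n) \<phi> (Suc k - j) * \<epsilon> j \<omega>)
      = (\<Sum>j\<le>Suc n. (if j \<le> Suc k then impulse_response (a n) \<phi> (Suc k - j) else 0) * \<epsilon> j \<omega>)"
    using k by (intro sum.mono_neutral_cong_left) auto
  have "Zn n t \<omega> = (1 - a n) / sqrt (real n) * ((\<Sum>j\<le>k. (\<Sum>i\<le>k - j. impulse_response (a n) \<phi> i) * \<epsilon> j \<omega>)
      + c * (\<Sum>j\<le>Suc k. impulse_response (a n) \<phi> (Suc k - j) * \<epsilon> j \<omega>))"
    unfolding rescaled_process_def Let_def sum_ar_seq k_def[symmetric] c_def[symmetric]
      ar_seq_eq_convolution[of _ _ _ "k + 1"] by simp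
  also have "\<dots> = (\<Sum>j\<le>Suc n. ar_weight n t j / sqrt (real n) * \<epsilon> j \<omega>)"
    unfolding 1 2 distrib_left sum_distrib_left sum.distrib[symmetric]
  proof (intro sum.cong refl)
    fix j
    have wt_eq: "ar_weight n t j = (if j \<le> k then step_response (a n) \<phi> (k - j) else 0)
        + c * (1 - a n) * (if j \<le> Suc k then impulse_response (a n) \<phi> (Suc k - j) else 0)"
      by (simp only: ar_weight_def Let_def k_def c_def)
    show "(1 - a n) / sqrt (real n) * ((if j \<le> k then sum (impulse_response (a n) \<phi>) {..k - j} else 0) * \<epsilon> j \<omega>) +
        (1 - a n) / sqrt (real n) * (c * ((if j \<le> Suc k then impulse_response (a n) \<phi> (Suc k - j) else 0) * \<epsilon> j \<omega>)) =
        ar_weight n t j / sqrt (real n) * \<epsilon> j \<omega>"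
      unfolding wt_eq step_response_def by (simp add: add_divide_distrib distrib_left distrib_right mult_ac)
  qed
  finally show ?thesis .
qed

lemma ar_weight_approx_response:
  assumes n: "n \<ge> 1" and t: "t \<in> {0..1}"
  defines "k \<equiv> nat \<lfloor>real n * t\<rfloor>"
  shows "\<bar>ar_weight n t j - (if j \<le> k then step_response (a n) \<phi> (k - j) else 0)\<bar> \<le> 1 - a n"
proof -
  have an: "0 \<le> a n" "a n \<le> 1" using a[OF n] by auto
  define p where "p = (if j \<le> Suc k then impulse_response (a n) \<phi> (Suc k - j) else 0)"
  have p: "0 \<le> p" "p \<le> 1" using impulse_response_bounds[OF an] by (auto simp: p_def)
  have c: "0 \<le> real n * t - real k" "real n * t - real k \<le> 1"
    using floor_bounds(1,2)[OF t, of n] unfolding k_def by (linarith, linarith)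
  have "ar_weight n t j - (if j \<le> k then step_response (a n) \<phi> (k - j) else 0) = (real n * t - real k) * (1 - a n) * p"
    by (simp add: ar_weight_def Let_def k_def p_def)
  then have "ar_weight n t j - (if j \<le> k then step_response (a n) \<phi> (k - j) else 0) = ((real n * t - real k) * p) * (1 - a n)"
    by (simp add: mult_ac)
  moreover have "0 \<le> ((real n * t - real k) * p) * (1 - a n)"
    using c(1) p(1) an by (intro mult_nonneg_nonneg) auto
  moreover have "((real n * t - real k) * p) * (1 - a n) \<le> 1 * (1 - a n)"
    by (rule mult_right_mono[OF mult_le_one[OF c(2) p]]) (use an in simp)
  ultimately have "\<bar>ar_weight n t j - (if j \<le> k then step_response (a n) \<phi> (k - j) else 0)\<bar> \<le> 1 * (1 - a n)"
    by linarith
  then show ?thesis by simp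
qed

lemma ar_weight_abs_le: "n \<ge> 1 \<Longrightarrow> t \<in> {0..1} \<Longrightarrow> \<bar>ar_weight n t j\<bar> \<le> 2"
  using ar_weight_approx_response[of n t j] a[of n] step_response_bounds[of "a n" "nat \<lfloor>real n * t\<rfloor> - j"]
  by (cases "j \<le> nat \<lfloor>real n * t\<rfloor>") auto

text \<open>The three errors come from the uniform limit of the step response, from rounding
  \<open>n * t\<close> down, and from the interpolation term.\<close>

lemma ar_weight_approx:
  assumes n: "n \<ge> 1" and t: "t \<in> {0..1}"
    and \<delta>: "\<And>i. i \<le> n \<Longrightarrow> \<bar>step_response (a n) \<phi> i - (1 - exp (- (l / m) * (real i / real n)))\<bar> \<le> \<delta>"
  shows "\<bar>ar_weight n t j - limit_kernel (t - real j / real n)\<bar> \<le> \<delta> + \<beta> / real n + (1 - a n)"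
proof -
  define k where "k = nat \<lfloor>real n * t\<rfloor>"
  note k = floor_bounds[OF t, of n, folded k_def]
  define q where "q = (if j \<le> k then step_response (a n) \<phi> (k - j) else 0)"
  have "\<bar>q - limit_kernel (t - real j / real n)\<bar> \<le> \<delta> + \<beta> / real n"
  proof (cases "j \<le> k")
    case True
    have "\<bar>step_response (a n) \<phi> (k - j) - limit_kernel (real (k - j) / real n)\<bar> \<le> \<delta>"
      using \<delta>[of "k - j"] k by (simp add: limit_kernel_def \<beta>_def)
    moreover have "\<bar>limit_kernel (real (k - j) / real n) - limit_kernel (t - real j / real n)\<bar> \<le> \<beta> * \<bar>real (k - j) / real n - (t - real j / real n)\<bar>"
      by (rule limit_kernel_lipschitz)
    moreover have "\<bar>real (k - j) / real n - (t - real j / real n)\<bar> \<le> 1 / real n"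
    proof -
      have "real (k - j) / real n - (t - real j / real n) = (real k - real n * t) / real n"
        using True n by (simp add: field_simps of_nat_diff)
      moreover have "\<bar>(real k - real n * t) / real n\<bar> \<le> 1 / real n"
      proof -
        have "\<bar>real k - real n * t\<bar> \<le> 1" using k by linarith
        then show ?thesis unfolding abs_divide using divide_right_mono[of "\<bar>real k - real n * t\<bar>" 1 "real n"] by simp
      qed
      ultimately show ?thesis by simp
    qed
    ultimately show ?thesis
      using \<beta>_pos mult_left_mono[of "\<bar>real (k - j) / real n - (t - real j / real n)\<bar>" "1 / real n" \<beta>] True
      by (simp add: q_def)
  next
    case False
    then have "real n * t \<le> real j" using k by linarith
    then have "limit_kernel (t - real j / real n) = 0" using n by (intro limit_kernel_nonpos) (simp add: field_simps)
    moreover have "0 \<le> \<delta>" using \<delta>[of 0] by linarith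
    moreover have "0 \<le> \<beta> / real n" using \<beta>_pos by simp
    ultimately show ?thesis using False by (simp add: q_def)
  qed
  moreover have "\<bar>ar_weight n t j - q\<bar> \<le> 1 - a n"
    unfolding q_def k_def by (rule ar_weight_approx_response[OF n t])
  ultimately show ?thesis by linarith
qed

text \<open>The process driven by \<open>K\<close> standardised noise variables, with the kernel
  frozen at the left end of each block. The same linear map is applied to block sums and to Brownian
  increments.\<close>

definition step_path :: "nat \<Rightarrow> (nat \<Rightarrow> real) \<Rightarrow> real \<Rightarrow> real" where
  "step_path K x t = (\<Sum>i<K. limit_kernel (t - real i / real K) / sqrt (real K) * x i)"

text \<open>Indices from \<open>K * N\<close> on lie in no complete block, hence the weight
  0.\<close>

definition block_weight :: "nat \<Rightarrow> nat \<Rightarrow> real \<Rightarrow> nat \<Rightarrow> real" where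
  "block_weight N K t j = (if j < K * N then limit_kernel (t - real (j div N) / real K) / sqrt (real (K * N)) else 0)"

lemma step_path_block_eq:
  assumes "K * N \<le> n"
  shows "step_path K (\<lambda>i. block N i \<omega>) t = (\<Sum>j\<le>Suc n. block_weight N K t j * \<epsilon> j \<omega>)"
proof -
  have "step_path K (\<lambda>i. block N i \<omega>) t
      = (\<Sum>i<K. \<Sum>j\<in>{i * N..<i * N + N}. limit_kernel (t - real (j div N) / real K) / sqrt (real (K * N)) * \<epsilon> j \<omega>)"
    unfolding step_path_def
  proof (intro sum.cong refl)
    fix i
    have "j div N = i" if "j \<in> {i * N..<i * N + N}" for j
      using that by (intro div_nat_eqI) (auto simp: mult.commute)
    then have "(\<Sum>j\<in>{i * N..<i * N + N}. limit_kernel (t - real (j div N) / real K) / sqrt (real (K * N)) * \<epsilon> j \<omega>)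
        = (\<Sum>j\<in>{i * N..<i * N + N}. limit_kernel (t - real i / real K) / sqrt (real (K * N)) * \<epsilon> j \<omega>)"
      by (intro sum.cong) auto
    also have "\<dots> = limit_kernel (t - real i / real K) / sqrt (real (K * N)) * (\<Sum>j\<in>{i * N..<i * N + N}. \<epsilon> j \<omega>)"
      by (rule sum_distrib_left[symmetric])
    finally show "limit_kernel (t - real i / real K) / sqrt (real K) * block N i \<omega>
        = (\<Sum>j\<in>{i * N..<i * N + N}. limit_kernel (t - real (j div N) / real K) / sqrt (real (K * N)) * \<epsilon> j \<omega>)"
      by (simp add: block_def real_sqrt_mult)
  qed
  also have "\<dots> = (\<Sum>j<K * N. limit_kernel (t - real (j div N) / real K) / sqrt (real (K * N)) * \<epsilon> j \<omega>)"
    by (rule sum.nat_group)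
  also have "\<dots> = (\<Sum>j\<le>Suc n. block_weight N K t j * \<epsilon> j \<omega>)"
    using assms by (intro sum.mono_neutral_cong_left) (auto simp: block_weight_def)
  finally show ?thesis .
qed

text \<open>The discretised kernel is constant on blocks, so replacing \<open>j / n\<close> by the left end of its block
  costs at most \<open>\<beta> / K\<close> up to terms that vanish as \<open>n\<close> grows.\<close>
lemma ar_weight_block_weight_diff:
  assumes n: "n \<ge> 1" and K: "K \<ge> 1" and t: "t \<in> {0..1}" and N: "N = n div K" and j: "j < K * N"
    and 1: "\<bar>ar_weight n t j - limit_kernel (t - real j / real n)\<bar> \<le> e1"
    and 2: "\<beta> * real K / real n \<le> e2"
    and 3: "\<bar>1 - sqrt (real n / real (K * N))\<bar> \<le> e3"
  shows "\<bar>ar_weight n t j - sqrt (real n) * block_weight N K t j\<bar> \<le> e1 + e2 + e3 + \<beta> / real K"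
proof -
  have KN: "K * N \<le> n" "n < K * N + K"
  proof -
    have "K * N + n mod K = n" "n mod K < K" using K by (auto simp: N)
    then show "K * N \<le> n" "n < K * N + K" by linarith+
  qed
  have Npos: "N > 0" using j by (cases N) auto
  define x where "x = real j / real n - real (j div N) / real K"
  have x: "\<bar>x\<bar> \<le> 1 / real K + real K / real n"
  proof -
    have q: "real (j div N) * real N \<le> real j" "real j < real (j div N) * real N + real N"
    proof -
      have "j div N * N + j mod N = j" "j mod N < N" using Npos by auto
      then have "real (j div N) * real N + real (j mod N) = real j" "real (j mod N) < real N"
        by (metis of_nat_add of_nat_mult, simp)
      then show "real (j div N) * real N \<le> real j" "real j < real (j div N) * real N + real N" by linarith+
    qed
    \<comment> \<open>The position of \<open>j\<close> if the \<open>K\<close> blocks filled the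
      unit interval exactly. It is within one block length of the left end of its block, and within
      \<open>K / n\<close> of \<open>j / n\<close> because fewer than \<open>K\<close> indices are
      left over.\<close>
    define y where "y = real j / (real K * real N)"
    have y1: "real (j div N) / real K \<le> y" "y \<le> real (j div N) / real K + 1 / real K"
      using q K Npos by (auto simp: y_def field_simps)
    have yn: "y - real j / real n = (real j / (real K * real N)) * ((real n - real K * real N) / real n)"
      using K Npos n by (simp add: y_def field_simps)
    have "real j \<le> real K * real N" using j by (metis less_imp_le of_nat_le_iff of_nat_mult)
    then have b1: "0 \<le> real j / (real K * real N)" "real j / (real K * real N) \<le> 1"
      using K Npos by (auto simp: divide_le_eq_1)
    have rr: "real K * real N \<le> real n" "real n < real K * real N + real K"
      using KN by (metis of_nat_le_iff of_nat_mult, metis of_nat_less_iff of_nat_mult of_nat_add)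
    have b2: "0 \<le> (real n - real K * real N) / real n" "(real n - real K * real N) / real n \<le> real K / real n"
      using rr by (auto intro!: divide_right_mono)
    have "0 \<le> y - real j / real n" "y - real j / real n \<le> 1 * (real K / real n)"
      unfolding yn by (rule mult_nonneg_nonneg[OF b1(1) b2(1)], rule mult_mono[OF b1(2) b2(2) _ b2(1)], simp)
    then show ?thesis unfolding x_def using y1 b2 by linarith
  qed
  have "\<bar>limit_kernel (t - real j / real n) - limit_kernel (t - real (j div N) / real K)\<bar> \<le> \<beta> * \<bar>x\<bar>"
    using limit_kernel_lipschitz[of "t - real j / real n" "t - real (j div N) / real K"]
    by (simp add: x_def abs_minus_commute)
  also have "\<dots> \<le> \<beta> * (1 / real K + real K / real n)" using x \<beta>_pos by (intro mult_left_mono) auto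
  also have "\<dots> \<le> \<beta> / real K + e2" using 2 by (simp add: distrib_left)
  finally have A: "\<bar>limit_kernel (t - real j / real n) - limit_kernel (t - real (j div N) / real K)\<bar> \<le> \<beta> / real K + e2" .
  define G where "G = limit_kernel (t - real (j div N) / real K)"
  have G: "0 \<le> G" "G \<le> 1" using limit_kernel_bounds by (auto simp: G_def)
  have "sqrt (real n) * block_weight N K t j = G * sqrt (real n / real (K * N))"
    using j by (simp add: block_weight_def G_def real_sqrt_divide)
  then have "G - sqrt (real n) * block_weight N K t j = G * (1 - sqrt (real n / real (K * N)))"
    by (simp only: right_diff_distrib mult_1_right)
  then have "\<bar>G - sqrt (real n) * block_weight N K t j\<bar> = G * \<bar>1 - sqrt (real n / real (K * N))\<bar>"
    using G by (simp only: abs_mult abs_of_nonneg)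
  also have "\<dots> \<le> 1 * \<bar>1 - sqrt (real n / real (K * N))\<bar>" using G by (intro mult_right_mono) auto
  finally have B: "\<bar>G - sqrt (real n) * block_weight N K t j\<bar> \<le> e3" using 3 by simp
  show ?thesis using 1 A B unfolding G_def by linarith
qed

text \<open>Both sides are linear in the orthonormal noise, so the mean square distance is a sum of
  squared coefficient differences: at most \<open>n\<close> terms of size
  \<open>4 * (\<beta> / K)\<^sup>2 / n\<close> inside the blocks, and at most \<open>K + 2\<close>
  leftover terms of size \<open>4 / n\<close>.\<close>

lemma fdd_approx:
  assumes K: "K \<ge> 1" and t: "t \<in> {0..1}"
  shows "\<forall>\<^sub>F n in sequentially.
    integrable M (\<lambda>\<omega>. \<bar>Zn n t \<omega> - step_path K (\<lambda>i. block (n div K) i \<omega>) t\<bar>) \<and>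
    expectation (\<lambda>\<omega>. \<bar>Zn n t \<omega> - step_path K (\<lambda>i. block (n div K) i \<omega>) t\<bar>) \<le> 3 * \<beta> / real K"
proof -
  \<comment> \<open>Four vanishing errors of size \<open>e\<close> add up to
    \<open>4/5 * \<beta> / K\<close>, which keeps the coefficient error below
    \<open>2 * \<beta> / K\<close>.\<close>
  define e where "e = \<beta> / (5 * real K)"
  have e: "e > 0" using \<beta>_pos K by (simp add: e_def)
  have inv0: "(\<lambda>n. c / real n) \<longlonglongrightarrow> 0" for c by (rule lim_const_over_n)
  have E1: "\<forall>\<^sub>F n in sequentially. \<forall>i\<le>n. \<bar>step_response (a n) \<phi> i - (1 - exp (- (l / m) * (real i / real n)))\<bar> \<le> e"
    by (rule step_response_tendsto_uniformly[OF a l lim e])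
  have E2: "\<forall>\<^sub>F n in sequentially. \<beta> / real n + (real n * (1 - a n)) * (1 / real n) < e"
  proof (rule order_tendstoD(2)[OF _ e])
    have "(\<lambda>n. \<beta> / real n + (real n * (1 - a n)) * (1 / real n)) \<longlonglongrightarrow> 0 + l * 0"
      by (intro tendsto_intros lim inv0)
    then show "(\<lambda>n. \<beta> / real n + (real n * (1 - a n)) * (1 / real n)) \<longlonglongrightarrow> 0" by simp
  qed
  have E3: "\<forall>\<^sub>F n in sequentially. \<beta> * real K / real n < e"
    by (rule order_tendstoD(2)[OF inv0 e])
  have E4: "\<forall>\<^sub>F n in sequentially. \<bar>1 - sqrt (real n / real (K * (n div K)))\<bar> < e"
  proof (rule order_tendstoD(2)[OF _ e])
    have "(\<lambda>n. \<bar>1 - sqrt (real n / real (K * (n div K)))\<bar>) \<longlonglongrightarrow> \<bar>1 - sqrt 1\<bar>"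
      by (intro tendsto_intros block_count_ratio[OF K])
    then show "(\<lambda>n. \<bar>1 - sqrt (real n / real (K * (n div K)))\<bar>) \<longlonglongrightarrow> 0" by simp
  qed
  \<comment> \<open>The leftover terms are allowed 5 units \<open>(\<beta> / K)\<^sup>2\<close>;
    with the 4 units from the blocks this makes 9, the square of
    \<open>3 * \<beta> / K\<close>.\<close>
  have E5: "\<forall>\<^sub>F n in sequentially. 4 * real (K + 2) / real n < 5 * (\<beta> / real K)\<^sup>2"
    by (rule order_tendstoD(2)[OF inv0]) (use \<beta>_pos K in simp)
  show ?thesis
    using E1 E2 E3 E4 E5 eventually_ge_at_top[of 1]
  proof eventually_elim
    case (elim n)
    define N where "N = n div K"
    have KN: "K * N \<le> n" "n < K * N + K"
    proof -
      have "K * N + n mod K = n" "n mod K < K" using K by (auto simp: N_def)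
      then show "K * N \<le> n" "n < K * N + K" by linarith+
    qed
    define d where "d j = ar_weight n t j / sqrt (real n) - block_weight N K t j" for j
    have eq: "Zn n t \<omega> - step_path K (\<lambda>i. block N i \<omega>) t = (\<Sum>j\<le>Suc n. d j * \<epsilon> j \<omega>)" for \<omega>
      unfolding Zn_eq[OF t] step_path_block_eq[OF KN(1)] d_def
      by (simp only: sum_subtractf left_diff_distrib)
    have d1: "(d j)\<^sup>2 \<le> 4 * (\<beta> / real K)\<^sup>2 / real n" if "j < K * N" for j
    proof -
      have "\<bar>ar_weight n t j - limit_kernel (t - real j / real n)\<bar> \<le> e + \<beta> / real n + (1 - a n)"
        by (rule ar_weight_approx) (use elim t in auto)
      also have "\<dots> \<le> e + e" using elim by (simp add: add.assoc)
      finally have "\<bar>ar_weight n t j - sqrt (real n) * block_weight N K t j\<bar> \<le> (e + e) + e + e + \<beta> / real K"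
        by (intro ar_weight_block_weight_diff[OF _ K t N_def that]) (use elim N_def in \<open>simp_all del: of_nat_mult\<close>)
      also have "\<dots> = 4 / 5 * (\<beta> / real K) + \<beta> / real K" by (simp add: e_def)
      also have "\<dots> \<le> 2 * (\<beta> / real K)" using divide_pos_pos[OF \<beta>_pos, of "real K"] K by linarith
      finally have "\<bar>ar_weight n t j - sqrt (real n) * block_weight N K t j\<bar>\<^sup>2 \<le> (2 * (\<beta> / real K))\<^sup>2"
        by (intro power_mono) auto
      then have "(ar_weight n t j - sqrt (real n) * block_weight N K t j)\<^sup>2 \<le> 4 * (\<beta> / real K)\<^sup>2"
        by (simp only: power2_abs power_mult_distrib) simp
      then have "(ar_weight n t j - sqrt (real n) * block_weight N K t j)\<^sup>2 / real n \<le> 4 * (\<beta> / real K)\<^sup>2 / real n"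
        by (rule divide_right_mono) simp
      moreover have "d j = (ar_weight n t j - sqrt (real n) * block_weight N K t j) / sqrt (real n)"
        using elim by (simp add: d_def diff_divide_distrib)
      ultimately show ?thesis by (simp only: power_divide) simp
    qed
    have d2: "(d j)\<^sup>2 \<le> 4 / real n" if "\<not> j < K * N" for j
    proof -
      have "\<bar>ar_weight n t j\<bar>\<^sup>2 \<le> 2\<^sup>2" by (intro power_mono ar_weight_abs_le) (use elim t in auto)
      then show ?thesis using that by (simp add: d_def block_weight_def power_divide divide_right_mono)
    qed
    have "(\<Sum>j\<le>Suc n. (d j)\<^sup>2) = (\<Sum>j<K * N. (d j)\<^sup>2) + (\<Sum>j\<in>{K * N..Suc n}. (d j)\<^sup>2)"
    proof -
      have "{..Suc n} = {..<K * N} \<union> {K * N..Suc n}" using KN by auto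
      then show ?thesis by (simp only:) (subst sum.union_disjoint; auto)
    qed
    also have "\<dots> \<le> (\<Sum>j<K * N. 4 * (\<beta> / real K)\<^sup>2 / real n) + (\<Sum>j\<in>{K * N..Suc n}. 4 / real n)"
      by (intro add_mono sum_mono d1 d2) auto
    also have "\<dots> = real (K * N) / real n * (4 * (\<beta> / real K)\<^sup>2) + real (Suc (Suc n) - K * N) * 4 / real n"
      by simp
    also have "\<dots> \<le> 1 * (4 * (\<beta> / real K)\<^sup>2) + 4 * real (K + 2) / real n"
    proof (intro add_mono mult_right_mono)
      have "real (Suc (Suc n) - K * N) \<le> real (K + 2)" using KN by linarith
      then show "real (Suc (Suc n) - K * N) * 4 / real n \<le> 4 * real (K + 2) / real n"
        by (intro divide_right_mono) auto
      show "real (K * N) / real n \<le> 1" using KN by (auto simp: divide_le_eq_1 simp del: of_nat_mult)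
    qed auto
    also have "\<dots> \<le> 9 * (\<beta> / real K)\<^sup>2" using elim by simp
    also have "\<dots> = (3 * \<beta> / real K)\<^sup>2" by (simp add: power_divide power_mult_distrib)
    finally have sum_le: "(\<Sum>j\<le>Suc n. (d j)\<^sup>2) \<le> (3 * \<beta> / real K)\<^sup>2" .
    have "integrable M (\<lambda>\<omega>. \<bar>\<Sum>j\<le>Suc n. d j * \<epsilon> j \<omega>\<bar>) \<and>
        expectation (\<lambda>\<omega>. \<bar>\<Sum>j\<le>Suc n. d j * \<epsilon> j \<omega>\<bar>) \<le> 3 * \<beta> / real K"
    proof -
      have meas: "(\<lambda>\<omega>. \<Sum>j\<le>Suc n. d j * \<epsilon> j \<omega>) \<in> borel_measurable M" by measurable
      have "expectation (\<lambda>\<omega>. (\<Sum>j\<le>Suc n. d j * \<epsilon> j \<omega>)\<^sup>2) \<le> (3 * \<beta> / real K)\<^sup>2"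
        using sum_le unfolding noise_sum_sq(2)[OF finite_atMost] .
      from expectation_abs_le[OF meas noise_sum_sq(1)[OF finite_atMost] this] show ?thesis
        using \<beta>_pos K by simp
    qed
    then show ?case unfolding N_def[symmetric] eq .
  qed
qed

text \<open>The distance of two Bernstein paths is at most the sum of the differences at the
  \<open>k + 1\<close> nodes. This factor is why \<open>K\<close> is chosen after
  \<open>k\<close>.\<close>

lemma fdd_approx_functional:
  assumes F: "bounded_lipschitz F L b" and K: "K \<ge> 1" and k: "k \<ge> 1"
  shows "\<forall>\<^sub>F n in sequentially.
    \<bar>expectation (\<lambda>\<omega>. F (bernstein_op k (\<lambda>t. Zn n t \<omega>)))
     - expectation (\<lambda>\<omega>. F (bernstein_op k (step_path K (\<lambda>i. block (n div K) i \<omega>))))\<bar>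
    \<le> L * (real (Suc k) * (3 * \<beta> / real K))"
proof -
  have "\<forall>\<^sub>F n in sequentially. \<forall>i\<in>{..k}.
    integrable M (\<lambda>\<omega>. \<bar>Zn n (real i / real k) \<omega> - step_path K (\<lambda>i. block (n div K) i \<omega>) (real i / real k)\<bar>) \<and>
    expectation (\<lambda>\<omega>. \<bar>Zn n (real i / real k) \<omega> - step_path K (\<lambda>i. block (n div K) i \<omega>) (real i / real k)\<bar>) \<le> 3 * \<beta> / real K"
    by (intro eventually_ball_finite ballI fdd_approx K) (use k in \<open>auto simp: divide_le_eq_1\<close>)
  then show ?thesis
  proof eventually_elim
    case (elim n)
    let ?D = "\<lambda>i \<omega>. \<bar>Zn n (real i / real k) \<omega> - step_path K (\<lambda>i. block (n div K) i \<omega>) (real i / real k)\<bar>"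
    have "\<bar>expectation (\<lambda>\<omega>. F (bernstein_op k (\<lambda>t. Zn n t \<omega>)))
       - expectation (\<lambda>\<omega>. F (bernstein_op k (step_path K (\<lambda>i. block (n div K) i \<omega>))))\<bar>
       \<le> L * expectation (\<lambda>\<omega>. \<Sum>i\<le>k. ?D i \<omega>)"
    proof (rule bounded_lipschitz_expectation_diff[OF F])
      show "(\<lambda>\<omega>. bernstein_op k (\<lambda>t. Zn n t \<omega>)) \<in> measurable M borel_C01"
        by (intro bernstein_path_measurable rescaled_process_measurable)
      show "(\<lambda>\<omega>. bernstein_op k (step_path K (\<lambda>i. block (n div K) i \<omega>))) \<in> measurable M borel_C01"
        unfolding step_path_def block_def by (intro bernstein_path_measurable) measurable
    qed (use elim mdist_bernstein_path in \<open>auto intro: Bochner_Integration.integrable_sum\<close>)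
    also have "\<dots> = L * (\<Sum>i\<le>k. expectation (?D i))"
      using elim by (subst Bochner_Integration.integral_sum) auto
    also have "\<dots> \<le> L * (\<Sum>i\<le>k. 3 * \<beta> / real K)"
      using elim F by (intro mult_left_mono sum_mono) (auto simp: bounded_lipschitz_def)
    finally show ?case by simp
  qed
qed

end

section \<open>The Wiener integral\<close>

definition partition_points :: "nat \<Rightarrow> (nat \<Rightarrow> real) \<Rightarrow> bool" where
  "partition_points k p \<longleftrightarrow> 0 \<le> p 0 \<and> (\<forall>i<k. p i \<le> p (Suc i))"

lemma partition_points_mono: "partition_points k p \<Longrightarrow> i \<le> j \<Longrightarrow> j \<le> k \<Longrightarrow> p i \<le> p j"
proof (induction j)
  case (Suc j)
  then show ?case by (cases "i = Suc j") (auto simp: partition_points_def intro: order_trans)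
qed simp

lemma partition_points_nonneg: "partition_points k p \<Longrightarrow> i \<le> k \<Longrightarrow> 0 \<le> p i"
  using partition_points_mono[of k p 0 i] by (auto simp: partition_points_def)

lemma step_fun_measurable [measurable]: "step_fun k p c \<in> borel_measurable borel"
  unfolding step_fun_def[abs_def] by measurable

lemma step_fun_outside:
  assumes "partition_points k p" "a \<le> p 0" "p k \<le> b" "s \<notin> {a..b}"
  shows "step_fun k p c s = 0"
  unfolding step_fun_def
proof (intro sum.neutral ballI)
  fix i assume "i \<in> {..<k}"
  then have "p 0 \<le> p i" "p (Suc i) \<le> p k" using partition_points_mono[OF assms(1)] by auto
  then have "s \<notin> {p i<..p (Suc i)}" using assms by auto
  then show "c i * indicator {p i<..p (Suc i)} s = 0" by simp
qed

lemma step_fun_value: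
  assumes t: "0 < t" and s: "s \<in> {0<..t}" and K: "K > 0"
  obtains i where "i < K" "s \<in> {real i * t / real K<..real (Suc i) * t / real K}"
    "\<And>c. step_fun K (\<lambda>i. real i * t / real K) c s = c i"
proof -
  define z where "z = s * real K / t"
  have z: "0 < z" "z \<le> real K" using s t K by (auto simp: z_def field_simps)
  \<comment> \<open>The intervals are open on the left, so the index is the ceiling minus one rather
    than the floor.\<close>
  define i where "i = nat (\<lceil>z\<rceil> - 1)"
  have i: "real i < z" "z \<le> real (Suc i)" using z by (auto simp: i_def) linarith+
  have iK: "i < K" using i z by linarith
  have iff: "s \<in> {real j * t / real K<..real (Suc j) * t / real K} \<longleftrightarrow> real j < z \<and> z \<le> real (Suc j)" for j
    using t K by (auto simp: z_def field_simps simp del: of_nat_Suc)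
  have "step_fun K (\<lambda>i. real i * t / real K) c s = c i" for c
  proof -
    have "c j * indicator {real j * t / real K<..real (Suc j) * t / real K} s = (if j = i then c i else 0)" for j
    proof (cases "j = i")
      case False
      then have "\<not> (real j < z \<and> z \<le> real (Suc j))" using i by linarith
      then have "s \<notin> {real j * t / real K<..real (Suc j) * t / real K}" using iff[of j] by blast
      then show ?thesis using False by (simp add: indicator_def del: greaterThanAtMost_iff of_nat_Suc)
    next
      case True
      then have "s \<in> {real j * t / real K<..real (Suc j) * t / real K}" using iff[of j] i by blast
      then show ?thesis using True by (simp add: indicator_def del: greaterThanAtMost_iff of_nat_Suc)
    qed
    then show ?thesis using iK by (simp add: step_fun_def)
  qed
  with iK i iff show ?thesis using that by blast
qed

text \<open>The pointwise inequality with factors 2 replaces Minkowski and avoids square roots of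
  possibly infinite integrals.\<close>

lemma nn_integral_sq_triangle:
  fixes f g h :: "'x \<Rightarrow> real"
  assumes [measurable]: "f \<in> borel_measurable Q" "g \<in> borel_measurable Q" "h \<in> borel_measurable Q"
  shows "(\<integral>\<^sup>+x. ennreal ((f x - h x)\<^sup>2) \<partial>Q)
     \<le> 2 * (\<integral>\<^sup>+x. ennreal ((f x - g x)\<^sup>2) \<partial>Q) + 2 * (\<integral>\<^sup>+x. ennreal ((g x - h x)\<^sup>2) \<partial>Q)"
proof -
  have "(x - z)\<^sup>2 \<le> 2 * (x - y)\<^sup>2 + 2 * (y - z)\<^sup>2" for x y z :: real
  proof -
    have "0 \<le> ((x - y) - (y - z))\<^sup>2" by simp
    then show ?thesis by (simp add: power2_eq_square algebra_simps)
  qed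
  then have "ennreal ((f x - h x)\<^sup>2) \<le> 2 * ennreal ((f x - g x)\<^sup>2) + 2 * ennreal ((g x - h x)\<^sup>2)" for x
  proof -
    have "ennreal ((f x - h x)\<^sup>2) \<le> ennreal (2 * (f x - g x)\<^sup>2 + 2 * (g x - h x)\<^sup>2)"
      by (intro ennreal_leI) fact
    then show ?thesis by (simp add: ennreal_plus ennreal_mult)
  qed
  then have "(\<integral>\<^sup>+x. ennreal ((f x - h x)\<^sup>2) \<partial>Q)
     \<le> (\<integral>\<^sup>+x. 2 * ennreal ((f x - g x)\<^sup>2) + 2 * ennreal ((g x - h x)\<^sup>2) \<partial>Q)"
    by (intro nn_integral_mono) auto
  also have "\<dots> = 2 * (\<integral>\<^sup>+x. ennreal ((f x - g x)\<^sup>2) \<partial>Q) + 2 * (\<integral>\<^sup>+x. ennreal ((g x - h x)\<^sup>2) \<partial>Q)"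
    by (simp add: nn_integral_add nn_integral_cmult)
  finally show ?thesis .
qed

section \<open>Ito isometry and uniqueness of the Wiener integral\<close>

locale brownian = prob_space N for N :: "'b measure" +
  fixes W :: "real \<Rightarrow> 'b \<Rightarrow> real"
  assumes bm: "std_brownian_motion N W"
begin

lemma W_measurable: "0 \<le> t \<Longrightarrow> W t \<in> borel_measurable N"
  using bm by (simp add: std_brownian_motion_def)

lemma incr_distributed:
  "0 \<le> s \<Longrightarrow> s < t \<Longrightarrow> distributed N lborel (\<lambda>\<omega>. W t \<omega> - W s \<omega>) (normal_density 0 (sqrt (t - s)))"
  using bm by (simp add: std_brownian_motion_def)

lemma incr_indep:
  assumes "0 \<le> p 0" "\<And>i. i < k \<Longrightarrow> p i < p (Suc i)"
  shows "indep_vars (\<lambda>_. borel) (\<lambda>i \<omega>. W (p (Suc i)) \<omega> - W (p i) \<omega>) {..<k}"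
  using bm[unfolded std_brownian_motion_def, THEN conjunct2, THEN conjunct2, THEN conjunct2, THEN conjunct2, THEN conjunct2,
      rule_format, of p k] assms by simp

lemma incr_moments:
  assumes "0 \<le> s" "s \<le> t"
  shows "integrable N (\<lambda>\<omega>. W t \<omega> - W s \<omega>)" "expectation (\<lambda>\<omega>. W t \<omega> - W s \<omega>) = 0"
    "integrable N (\<lambda>\<omega>. (W t \<omega> - W s \<omega>)\<^sup>2)" "expectation (\<lambda>\<omega>. (W t \<omega> - W s \<omega>)\<^sup>2) = t - s"
proof -
  have "integrable N (\<lambda>\<omega>. W t \<omega> - W s \<omega>) \<and> expectation (\<lambda>\<omega>. W t \<omega> - W s \<omega>) = 0 \<and>
    integrable N (\<lambda>\<omega>. (W t \<omega> - W s \<omega>)\<^sup>2) \<and> expectation (\<lambda>\<omega>. (W t \<omega> - W s \<omega>)\<^sup>2) = t - s"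
  proof (cases "s = t")
    case False
    then have st: "s < t" using assms by simp
    note D = incr_distributed[OF assms(1) st]
    have pos: "0 < sqrt (t - s)" using st by simp
    have i1: "integrable N (\<lambda>\<omega>. W t \<omega> - W s \<omega>)"
    proof -
      have "integrable lborel (\<lambda>x. normal_density 0 (sqrt (t - s)) x * x)"
        using integrable_normal_moment[OF pos, of 0 1] by (simp only: diff_0_right power_one_right)
      then show ?thesis using distributed_integrable[OF D, of "\<lambda>x. x"] by simp
    qed
    have i2: "integrable N (\<lambda>\<omega>. (W t \<omega> - W s \<omega>)\<^sup>2)"
      using distributed_integrable[OF D, of "\<lambda>x. x\<^sup>2"] integrable_normal_moment[OF pos, of 0 2] by simp
    have e1: "expectation (\<lambda>\<omega>. W t \<omega> - W s \<omega>) = 0"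
      by (rule normal_distributed_expectation[OF pos D])
    have "variance (\<lambda>\<omega>. W t \<omega> - W s \<omega>) = (sqrt (t - s))\<^sup>2"
      by (rule normal_distributed_variance[OF pos D])
    with i1 i2 e1 st show ?thesis by simp
  qed simp
  then show "integrable N (\<lambda>\<omega>. W t \<omega> - W s \<omega>)" "expectation (\<lambda>\<omega>. W t \<omega> - W s \<omega>) = 0"
    "integrable N (\<lambda>\<omega>. (W t \<omega> - W s \<omega>)\<^sup>2)" "expectation (\<lambda>\<omega>. (W t \<omega> - W s \<omega>)\<^sup>2) = t - s" by auto
qed

text \<open>Subtracting \<open>W 0\<close>, which vanishes only almost surely, makes the covariance identity hold
  without exceptional sets and leaves all increments unchanged.\<close>
lemma covariance:
  assumes "0 \<le> s" "0 \<le> t"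
  shows "integrable N (\<lambda>\<omega>. (W s \<omega> - W 0 \<omega>) * (W t \<omega> - W 0 \<omega>))"
    "expectation (\<lambda>\<omega>. (W s \<omega> - W 0 \<omega>) * (W t \<omega> - W 0 \<omega>)) = min s t"
proof -
  have "integrable N (\<lambda>\<omega>. (W s \<omega> - W 0 \<omega>) * (W t \<omega> - W 0 \<omega>)) \<and>
    expectation (\<lambda>\<omega>. (W s \<omega> - W 0 \<omega>) * (W t \<omega> - W 0 \<omega>)) = min s t"
    using assms
  proof (induction s t rule: linorder_wlog)
    case (sym s t)
    then show ?case by (simp add: mult.commute min.commute)
  next
    case (le s t)
    note sq = incr_moments[of 0 s]
    consider "s = 0" | "s = t" | "0 < s" "s < t" using le by linarith
    then show ?case
    proof cases
      case 1 then show ?thesis using le by simp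
    next
      case 2 then show ?thesis using sq le by (simp add: power2_eq_square)
    next
      case 3
      define p where "p i = (if i = 0 then 0 else if i = Suc 0 then s else t)" for i :: nat
      define D where "D i \<omega> = W (p (Suc i)) \<omega> - W (p i) \<omega>" for i \<omega>
      have ind: "indep_vars (\<lambda>_. borel) D {..<2}"
        unfolding D_def[abs_def] by (rule incr_indep) (use 3 in \<open>auto simp: p_def\<close>)
      have D: "D 0 = (\<lambda>\<omega>. W s \<omega> - W 0 \<omega>)" "D 1 = (\<lambda>\<omega>. W t \<omega> - W s \<omega>)"
        by (auto simp: D_def p_def fun_eq_iff)
      have int: "integrable N (D i)" if "i \<in> {..<2}" for i
        using that incr_moments(1)[of 0 s] incr_moments(1)[of s t] 3 D
        by (auto simp: less_2_cases_iff)
      have "integrable N (\<lambda>\<omega>. \<Prod>i<2. D i \<omega>)" "expectation (\<lambda>\<omega>. \<Prod>i<2. D i \<omega>) = (\<Prod>i<2. expectation (D i))"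
        by (auto intro!: indep_vars_integrable indep_vars_lebesgue_integral ind int)
      then have p: "integrable N (\<lambda>\<omega>. (W s \<omega> - W 0 \<omega>) * (W t \<omega> - W s \<omega>))"
        "expectation (\<lambda>\<omega>. (W s \<omega> - W 0 \<omega>) * (W t \<omega> - W s \<omega>)) = 0"
        using incr_moments(2)[of 0 s] 3 by (simp_all add: numeral_2_eq_2 D[unfolded One_nat_def])
      have eq: "(W s \<omega> - W 0 \<omega>) * (W t \<omega> - W 0 \<omega>) = (W s \<omega> - W 0 \<omega>)\<^sup>2 + (W s \<omega> - W 0 \<omega>) * (W t \<omega> - W s \<omega>)" for \<omega>
        by (simp add: algebra_simps power2_eq_square)
      show ?thesis unfolding eq using p sq 3 by simp
    qed
  qed
  then show "integrable N (\<lambda>\<omega>. (W s \<omega> - W 0 \<omega>) * (W t \<omega> - W 0 \<omega>))"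
    "expectation (\<lambda>\<omega>. (W s \<omega> - W 0 \<omega>) * (W t \<omega> - W 0 \<omega>)) = min s t" by auto
qed

text \<open>Everything reduces to the covariance \<open>min s t\<close>, and the four endpoint terms
  combine to the length of the overlap. Arbitrary overlaps are allowed, so step functions on
  different partitions need no common refinement.\<close>

lemma incr_product:
  assumes ab: "0 \<le> a" "a \<le> b" and cd: "0 \<le> c" "c \<le> d"
  shows "integrable N (\<lambda>\<omega>. (W b \<omega> - W a \<omega>) * (W d \<omega> - W c \<omega>))"
    "integrable lborel (\<lambda>s. indicator {a<..b} s * indicator {c<..d} s :: real)"
    "expectation (\<lambda>\<omega>. (W b \<omega> - W a \<omega>) * (W d \<omega> - W c \<omega>)) = (\<integral>s. indicator {a<..b} s * indicator {c<..d} s \<partial>lborel)"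
proof -
  define R where "R s \<omega> = W s \<omega> - W 0 \<omega>" for s \<omega>
  have eq: "(W b \<omega> - W a \<omega>) * (W d \<omega> - W c \<omega>) = (R b \<omega> * R d \<omega> - R b \<omega> * R c \<omega>) - (R a \<omega> * R d \<omega> - R a \<omega> * R c \<omega>)" for \<omega>
    by (simp add: R_def algebra_simps)
  have R: "integrable N (\<lambda>\<omega>. R s \<omega> * R t \<omega>)" "expectation (\<lambda>\<omega>. R s \<omega> * R t \<omega>) = min s t"
    if "0 \<le> s" "0 \<le> t" for s t
    using covariance[OF that] by (auto simp: R_def)
  show "integrable N (\<lambda>\<omega>. (W b \<omega> - W a \<omega>) * (W d \<omega> - W c \<omega>))"
    unfolding eq using R ab cd by (intro Bochner_Integration.integrable_diff) auto
  have E: "expectation (\<lambda>\<omega>. (W b \<omega> - W a \<omega>) * (W d \<omega> - W c \<omega>)) = (min b d - min b c) - (min a d - min a c)"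
    unfolding eq using R ab cd by (simp add: Bochner_Integration.integral_diff Bochner_Integration.integrable_diff)
  have ind: "(\<lambda>s. indicator {a<..b} s * indicator {c<..d} s :: real) = indicator {max a c<..min b d}"
    by (auto simp: fun_eq_iff indicator_def)
  have Ioc: "emeasure lborel {x<..y} = ennreal (max 0 (y - x))" for x y :: real
    by (cases "x \<le> y") (simp_all add: max_def)
  show "integrable lborel (\<lambda>s. indicator {a<..b} s * indicator {c<..d} s :: real)"
    unfolding ind by (rule integrable_real_indicator) (simp_all add: Ioc)
  have "(\<integral>s. indicator {a<..b} s * indicator {c<..d} s \<partial>lborel) = max 0 (min b d - max a c)"
    unfolding ind by (simp add: measure_def Ioc del: ennreal_max_0)
  then show "expectation (\<lambda>\<omega>. (W b \<omega> - W a \<omega>) * (W d \<omega> - W c \<omega>)) = (\<integral>s. indicator {a<..b} s * indicator {c<..d} s \<partial>lborel)"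
    unfolding E using ab cd by (auto simp: min_def max_def)
qed

lemma step_product:
  assumes p: "partition_points k p" and p': "partition_points k' p'"
  shows "integrable N (\<lambda>\<omega>. step_integral W k p c \<omega> * step_integral W k' p' c' \<omega>)"
    "integrable lborel (\<lambda>s. step_fun k p c s * step_fun k' p' c' s)"
    "expectation (\<lambda>\<omega>. step_integral W k p c \<omega> * step_integral W k' p' c' \<omega>)
      = (\<integral>s. step_fun k p c s * step_fun k' p' c' s \<partial>lborel)"
proof -
  have I: "step_integral W k p c \<omega> * step_integral W k' p' c' \<omega>
      = (\<Sum>i<k. \<Sum>j<k'. (c i * c' j) * ((W (p (Suc i)) \<omega> - W (p i) \<omega>) * (W (p' (Suc j)) \<omega> - W (p' j) \<omega>)))" for \<omega>
    unfolding step_integral_def sum_product by (intro sum.cong) (auto simp: mult_ac)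
  have F: "step_fun k p c s * step_fun k' p' c' s
      = (\<Sum>i<k. \<Sum>j<k'. (c i * c' j) * (indicator {p i<..p (Suc i)} s * indicator {p' j<..p' (Suc j)} s))" for s
    unfolding step_fun_def sum_product by (intro sum.cong) (auto simp: mult_ac)
  note ip = incr_product[OF partition_points_nonneg[OF p] _ partition_points_nonneg[OF p']]
  have P: "p i \<le> p (Suc i)" if "i < k" for i using p that by (simp add: partition_points_def)
  have P': "p' i \<le> p' (Suc i)" if "i < k'" for i using p' that by (simp add: partition_points_def)
  show "integrable N (\<lambda>\<omega>. step_integral W k p c \<omega> * step_integral W k' p' c' \<omega>)"
    unfolding I by (intro Bochner_Integration.integrable_sum integrable_mult_right ip P P') auto
  show "integrable lborel (\<lambda>s. step_fun k p c s * step_fun k' p' c' s)"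
    unfolding F by (intro Bochner_Integration.integrable_sum integrable_mult_right ip P P') auto
  show "expectation (\<lambda>\<omega>. step_integral W k p c \<omega> * step_integral W k' p' c' \<omega>)
      = (\<integral>s. step_fun k p c s * step_fun k' p' c' s \<partial>lborel)"
    unfolding I F
    by (subst (1 2) Bochner_Integration.integral_sum, (intro Bochner_Integration.integrable_sum integrable_mult_right ip P P'; simp)+,
        intro sum.cong refl,
        subst (1 2) Bochner_Integration.integral_sum, (intro integrable_mult_right ip P P'; simp)+,
        intro sum.cong refl)
       (simp add: ip P P')
qed

text \<open>Expanding the square leaves three products covered by \<open>step_product\<close>. The
  partitions are unrelated because two approximating sequences of the same integral will be
  compared; nonnegative integrals match the definition of the Wiener integral.\<close>

lemma step_isometry:
  assumes p: "partition_points k p" and p': "partition_points k' p'"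
  shows "(\<integral>\<^sup>+\<omega>. ennreal ((step_integral W k p c \<omega> - step_integral W k' p' c' \<omega>)\<^sup>2) \<partial>N)
     = (\<integral>\<^sup>+s. ennreal ((step_fun k p c s - step_fun k' p' c' s)\<^sup>2) \<partial>lborel)"
proof -
  have eq: "(x - y)\<^sup>2 = (x * x - x * y) - (x * y - y * y)" for x y :: real
    by (simp add: algebra_simps power2_eq_square)
  note sp = step_product[OF p p, of c c] step_product[OF p p', of c c'] step_product[OF p' p', of c' c']
  have 1: "integrable N (\<lambda>\<omega>. (step_integral W k p c \<omega> - step_integral W k' p' c' \<omega>)\<^sup>2)"
    unfolding eq by (intro Bochner_Integration.integrable_diff sp)
  have 2: "integrable lborel (\<lambda>s. (step_fun k p c s - step_fun k' p' c' s)\<^sup>2)"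
    unfolding eq by (intro Bochner_Integration.integrable_diff sp)
  have "expectation (\<lambda>\<omega>. (step_integral W k p c \<omega> - step_integral W k' p' c' \<omega>)\<^sup>2)
      = (\<integral>s. (step_fun k p c s - step_fun k' p' c' s)\<^sup>2 \<partial>lborel)"
    unfolding eq using sp by (simp add: Bochner_Integration.integral_diff Bochner_Integration.integrable_diff)
  then show ?thesis
    using nn_integral_eq_integral[OF 1] nn_integral_eq_integral[OF 2] by simp
qed

lemma step_integral_measurable:
  assumes "partition_points k p"
  shows "step_integral W k p c \<in> borel_measurable N"
  unfolding step_integral_def[abs_def]
  by (intro borel_measurable_sum borel_measurable_times borel_measurable_const borel_measurable_diff W_measurable partition_points_nonneg[OF assms]) auto

text \<open>The way from \<open>I\<close> to \<open>I'\<close> leads through the two step integrals;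
  the isometry turns the middle distance into one between step functions, both close to
  \<open>f\<close>.\<close>

lemma wiener_integral_unique:
  assumes a: "0 \<le> a" and I: "has_wiener_integral N W a b f I" and I': "has_wiener_integral N W a b f I'"
  shows "AE \<omega> in N. I \<omega> = I' \<omega>"
proof -
  obtain k p c where m: "set_borel_measurable lborel {a..b} f" "I \<in> borel_measurable N"
    and p: "\<And>n. a \<le> p n 0" "\<And>n. p n (k n) \<le> b" "\<And>n i. i < k n \<Longrightarrow> p n i \<le> p n (Suc i)"
    and f: "(\<lambda>n. \<integral>\<^sup>+ s\<in>{a..b}. ennreal ((f s - step_fun (k n) (p n) (c n) s)\<^sup>2) \<partial>lborel) \<longlonglongrightarrow> 0"
    and S: "(\<lambda>n. \<integral>\<^sup>+ \<omega>. ennreal ((I \<omega> - step_integral W (k n) (p n) (c n) \<omega>)\<^sup>2) \<partial>N) \<longlonglongrightarrow> 0"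
    using I unfolding has_wiener_integral_def by blast
  obtain k' p' c' where m': "I' \<in> borel_measurable N"
    and p': "\<And>n. a \<le> p' n 0" "\<And>n. p' n (k' n) \<le> b" "\<And>n i. i < k' n \<Longrightarrow> p' n i \<le> p' n (Suc i)"
    and f': "(\<lambda>n. \<integral>\<^sup>+ s\<in>{a..b}. ennreal ((f s - step_fun (k' n) (p' n) (c' n) s)\<^sup>2) \<partial>lborel) \<longlonglongrightarrow> 0"
    and S': "(\<lambda>n. \<integral>\<^sup>+ \<omega>. ennreal ((I' \<omega> - step_integral W (k' n) (p' n) (c' n) \<omega>)\<^sup>2) \<partial>N) \<longlonglongrightarrow> 0"
    using I' unfolding has_wiener_integral_def by blast
  have part: "partition_points (k n) (p n)" "partition_points (k' n) (p' n)" for n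
    using p p' a order_trans[OF a p(1)] order_trans[OF a p'(1)] by (auto simp: partition_points_def)
  define T where "T n = step_integral W (k n) (p n) (c n)" for n
  define T' where "T' n = step_integral W (k' n) (p' n) (c' n)" for n
  define g where "g n = step_fun (k n) (p n) (c n)" for n
  define g' where "g' n = step_fun (k' n) (p' n) (c' n)" for n
  have Tm: "T n \<in> borel_measurable N" "T' n \<in> borel_measurable N" for n
    by (auto simp: T_def T'_def intro!: step_integral_measurable part)
  define A where "A n = (\<integral>\<^sup>+ \<omega>. ennreal ((I \<omega> - T n \<omega>)\<^sup>2) \<partial>N)" for n
  define A' where "A' n = (\<integral>\<^sup>+ \<omega>. ennreal ((I' \<omega> - T' n \<omega>)\<^sup>2) \<partial>N)" for n
  define B where "B n = (\<integral>\<^sup>+ s\<in>{a..b}. ennreal ((f s - g n s)\<^sup>2) \<partial>lborel)" for n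
  define B' where "B' n = (\<integral>\<^sup>+ s\<in>{a..b}. ennreal ((f s - g' n s)\<^sup>2) \<partial>lborel)" for n
  \<comment> \<open>The step functions vanish off \<open>{a..b}\<close>, so cutting \<open>f\<close>
    to this interval lets the isometry over the whole line be compared with integrals over
    \<open>{a..b}\<close>.\<close>
  define h where "h s = indicator {a..b} s * f s" for s
  have hm: "h \<in> borel_measurable lborel"
    using m(1) by (simp add: set_borel_measurable_def h_def[abs_def])
  have gm: "g n \<in> borel_measurable lborel" "g' n \<in> borel_measurable lborel" for n
    by (auto simp: g_def g'_def)
  have out: "g n s = 0" "g' n s = 0" if "s \<notin> {a..b}" for n s
    using step_fun_outside[OF part(1) p(1,2) that] step_fun_outside[OF part(2) p'(1,2) that]
    by (auto simp: g_def g'_def)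
  have "(\<integral>\<^sup>+ s. ennreal ((h s - g n s)\<^sup>2) \<partial>lborel) = B n" "(\<integral>\<^sup>+ s. ennreal ((h s - g' n s)\<^sup>2) \<partial>lborel) = B' n" for n
    unfolding B_def B'_def
    by (intro nn_integral_cong; simp add: h_def indicator_def out split: split_indicator)+
  then have B: "(\<integral>\<^sup>+ s. ennreal ((g n s - h s)\<^sup>2) \<partial>lborel) = B n" "(\<integral>\<^sup>+ s. ennreal ((h s - g' n s)\<^sup>2) \<partial>lborel) = B' n" for n
    by (simp_all add: power2_commute)
  have bound: "(\<integral>\<^sup>+ \<omega>. ennreal ((I \<omega> - I' \<omega>)\<^sup>2) \<partial>N) \<le> 2 * A n + 2 * (2 * (2 * B n + 2 * B' n) + 2 * A' n)" for n
  proof -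
    have "(\<integral>\<^sup>+ \<omega>. ennreal ((I \<omega> - I' \<omega>)\<^sup>2) \<partial>N) \<le> 2 * A n + 2 * (\<integral>\<^sup>+ \<omega>. ennreal ((T n \<omega> - I' \<omega>)\<^sup>2) \<partial>N)"
      unfolding A_def by (rule nn_integral_sq_triangle[OF m(2) Tm(1) m'])
    also have "(\<integral>\<^sup>+ \<omega>. ennreal ((T n \<omega> - I' \<omega>)\<^sup>2) \<partial>N)
        \<le> 2 * (\<integral>\<^sup>+ \<omega>. ennreal ((T n \<omega> - T' n \<omega>)\<^sup>2) \<partial>N) + 2 * A' n"
      unfolding A'_def power2_commute[of "I' _"] by (rule nn_integral_sq_triangle[OF Tm(1) Tm(2) m'])
    also have "(\<integral>\<^sup>+ \<omega>. ennreal ((T n \<omega> - T' n \<omega>)\<^sup>2) \<partial>N) = (\<integral>\<^sup>+ s. ennreal ((g n s - g' n s)\<^sup>2) \<partial>lborel)"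
      unfolding T_def T'_def g_def g'_def by (rule step_isometry[OF part])
    also have "\<dots> \<le> 2 * B n + 2 * B' n"
      using nn_integral_sq_triangle[OF gm(1) hm gm(2), of n n] B by simp
    finally show ?thesis by (simp add: add_mono mult_left_mono)
  qed
  have lims: "A \<longlonglongrightarrow> 0" "A' \<longlonglongrightarrow> 0" "B \<longlonglongrightarrow> 0" "B' \<longlonglongrightarrow> 0"
    using S S' f f' unfolding A_def[abs_def] A'_def[abs_def] B_def[abs_def] B'_def[abs_def] T_def T'_def g_def g'_def by auto
  have c: "(\<lambda>n. 2 * X n) \<longlonglongrightarrow> 0" if "X \<longlonglongrightarrow> 0" for X :: "nat \<Rightarrow> ennreal"
    using ennreal_tendsto_cmult[OF _ that, of 2] by simp
  have z: "(\<lambda>n. X n + X' n) \<longlonglongrightarrow> 0" if "X \<longlonglongrightarrow> 0" "X' \<longlonglongrightarrow> 0" for X X' :: "nat \<Rightarrow> ennreal"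
    using tendsto_add[OF that] by simp
  have "(\<lambda>n. 2 * A n + 2 * (2 * (2 * B n + 2 * B' n) + 2 * A' n)) \<longlonglongrightarrow> 0"
    by (intro c z lims)
  then have "(\<integral>\<^sup>+ \<omega>. ennreal ((I \<omega> - I' \<omega>)\<^sup>2) \<partial>N) \<le> 0"
    by (rule LIMSEQ_le_const) (use bound in auto)
  then have "(\<integral>\<^sup>+ \<omega>. ennreal ((I \<omega> - I' \<omega>)\<^sup>2) \<partial>N) = 0" by simp
  then have "AE \<omega> in N. ennreal ((I \<omega> - I' \<omega>)\<^sup>2) = 0"
    using m(2) m' by (subst (asm) nn_integral_0_iff_AE) auto
  then show ?thesis by eventually_elim simp
qed

lemma wiener_process_unique:
  assumes Z: "continuous_wiener_process N W K Z" and Z': "continuous_wiener_process N W K Z'"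
  shows "AE \<omega> in N. \<forall>t\<in>{0..1}. Z t \<omega> = Z' t \<omega>"
proof -
  \<comment> \<open>Countably many exceptional sets can be united; continuity then extends the
    equality to the closure, which includes the endpoints.\<close>
  have "AE \<omega> in N. \<forall>t\<in>{0<..<1} \<inter> \<rat>. Z t \<omega> = Z' t \<omega>"
    using Z Z' countable_rat
    by (intro AE_ball_countable[THEN iffD2] ballI wiener_integral_unique[of 0])
       (auto simp: continuous_wiener_process_def intro: countable_Int2)
  with AE_space show ?thesis
  proof eventually_elim
    case (elim \<omega>)
    have cont: "continuous_on {0..1} (\<lambda>t. Z t \<omega> - Z' t \<omega>)"
      using Z Z' elim by (auto simp: continuous_wiener_process_def intro: continuous_on_diff)
    have "closure (\<rat> :: real set) = UNIV"
      by (auto simp: closure_approachable dist_real_def) (metis rational_approximation)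
    then have cl: "closure ({0<..<1} \<inter> \<rat>) = {0..1::real}"
      by (subst closure_open_Int_superset) auto
    have "Z t \<omega> - Z' t \<omega> = 0" if "t \<in> {0..1}" for t
      by (rule continuous_constant_on_closure[where S="{0<..<1} \<inter> \<rat>" and f="\<lambda>t. Z t \<omega> - Z' t \<omega>"])
         (use cont cl elim that in auto)
    then show ?case by simp
  qed
qed

end

section \<open>Pathwise Riemann sums and Wiener integrals\<close>

lemma ennreal_pos_between:
  assumes "0 < (u :: ennreal)"
  shows "\<exists>\<eta>>0. ennreal \<eta> < u"
proof (cases u)
  case (real r)
  then have "0 < r" using assms by (simp add: ennreal_less_zero_iff)
  then have "ennreal (r / 2) < ennreal r" by (intro ennreal_lessI) auto
  with real \<open>0 < r\<close> show ?thesis by (intro exI[of _ "r / 2"]) auto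
next
  case top
  then show ?thesis by (intro exI[of _ 1]) auto
qed

lemma abel_sum:
  fixes h w :: "nat \<Rightarrow> real"
  shows "(\<Sum>i<K. h i * (w (Suc i) - w i)) = h K * w K - h 0 * w 0 - (\<Sum>i<K. w (Suc i) * (h (Suc i) - h i))"
  by (induction K) (simp_all add: algebra_simps)

lemma integral_partition:
  fixes f :: "real \<Rightarrow> real" and p :: "nat \<Rightarrow> real"
  assumes "\<And>i. i < K \<Longrightarrow> p i \<le> p (Suc i)" "f integrable_on {p 0..p K}"
  shows "integral {p 0..p K} f = (\<Sum>i<K. integral {p i..p (Suc i)} f)"
  using assms
proof (induction K)
  case (Suc K)
  have mono: "p 0 \<le> p j" if "j \<le> K" for j
    using that Suc.prems(1) by (induction j) (auto intro: order_trans)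
  have "f integrable_on {p 0..p K}"
    by (rule integrable_on_subinterval[OF Suc.prems(2)]) (use Suc.prems(1)[of K] in auto)
  then have "integral {p 0..p K} f = (\<Sum>i<K. integral {p i..p (Suc i)} f)" using Suc by auto
  moreover have "integral {p 0..p K} f + integral {p K..p (Suc K)} f = integral {p 0..p (Suc K)} f"
    by (rule Henstock_Kurzweil_Integration.integral_combine) (use mono Suc.prems in auto)
  ultimately show ?case by simp
qed simp

text \<open>A continuous \<open>w\<close> may have infinite variation, so Abel summation moves the
  increments onto \<open>h\<close>, which is monotone with density \<open>k\<close>. The error is
  the oscillation of \<open>w\<close> over one mesh times the integral of \<open>k\<close>.
  Integrability of \<open>k\<close> is the right generality because a truncated kernel has a density
  with a jump.\<close>

lemma riemann_stieltjes_limit: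
  fixes w h k :: "real \<Rightarrow> real"
  assumes T: "0 \<le> T" and w: "continuous_on {0..T} w"
    and k: "k integrable_on {0..T}" "\<And>s. 0 \<le> k s" and wk: "(\<lambda>s. w s * k s) integrable_on {0..T}"
    and h: "\<And>a b. 0 \<le> a \<Longrightarrow> a \<le> b \<Longrightarrow> b \<le> T \<Longrightarrow> h b - h a = integral {a..b} k"
  shows "(\<lambda>n. \<Sum>i<Suc n. h (real i * T / real (Suc n)) * (w (real (Suc i) * T / real (Suc n)) - w (real i * T / real (Suc n))))
     \<longlonglongrightarrow> h T * w T - h 0 * w 0 - integral {0..T} (\<lambda>s. w s * k s)"
proof -
  define p where "p n i = real i * T / real (Suc n)" for n i
  have p0: "p n 0 = 0" and pT: "p n (Suc n) = T" for n by (auto simp: p_def)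
  have pmono: "p n i \<le> p n j" if "i \<le> j" for n i j
    unfolding p_def using that T by (intro divide_right_mono mult_right_mono) auto
  have pin: "p n i \<in> {0..T}" if "i \<le> Suc n" for n i
    using pmono[of 0 i n] pmono[OF that, of n] by (simp add: p0 pT)
  have step: "p n (Suc i) - p n i = T / real (Suc n)" for n i
    by (simp add: p_def diff_divide_distrib[symmetric] left_diff_distrib[symmetric])
  define R where "R n = (\<Sum>i<Suc n. w (p n (Suc i)) * (h (p n (Suc i)) - h (p n i)))" for n
  have "R \<longlonglongrightarrow> integral {0..T} (\<lambda>s. w s * k s)"
  proof (rule LIMSEQ_I)
    fix e :: real assume e: "e > 0"
    \<comment> \<open>The added 1 keeps \<open>H\<close> positive and makes the final inequality
      strict.\<close>
    define H where "H = integral {0..T} k + 1"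
    have "0 \<le> integral {0..T} k" using k by (intro Henstock_Kurzweil_Integration.integral_nonneg) auto
    then have H: "H > 0" by (simp add: H_def)
    have "uniformly_continuous_on {0..T} w" by (rule compact_uniformly_continuous[OF w]) simp
    then obtain d where d: "d > 0"
      "\<And>s s'. s \<in> {0..T} \<Longrightarrow> s' \<in> {0..T} \<Longrightarrow> dist s' s < d \<Longrightarrow> dist (w s') (w s) < e / H"
      unfolding uniformly_continuous_on_def using divide_pos_pos[OF e H] by blast
    obtain n0 where n0: "T / d < real n0" using reals_Archimedean2 by blast
    have "\<bar>R n - integral {0..T} (\<lambda>s. w s * k s)\<bar> < e" if n: "n \<ge> n0" for n
    proof -
      have small: "T / real (Suc n) < d"
      proof -
        have "T / d < real (Suc n)" using n0 n by linarith
        then show ?thesis using d by (simp add: field_simps)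
      qed
      have sub: "{p n i..p n (Suc i)} \<subseteq> {0..T}" if "i < Suc n" for i
        using pin[of i n] pin[of "Suc i" n] that by auto
      have ki: "k integrable_on {p n i..p n (Suc i)}" "(\<lambda>s. w s * k s) integrable_on {p n i..p n (Suc i)}" if "i < Suc n" for i
        using integrable_on_subinterval[OF k(1) sub[OF that]] integrable_on_subinterval[OF wk sub[OF that]] by auto
      have hd: "h (p n (Suc i)) - h (p n i) = integral {p n i..p n (Suc i)} k" if "i < Suc n" for i
        using pin[of i n] pin[of "Suc i" n] that by (intro h pmono) auto
      have "integral {0..T} (\<lambda>s. w s * k s) = (\<Sum>i<Suc n. integral {p n i..p n (Suc i)} (\<lambda>s. w s * k s))"
        using integral_partition[of "Suc n" "p n" "\<lambda>s. w s * k s"] pmono wk by (simp add: p0 pT)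
      then have "\<bar>R n - integral {0..T} (\<lambda>s. w s * k s)\<bar>
          = \<bar>\<Sum>i<Suc n. w (p n (Suc i)) * integral {p n i..p n (Suc i)} k - integral {p n i..p n (Suc i)} (\<lambda>s. w s * k s)\<bar>"
        using hd by (simp add: R_def sum_subtractf)
      also have "\<dots> \<le> (\<Sum>i<Suc n. \<bar>w (p n (Suc i)) * integral {p n i..p n (Suc i)} k - integral {p n i..p n (Suc i)} (\<lambda>s. w s * k s)\<bar>)"
        by (rule sum_abs)
      also have "\<dots> \<le> (\<Sum>i<Suc n. e / H * integral {p n i..p n (Suc i)} k)"
      proof (rule sum_mono)
        fix i assume "i \<in> {..<Suc n}"
        then have i: "i < Suc n" by simp
        have "w (p n (Suc i)) * integral {p n i..p n (Suc i)} k - integral {p n i..p n (Suc i)} (\<lambda>s. w s * k s)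
            = integral {p n i..p n (Suc i)} (\<lambda>s. w (p n (Suc i)) * k s - w s * k s)"
          using Henstock_Kurzweil_Integration.integral_diff[OF integrable_on_cmult_left[OF ki(1)[OF i]] ki(2)[OF i], of "w (p n (Suc i))"]
          by simp
        also have "norm \<dots> \<le> integral {p n i..p n (Suc i)} (\<lambda>s. e / H * k s)"
        proof (rule integral_norm_bound_integral)
          show "(\<lambda>s. w (p n (Suc i)) * k s - w s * k s) integrable_on {p n i..p n (Suc i)}"
            using ki[OF i] by (intro integrable_diff integrable_on_mult_right) auto
          show "(\<lambda>s. e / H * k s) integrable_on {p n i..p n (Suc i)}"
            using ki[OF i] by (intro integrable_on_mult_right) auto
          fix s assume s: "s \<in> {p n i..p n (Suc i)}"
          have "dist (p n (Suc i)) s < d" using s step[of n i] small by (auto simp: dist_real_def)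
          then have "\<bar>w (p n (Suc i)) - w s\<bar> \<le> e / H"
            using d(2)[of s "p n (Suc i)"] s sub[OF i] pin[of "Suc i" n] i by (auto simp: dist_real_def less_imp_le)
          then have "\<bar>w (p n (Suc i)) - w s\<bar> * \<bar>k s\<bar> \<le> e / H * k s"
            using k(2)[of s] by (simp only: abs_of_nonneg mult_right_mono)
          then show "norm (w (p n (Suc i)) * k s - w s * k s) \<le> e / H * k s"
            by (simp only: left_diff_distrib[symmetric] real_norm_def abs_mult)
        qed
        finally show "\<bar>w (p n (Suc i)) * integral {p n i..p n (Suc i)} k - integral {p n i..p n (Suc i)} (\<lambda>s. w s * k s)\<bar>
            \<le> e / H * integral {p n i..p n (Suc i)} k" by simp
      qed
      also have "\<dots> = e / H * integral {0..T} k"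
      proof -
        have "integral {0..T} k = (\<Sum>i<Suc n. integral {p n i..p n (Suc i)} k)"
          using integral_partition[of "Suc n" "p n" k] pmono k by (simp add: p0 pT del: sum.lessThan_Suc)
        then show ?thesis by (simp only: sum_distrib_left)
      qed
      also have "\<dots> < e / H * H" using e H by (intro mult_strict_left_mono) (auto simp: H_def)
      finally show ?thesis using H by simp
    qed
    then show "\<exists>n0. \<forall>n\<ge>n0. norm (R n - integral {0..T} (\<lambda>s. w s * k s)) < e" by auto
  qed
  then have "(\<lambda>n. h T * w T - h 0 * w 0 - R n) \<longlonglongrightarrow> h T * w T - h 0 * w 0 - integral {0..T} (\<lambda>s. w s * k s)"
    by (intro tendsto_intros)
  moreover have "(\<Sum>i<Suc n. h (p n i) * (w (p n (Suc i)) - w (p n i))) = h T * w T - h 0 * w 0 - R n" for n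
    using abel_sum[of "\<lambda>i. h (p n i)" "\<lambda>i. w (p n i)" "Suc n"] by (simp only: R_def p0 pT)
  ultimately show ?thesis by (simp only: p_def)
qed

context brownian
begin

text \<open>The step functions converge uniformly to \<open>h\<close>, so by the isometry the
  Riemann sums are Cauchy in mean square. Fatou's lemma then upgrades the almost sure limit to a
  mean square limit, which identifies pathwise limits as Wiener integrals.\<close>

lemma has_wiener_integral_limit:
  assumes t: "0 \<le> t" and h: "continuous_on {0..t} h" and I: "I \<in> borel_measurable N"
    and lim: "AE \<omega> in N. (\<lambda>n. \<Sum>i<Suc n. h (real i * t / real (Suc n)) *
      (W (real (Suc i) * t / real (Suc n)) \<omega> - W (real i * t / real (Suc n)) \<omega>)) \<longlonglongrightarrow> I \<omega>"
  shows "has_wiener_integral N W 0 t h I"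
proof -
  define p where "p n i = real i * t / real (Suc n)" for n i
  define c where "c n i = h (p n i)" for n i
  define S where "S n = step_integral W (Suc n) (p n) (c n)" for n
  define g where "g n = step_fun (Suc n) (p n) (c n)" for n
  have part: "partition_points (Suc n) (p n)" for n
    using t by (auto simp: partition_points_def p_def intro!: divide_right_mono mult_right_mono)
  have Sm: "S n \<in> borel_measurable N" for n unfolding S_def by (rule step_integral_measurable[OF part])
  have gout: "g n s = 0" if "s \<notin> {0..t}" for n s
    unfolding g_def by (rule step_fun_outside[OF part _ _ that]) (auto simp: p_def)
  have unif: "\<forall>\<^sub>F n in sequentially. \<forall>s\<in>{0<..t}. \<bar>h s - g n s\<bar> \<le> e" if e: "e > 0" for e
  proof -
    have "uniformly_continuous_on {0..t} h" by (rule compact_uniformly_continuous[OF h]) simp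
    then obtain d where d: "d > 0"
      "\<And>s s'. s \<in> {0..t} \<Longrightarrow> s' \<in> {0..t} \<Longrightarrow> dist s' s < d \<Longrightarrow> dist (h s') (h s) < e"
      unfolding uniformly_continuous_on_def using e by blast
    obtain n0 where n0: "t / d < real n0" using reals_Archimedean2 by blast
    show ?thesis
      using eventually_ge_at_top[of n0]
    proof eventually_elim
      case (elim n)
      show ?case
      proof
        fix s assume s: "s \<in> {0<..t}"
        then have t: "0 < t" by auto
        obtain i where i: "i < Suc n" "s \<in> {p n i<..p n (Suc i)}" "g n s = h (p n i)"
          using step_fun_value[OF t s, of "Suc n"] unfolding g_def p_def c_def by (metis zero_less_Suc)
        have "p n (Suc i) - p n i = t / real (Suc n)"
          by (simp add: p_def diff_divide_distrib[symmetric] left_diff_distrib[symmetric])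
        moreover have "t / real (Suc n) < d"
        proof -
          have "t / d < real (Suc n)" using n0 elim by linarith
          then show ?thesis using d by (simp add: field_simps)
        qed
        ultimately have "dist (p n i) s < d" using i(2) by (auto simp: dist_real_def)
        moreover have "0 \<le> p n i" "p n i \<le> t" using i(2) s t by (auto simp: p_def)
        ultimately show "\<bar>h s - g n s\<bar> \<le> e"
          using d(2)[of s "p n i"] s i(3) by (auto simp: dist_real_def)
      qed
    qed
  qed
  have small: "\<exists>e>0. ennreal (e\<^sup>2) * ennreal t \<le> ennreal \<eta>" if \<eta>: "\<eta> > 0" for \<eta> :: real
  \<comment> \<open>Dividing by \<open>t + 1\<close> instead of \<open>t\<close> covers
    \<open>t = 0\<close>.\<close>
  proof (intro exI[of _ "sqrt (\<eta> / (t + 1))"] conjI)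
    show "ennreal ((sqrt (\<eta> / (t + 1)))\<^sup>2) * ennreal t \<le> ennreal \<eta>"
      using \<eta> t by (simp add: ennreal_mult[symmetric] ennreal_leI field_simps)
  qed (use \<eta> t in simp)
  \<comment> \<open>The left-open steps miss \<open>s = 0\<close>, where the step function is 0
    rather than near \<open>h 0\<close>.\<close>
  have AE0: "AE s in lborel. s \<noteq> (0::real)" by (rule AE_lborel_singleton)
  have bnd: "(\<integral>\<^sup>+s. ennreal ((f s)\<^sup>2) \<partial>lborel) \<le> ennreal (e\<^sup>2) * ennreal t"
    if f: "\<And>s. s \<in> {0<..t} \<Longrightarrow> \<bar>f s\<bar> \<le> e" "\<And>s. s \<notin> {0..t} \<Longrightarrow> f s = 0" and e: "e > 0" for f :: "real \<Rightarrow> real" and e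
  proof -
    have "(\<integral>\<^sup>+s. ennreal ((f s)\<^sup>2) \<partial>lborel) \<le> (\<integral>\<^sup>+s. ennreal (e\<^sup>2) * indicator {0..t} s \<partial>lborel)"
    proof (rule nn_integral_mono_AE)
      show "AE s in lborel. ennreal ((f s)\<^sup>2) \<le> ennreal (e\<^sup>2) * indicator {0..t} s"
        using AE0
      proof eventually_elim
        case (elim s)
        show ?case
        proof (cases "s \<in> {0..t}")
          case True
          then have "\<bar>f s\<bar>\<^sup>2 \<le> e\<^sup>2" using elim f(1)[of s] by (intro power_mono) auto
          then show ?thesis using True by (simp add: ennreal_leI)
        qed (simp add: f(2))
      qed
    qed
    also have "\<dots> = ennreal (e\<^sup>2) * ennreal t" using t by (simp add: nn_integral_cmult_indicator)
    finally show ?thesis .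
  qed
  show ?thesis
    unfolding has_wiener_integral_def
  proof (rule conjI[OF _ conjI[OF _ exI[of _ Suc, OF exI[of _ p, OF exI[of _ c]]]]]; (intro conjI allI)?)
    show "set_borel_measurable lborel {0..t} h"
      unfolding set_borel_measurable_def using borel_measurable_continuous_on_indicator[OF _ h] by simp
    show "I \<in> borel_measurable N" by (rule I)
    show "0 \<le> p n 0" "p n (Suc n) \<le> t" for n by (auto simp: p_def)
    show "i < Suc n \<longrightarrow> p n i \<le> p n (Suc i)" for n i using part by (simp add: partition_points_def)
    show "(\<lambda>n. \<integral>\<^sup>+ s\<in>{0..t}. ennreal ((h s - step_fun (Suc n) (p n) (c n) s)\<^sup>2) \<partial>lborel) \<longlonglongrightarrow> 0"
    proof (rule order_tendstoI)
      fix u :: ennreal assume "0 < u"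
      then obtain \<eta> where \<eta>: "\<eta> > 0" "ennreal \<eta> < u"
        using ennreal_pos_between by blast
      obtain e where e: "e > 0" "ennreal (e\<^sup>2) * ennreal t \<le> ennreal \<eta>" using small[OF \<eta>(1)] by blast
      show "\<forall>\<^sub>F n in sequentially. (\<integral>\<^sup>+ s\<in>{0..t}. ennreal ((h s - step_fun (Suc n) (p n) (c n) s)\<^sup>2) \<partial>lborel) < u"
        using unif[OF e(1)]
      proof eventually_elim
        case (elim n)
        have "(\<integral>\<^sup>+ s\<in>{0..t}. ennreal ((h s - step_fun (Suc n) (p n) (c n) s)\<^sup>2) \<partial>lborel)
            = (\<integral>\<^sup>+ s. ennreal ((if s \<in> {0..t} then h s - g n s else 0)\<^sup>2) \<partial>lborel)"
          by (intro nn_integral_cong) (auto simp: g_def)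
        also have "\<dots> \<le> ennreal (e\<^sup>2) * ennreal t" by (rule bnd) (use elim e in auto)
        finally show ?case using e \<eta> by order
      qed
    qed simp
    have SS: "(\<integral>\<^sup>+ \<omega>. ennreal ((I \<omega> - S n \<omega>)\<^sup>2) \<partial>N) \<le> ennreal ((2 * e)\<^sup>2) * ennreal t"
      if e: "e > 0" and n: "\<forall>s\<in>{0<..t}. \<bar>h s - g n s\<bar> \<le> e" for e n
    proof -
      have "(\<integral>\<^sup>+ \<omega>. ennreal ((I \<omega> - S n \<omega>)\<^sup>2) \<partial>N) = (\<integral>\<^sup>+ \<omega>. liminf (\<lambda>m. ennreal ((S m \<omega> - S n \<omega>)\<^sup>2)) \<partial>N)"
      proof (rule nn_integral_cong_AE)
        show "AE \<omega> in N. ennreal ((I \<omega> - S n \<omega>)\<^sup>2) = liminf (\<lambda>m. ennreal ((S m \<omega> - S n \<omega>)\<^sup>2))"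
          using lim
        proof eventually_elim
          case (elim \<omega>)
          then have "(\<lambda>m. S m \<omega>) \<longlonglongrightarrow> I \<omega>" by (simp only: S_def step_integral_def c_def p_def)
          then have "(\<lambda>m. ennreal ((S m \<omega> - S n \<omega>)\<^sup>2)) \<longlonglongrightarrow> ennreal ((I \<omega> - S n \<omega>)\<^sup>2)"
            by (intro tendsto_intros tendsto_ennrealI)
          then show ?case using lim_imp_Liminf[OF sequentially_bot] by metis
        qed
      qed
      also have "\<dots> \<le> liminf (\<lambda>m. \<integral>\<^sup>+ \<omega>. ennreal ((S m \<omega> - S n \<omega>)\<^sup>2) \<partial>N)"
        by (rule nn_integral_liminf) (use Sm in measurable)
      also have "\<dots> \<le> ennreal ((2 * e)\<^sup>2) * ennreal t"
      proof (rule Liminf_le)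
        show "\<forall>\<^sub>F m in sequentially. (\<integral>\<^sup>+ \<omega>. ennreal ((S m \<omega> - S n \<omega>)\<^sup>2) \<partial>N) \<le> ennreal ((2 * e)\<^sup>2) * ennreal t"
          using unif[OF e]
        proof eventually_elim
          case (elim m)
          have "(\<integral>\<^sup>+ \<omega>. ennreal ((S m \<omega> - S n \<omega>)\<^sup>2) \<partial>N) = (\<integral>\<^sup>+ s. ennreal ((g m s - g n s)\<^sup>2) \<partial>lborel)"
            unfolding S_def g_def by (rule step_isometry[OF part part])
          also have "\<dots> \<le> ennreal ((2 * e)\<^sup>2) * ennreal t"
          proof (rule bnd)
            fix s assume s: "s \<in> {0<..t}"
            have "\<bar>h s - g n s\<bar> \<le> e" "\<bar>h s - g m s\<bar> \<le> e" using n elim s by auto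
            then show "\<bar>g m s - g n s\<bar> \<le> 2 * e" by linarith
          qed (use gout e in auto)
          finally show ?case .
        qed
      qed simp
      finally show ?thesis .
    qed
    show "(\<lambda>n. \<integral>\<^sup>+ \<omega>. ennreal ((I \<omega> - step_integral W (Suc n) (p n) (c n) \<omega>)\<^sup>2) \<partial>N) \<longlonglongrightarrow> 0"
    proof (rule order_tendstoI)
      fix u :: ennreal assume "0 < u"
      then obtain \<eta> where \<eta>: "\<eta> > 0" "ennreal \<eta> < u"
        using ennreal_pos_between by blast
      obtain e where e: "e > 0" "ennreal (e\<^sup>2) * ennreal t \<le> ennreal \<eta>" using small[OF \<eta>(1)] by blast
      show "\<forall>\<^sub>F n in sequentially. (\<integral>\<^sup>+ \<omega>. ennreal ((I \<omega> - step_integral W (Suc n) (p n) (c n) \<omega>)\<^sup>2) \<partial>N) < u"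
        using unif[OF half_gt_zero[OF e(1)]]
      proof eventually_elim
        case (elim n)
        have "(\<integral>\<^sup>+ \<omega>. ennreal ((I \<omega> - S n \<omega>)\<^sup>2) \<partial>N) \<le> ennreal ((2 * (e / 2))\<^sup>2) * ennreal t"
          by (rule SS[OF half_gt_zero[OF e(1)] elim])
        also have "\<dots> \<le> ennreal \<eta>" using e by simp
        finally show ?case using \<eta> unfolding S_def by order
      qed
    qed simp
  qed
qed

end

section \<open>Pathwise construction of the limit\<close>

text \<open>The integral of \<open>\<beta> * exp (- (\<beta> * (t - s))) * w s\<close>. With
  \<open>exp (- (\<beta> * t))\<close> taken outside, \<open>t\<close> enters only through a
  prefactor and an upper limit, which makes differentiation direct.\<close>

definition exp_average :: "real \<Rightarrow> (real \<Rightarrow> real) \<Rightarrow> real \<Rightarrow> real" where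
  "exp_average \<beta> w t = \<beta> * exp (- (\<beta> * t)) * integral {0..t} (\<lambda>s. exp (\<beta> * s) * w s)"

text \<open>The grid is that of the unit interval for every \<open>t\<close>, with the kernel cut
  off at \<open>t\<close>, because this is what the block approximation becomes when block sums are
  replaced by Brownian increments.\<close>

definition kernel_step_sum :: "real \<Rightarrow> (real \<Rightarrow> real) \<Rightarrow> nat \<Rightarrow> real \<Rightarrow> real" where
  "kernel_step_sum \<beta> w n t = (\<Sum>i<Suc n. (1 - exp (- (\<beta> * max 0 (t - real i / real (Suc n))))) *
      (w (real (Suc i) / real (Suc n)) - w (real i / real (Suc n))))"

lemma integral_exp_kernel:
  fixes a b \<beta> t :: real
  assumes "a \<le> b"
  shows "((\<lambda>s. \<beta> * exp (- (\<beta> * (t - s)))) has_integral exp (- (\<beta> * (t - b))) - exp (- (\<beta> * (t - a)))) {a..b}"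
proof (rule fundamental_theorem_of_calculus[OF assms])
  show "((\<lambda>s. exp (- (\<beta> * (t - s)))) has_vector_derivative \<beta> * exp (- (\<beta> * (t - x)))) (at x within {a..b})" for x
    unfolding has_real_derivative_iff_has_vector_derivative[symmetric]
    by (auto intro!: derivative_eq_intros)
qed

section \<open>Exponential averages of a fixed continuous path\<close>

context
  fixes \<beta> :: real and w :: "real \<Rightarrow> real"
  assumes \<beta>: "\<beta> > 0" and w: "continuous_on {0..} w" and w0: "w 0 = 0"
begin

lemma w_cont: "continuous_on {0..t} w"
  by (rule continuous_on_subset[OF w]) auto

lemma exp_average_eq: "exp_average \<beta> w t = integral {0..t} (\<lambda>s. w s * (\<beta> * exp (- (\<beta> * (t - s)))))"
proof -
  have eq: "w s * (\<beta> * exp (- (\<beta> * (t - s)))) = \<beta> * exp (- (\<beta> * t)) * (exp (\<beta> * s) * w s)" for s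
  proof -
    have "exp (- (\<beta> * (t - s))) = exp (- (\<beta> * t)) * exp (\<beta> * s)" by (simp add: exp_add[symmetric] algebra_simps)
    then show ?thesis by simp
  qed
  show ?thesis unfolding eq exp_average_def by simp
qed

lemma exp_average_derivative:
  assumes "t \<in> {0..T}"
  shows "(exp_average \<beta> w has_real_derivative \<beta> * w t - \<beta> * exp_average \<beta> w t) (at t within {0..T})"
proof -
  have "continuous_on {0..T} (\<lambda>s. exp (\<beta> * s) * w s)" by (intro continuous_intros w_cont)
  from integral_has_real_derivative[OF this assms]
  have "((\<lambda>t. integral {0..t} (\<lambda>s. exp (\<beta> * s) * w s)) has_real_derivative exp (\<beta> * t) * w t) (at t within {0..T})" .
  then have "(exp_average \<beta> w has_real_derivative
      (\<beta> * (- \<beta> * exp (- (\<beta> * t)))) * integral {0..t} (\<lambda>s. exp (\<beta> * s) * w s)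
      + \<beta> * exp (- (\<beta> * t)) * (exp (\<beta> * t) * w t)) (at t within {0..T})"
    unfolding exp_average_def[abs_def] by (auto intro!: derivative_eq_intros)
  moreover have "\<beta> * exp (- (\<beta> * t)) * (exp (\<beta> * t) * w t) = \<beta> * w t"
  proof -
    have "exp (- (\<beta> * t)) * exp (\<beta> * t) = 1" by (simp flip: exp_add)
    then show ?thesis by (simp add: mult.assoc[symmetric])
  qed
  ultimately show ?thesis by (simp only: exp_average_def mult.assoc mult_minus_left mult_minus_right) simp
qed

lemma exp_average_continuous: "continuous_on {0..T} (exp_average \<beta> w)"
  using exp_average_derivative by (intro DERIV_continuous_on)

text \<open>The fundamental theorem of calculus for the equation
  \<open>z' = \<beta> w - \<beta> z\<close>. The integrand is the pathwise form of the inner Wiener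
  integral, so the double integral in the theorem needs no stochastic Fubini argument.\<close>

lemma exp_average_integral:
  assumes "0 \<le> t"
  shows "exp_average \<beta> w t = (LBINT s:{0..t}. \<beta> * w s - \<beta> * exp_average \<beta> w s)"
proof -
  have "((\<lambda>s. \<beta> * w s - \<beta> * exp_average \<beta> w s) has_integral exp_average \<beta> w t - exp_average \<beta> w 0) {0..t}"
    using exp_average_derivative assms
    by (intro fundamental_theorem_of_calculus) (auto simp: has_real_derivative_iff_has_vector_derivative[symmetric])
  moreover have "set_integrable lborel {0..t} (\<lambda>s. \<beta> * w s - \<beta> * exp_average \<beta> w s)"
    by (intro borel_integrable_atLeastAtMost' continuous_intros w_cont exp_average_continuous)
  ultimately show ?thesis
    by (simp add: set_borel_integral_eq_integral integral_unique) (simp add: exp_average_def)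
qed

lemma integral_kernel_limit:
  assumes t: "0 \<le> t"
  shows "(\<lambda>n. \<Sum>i<Suc n. (1 - exp (- (\<beta> * (t - real i * t / real (Suc n))))) *
      (w (real (Suc i) * t / real (Suc n)) - w (real i * t / real (Suc n)))) \<longlonglongrightarrow> exp_average \<beta> w t"
proof -
  \<comment> \<open>\<open>?h\<close> is minus the kernel, because the integrator must increase; it
    vanishes at \<open>t\<close>, and \<open>w 0 = 0\<close>, so no boundary term survives.\<close>
  let ?k = "\<lambda>s. \<beta> * exp (- (\<beta> * (t - s)))" and ?h = "\<lambda>s. exp (- (\<beta> * (t - s))) - 1"
  have "(\<lambda>n. \<Sum>i<Suc n. ?h (real i * t / real (Suc n)) *
      (w (real (Suc i) * t / real (Suc n)) - w (real i * t / real (Suc n))))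
      \<longlonglongrightarrow> ?h t * w t - ?h 0 * w 0 - integral {0..t} (\<lambda>s. w s * ?k s)"
  proof (rule riemann_stieltjes_limit)
    show "?h b - ?h a = integral {a..b} ?k" if "a \<le> b" for a b
      unfolding integral_unique[OF integral_exp_kernel[OF that]] by simp
  qed (use \<beta> t w_cont in \<open>auto intro!: integrable_continuous_real continuous_intros\<close>)
  then have "(\<lambda>n. - (\<Sum>i<Suc n. ?h (real i * t / real (Suc n)) *
      (w (real (Suc i) * t / real (Suc n)) - w (real i * t / real (Suc n)))))
      \<longlonglongrightarrow> - (?h t * w t - ?h 0 * w 0 - integral {0..t} (\<lambda>s. w s * ?k s))"
    by (rule tendsto_minus)
  moreover have eq: "(1 - x) * d = - ((x - 1) * d)" for x d :: real by (simp add: algebra_simps)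
  ultimately show ?thesis unfolding exp_average_eq eq sum_negf by (simp add: w0)
qed

text \<open>Here the kernel has the value \<open>\<beta>\<close> at \<open>t\<close>, so the
  boundary term \<open>\<beta> * w t\<close> of the summation by parts remains.\<close>

lemma derivative_kernel_limit:
  assumes t: "0 \<le> t"
  shows "(\<lambda>n. \<Sum>i<Suc n. (\<beta> * exp (- (\<beta> * (t - real i * t / real (Suc n))))) *
      (w (real (Suc i) * t / real (Suc n)) - w (real i * t / real (Suc n)))) \<longlonglongrightarrow> \<beta> * w t - \<beta> * exp_average \<beta> w t"
proof -
  let ?k = "\<lambda>s. \<beta> * (\<beta> * exp (- (\<beta> * (t - s))))" and ?h = "\<lambda>s. \<beta> * exp (- (\<beta> * (t - s)))"
  have k: "integral {a..b} ?k = \<beta> * (exp (- (\<beta> * (t - b))) - exp (- (\<beta> * (t - a))))" if "a \<le> b" for a b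
    using integral_unique[OF integral_exp_kernel[OF that, of \<beta> t]] by simp
  have "(\<lambda>n. \<Sum>i<Suc n. ?h (real i * t / real (Suc n)) *
      (w (real (Suc i) * t / real (Suc n)) - w (real i * t / real (Suc n))))
      \<longlonglongrightarrow> ?h t * w t - ?h 0 * w 0 - integral {0..t} (\<lambda>s. w s * ?k s)"
  proof (rule riemann_stieltjes_limit)
    show "?h b - ?h a = integral {a..b} ?k" if "a \<le> b" for a b
      unfolding k[OF that] by (simp add: right_diff_distrib)
  qed (use \<beta> t w_cont in \<open>auto intro!: integrable_continuous_real continuous_intros\<close>)
  moreover have "integral {0..t} (\<lambda>s. w s * ?k s) = \<beta> * exp_average \<beta> w t"
    unfolding exp_average_eq using integral_mult_right[of "{0..t}" \<beta> "\<lambda>s. w s * (\<beta> * exp (- (\<beta> * (t - s))))"]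
    by (simp add: mult_ac)
  ultimately show ?thesis by (simp add: w0)
qed

text \<open>The grid need not contain \<open>t\<close>, but the truncated kernel still has an
  integrable density, which drops to 0 beyond \<open>t\<close>; the Riemann-Stieltjes limit
  therefore applies on the whole unit interval.\<close>

lemma step_kernel_limit:
  assumes t: "t \<in> {0..1}"
  shows "(\<lambda>n. kernel_step_sum \<beta> w n t) \<longlonglongrightarrow> exp_average \<beta> w t"
proof -
  let ?e = "\<lambda>s. \<beta> * exp (- (\<beta> * (t - s)))"
  let ?k = "\<lambda>s. if s \<in> {0..t} then ?e s else 0" and ?h = "\<lambda>s. exp (- (\<beta> * max 0 (t - s))) - 1"
  have sub: "{0..t} \<inter> {0..1} = {0..t}" using t by auto
  have wk: "(\<lambda>s. w s * ?k s) = (\<lambda>s. if s \<in> {0..t} then w s * ?e s else 0)" by auto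
  have "(\<lambda>n. \<Sum>i<Suc n. ?h (real i * 1 / real (Suc n)) *
      (w (real (Suc i) * 1 / real (Suc n)) - w (real i * 1 / real (Suc n))))
      \<longlonglongrightarrow> ?h 1 * w 1 - ?h 0 * w 0 - integral {0..1} (\<lambda>s. w s * ?k s)"
  proof (rule riemann_stieltjes_limit)
    show "?k integrable_on {0..1}"
    proof (rule Henstock_Kurzweil_Integration.integrable_restrict_Int[THEN iffD2])
      show "?e integrable_on ({0..t} \<inter> {0..1})"
        unfolding sub by (intro integrable_continuous_real continuous_intros)
    qed
    show "(\<lambda>s. w s * ?k s) integrable_on {0..1}"
    proof -
      have "(\<lambda>s. w s * ?e s) integrable_on ({0..t} \<inter> {0..1})"
        unfolding sub by (intro integrable_continuous_real continuous_intros w_cont)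
      then have "(\<lambda>s. if s \<in> {0..t} then w s * ?e s else 0) integrable_on {0..1}"
        by (rule Henstock_Kurzweil_Integration.integrable_restrict_Int[THEN iffD2])
      then show ?thesis by (simp only: wk)
    qed
    fix a b :: real assume ab: "0 \<le> a" "a \<le> b" "b \<le> 1"
    have I: "integral {a..b} ?k = integral ({0..t} \<inter> {a..b}) ?e"
      by (rule Henstock_Kurzweil_Integration.integral_restrict_Int)
    show "?h b - ?h a = integral {a..b} ?k"
    proof (cases "a \<le> t")
      case True
      then have "{0..t} \<inter> {a..b} = {a..min b t}" using ab by auto
      then have "integral {a..b} ?k = exp (- (\<beta> * (t - min b t))) - exp (- (\<beta> * (t - a)))"
        unfolding I using integral_unique[OF integral_exp_kernel[of a "min b t" \<beta> t]] True ab by simp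
      then show ?thesis using True by (simp add: min_def max_def)
    next
      case False
      then have "{0..t} \<inter> {a..b} = {}" by auto
      then show ?thesis unfolding I using False ab by simp
    qed
  qed (use \<beta> w_cont in auto)
  then have "(\<lambda>n. - (\<Sum>i<Suc n. ?h (real i / real (Suc n)) *
      (w (real (Suc i) / real (Suc n)) - w (real i / real (Suc n)))))
      \<longlonglongrightarrow> - (?h 1 * w 1 - ?h 0 * w 0 - integral {0..1} (\<lambda>s. w s * ?k s))"
    unfolding mult_1_right by (rule tendsto_minus)
  moreover have "integral {0..1} (\<lambda>s. w s * ?k s) = exp_average \<beta> w t"
  proof -
    have "integral {0..1} (\<lambda>s. if s \<in> {0..t} then w s * ?e s else 0) = exp_average \<beta> w t"
      unfolding Henstock_Kurzweil_Integration.integral_restrict_Int sub exp_average_eq ..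
    then show ?thesis by (simp only: wk)
  qed
  moreover have eq: "(1 - x) * d = - ((x - 1) * d)" for x d :: real by (simp add: algebra_simps)
  ultimately show ?thesis using t unfolding kernel_step_sum_def eq sum_negf by (simp add: w0)
qed

end

context brownian
begin

text \<open>A continuous version must be continuous at every point of the space, while Brownian
  paths are so only almost surely. Setting the paths to 0 on a null set that contains the bad points
  repairs this for all times at once.\<close>

lemma regular_version:
  obtains w where "\<And>t. 0 \<le> t \<Longrightarrow> w t \<in> borel_measurable N"
    "\<And>\<omega>. \<omega> \<in> space N \<Longrightarrow> continuous_on {0..} (\<lambda>t. w t \<omega>)" "\<And>\<omega>. w 0 \<omega> = 0"
    "AE \<omega> in N. \<forall>t. w t \<omega> = W t \<omega>"
proof -
  have "AE \<omega> in N. W 0 \<omega> = 0 \<and> continuous_on {0..} (\<lambda>t. W t \<omega>)"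
    using bm by (simp add: std_brownian_motion_def)
  then obtain B where B: "B \<in> null_sets N" "{\<omega> \<in> space N. \<not> (W 0 \<omega> = 0 \<and> continuous_on {0..} (\<lambda>t. W t \<omega>))} \<subseteq> B"
    by (auto simp: eventually_ae_filter)
  define w where "w t \<omega> = (if \<omega> \<in> space N - B then W t \<omega> else 0)" for t \<omega>
  have Bs: "space N - B \<in> sets N" using B(1) by auto
  show ?thesis
  proof (rule that)
    show "w t \<in> borel_measurable N" if "0 \<le> t" for t
      unfolding w_def[abs_def] using W_measurable[OF that] Bs by (intro measurable_If_set) (auto simp: Int_absorb2)
    show "continuous_on {0..} (\<lambda>t. w t \<omega>)" if "\<omega> \<in> space N" for \<omega>
      using B(2) that by (cases "\<omega> \<in> B") (auto simp: w_def)
    show "w 0 \<omega> = 0" for \<omega> using B(2) by (auto simp: w_def)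
    show "AE \<omega> in N. \<forall>t. w t \<omega> = W t \<omega>"
      using AE_not_in[OF B(1)] AE_space by eventually_elim (simp add: w_def)
  qed
qed

lemma explicit_wiener_processes:
  assumes \<beta>: "\<beta> > 0"
  obtains Z X where
    "continuous_wiener_process N W (\<lambda>t s. 1 - exp (- \<beta> * (t - s))) Z"
    "continuous_wiener_process N W (\<lambda>s u. \<beta> * exp (- \<beta> * (s - u))) X"
    "\<And>\<omega> t. \<omega> \<in> space N \<Longrightarrow> t \<in> {0..1} \<Longrightarrow> Z t \<omega> = (LBINT s:{0..t}. X s \<omega>)"
    "AE \<omega> in N. \<forall>t\<in>{0..1}. (\<lambda>n. kernel_step_sum \<beta> (\<lambda>s. W s \<omega>) n t) \<longlonglongrightarrow> Z t \<omega>"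
proof -
  obtain w where wm: "\<And>t. 0 \<le> t \<Longrightarrow> w t \<in> borel_measurable N"
    and wc: "\<And>\<omega>. \<omega> \<in> space N \<Longrightarrow> continuous_on {0..} (\<lambda>t. w t \<omega>)" and w0: "\<And>\<omega>. w 0 \<omega> = 0"
    and wW: "AE \<omega> in N. \<forall>t. w t \<omega> = W t \<omega>"
    using regular_version by blast
  define Z where "Z t \<omega> = exp_average \<beta> (\<lambda>s. w s \<omega>) t" for t \<omega>
  \<comment> \<open>Chosen as the time derivative of \<open>Z\<close>, read off the differential
    equation of the exponential average.\<close>
  define X where "X t \<omega> = \<beta> * w t \<omega> - \<beta> * Z t \<omega>" for t \<omega>
  have sums_meas: "(\<lambda>\<omega>. \<Sum>i<Suc n. c i * (w (real (Suc i) * t / real (Suc n)) \<omega> - w (real i * t / real (Suc n)) \<omega>)) \<in> borel_measurable N"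
    if "0 \<le> t" for c t n
    using that by (intro borel_measurable_sum borel_measurable_times borel_measurable_diff borel_measurable_const wm) auto
  \<comment> \<open>The pathwise integral is measurable as a pointwise limit of Riemann
    sums.\<close>
  have Zm: "Z t \<in> borel_measurable N" if "0 \<le> t" for t
    by (rule borel_measurable_LIMSEQ_real[OF _ sums_meas[OF that]])
       (unfold Z_def, rule integral_kernel_limit[OF \<beta> wc w0 that])
  have Xm: "X t \<in> borel_measurable N" if "0 \<le> t" for t
    unfolding X_def[abs_def] using wm[OF that] Zm[OF that] by measurable
  show ?thesis
  proof (rule that)
    show "continuous_wiener_process N W (\<lambda>t s. 1 - exp (- \<beta> * (t - s))) Z"
      unfolding continuous_wiener_process_def
    proof (intro conjI ballI)
      show "continuous_on {0..1} (\<lambda>t. Z t \<omega>)" if "\<omega> \<in> space N" for \<omega>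
        unfolding Z_def using exp_average_continuous[OF \<beta> wc[OF that] w0] by (simp add: eta_contract_eq)
      fix t :: real assume t: "t \<in> {0..1}"
      show "has_wiener_integral N W 0 t (\<lambda>s. 1 - exp (- \<beta> * (t - s))) (Z t)"
      proof (rule has_wiener_integral_limit)
        show "AE \<omega> in N. (\<lambda>n. \<Sum>i<Suc n. (1 - exp (- \<beta> * (t - real i * t / real (Suc n)))) *
            (W (real (Suc i) * t / real (Suc n)) \<omega> - W (real i * t / real (Suc n)) \<omega>)) \<longlonglongrightarrow> Z t \<omega>"
          using wW AE_space
        proof eventually_elim
          case (elim \<omega>)
          from integral_kernel_limit[OF \<beta> wc[OF elim(2)] w0, of t] t show ?case
            unfolding Z_def using elim(1) by simp
        qed
      qed (use t Zm in \<open>auto intro!: continuous_intros\<close>)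
    qed
    show "continuous_wiener_process N W (\<lambda>s u. \<beta> * exp (- \<beta> * (s - u))) X"
      unfolding continuous_wiener_process_def
    proof (intro conjI ballI)
      show "continuous_on {0..1} (\<lambda>t. X t \<omega>)" if "\<omega> \<in> space N" for \<omega>
        unfolding X_def Z_def
        by (intro continuous_intros w_cont[OF \<beta> wc[OF that] w0] exp_average_continuous[OF \<beta> wc[OF that] w0])
      fix t :: real assume t: "t \<in> {0..1}"
      show "has_wiener_integral N W 0 t (\<lambda>s. \<beta> * exp (- \<beta> * (t - s))) (X t)"
      proof (rule has_wiener_integral_limit)
        show "AE \<omega> in N. (\<lambda>n. \<Sum>i<Suc n. (\<beta> * exp (- \<beta> * (t - real i * t / real (Suc n)))) *
            (W (real (Suc i) * t / real (Suc n)) \<omega> - W (real i * t / real (Suc n)) \<omega>)) \<longlonglongrightarrow> X t \<omega>"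
          using wW AE_space
        proof eventually_elim
          case (elim \<omega>)
          from derivative_kernel_limit[OF \<beta> wc[OF elim(2)] w0, of t] t show ?case
            unfolding X_def Z_def using elim(1) by simp
        qed
      qed (use t Xm in \<open>auto intro!: continuous_intros\<close>)
    qed
    show "Z t \<omega> = (LBINT s:{0..t}. X s \<omega>)" if "\<omega> \<in> space N" "t \<in> {0..1}" for \<omega> t
      unfolding X_def Z_def using exp_average_integral[OF \<beta> wc[OF that(1)] w0, of t] that(2) by simp
    show "AE \<omega> in N. \<forall>t\<in>{0..1}. (\<lambda>n. kernel_step_sum \<beta> (\<lambda>s. W s \<omega>) n t) \<longlonglongrightarrow> Z t \<omega>"
      using wW AE_space
    proof eventually_elim
      case (elim \<omega>)
      then show ?case
        unfolding Z_def using step_kernel_limit[OF \<beta> wc[OF elim(2)] w0] by simp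
    qed
  qed
qed

end

section \<open>Joint convergence of the block sums\<close>

text \<open>The one-dimensional Skorohod representation is copied on each factor of a product space,
  where all coordinates converge pointwise; bounded convergence then gives the limit.\<close>

lemma product_weak_conv:
  fixes \<mu> :: "nat \<Rightarrow> real measure" and \<nu> :: "real measure" and G :: "(nat \<Rightarrow> real) \<Rightarrow> real"
  assumes \<mu>: "\<And>n. real_distribution (\<mu> n)" and \<nu>: "real_distribution \<nu>"
    and conv: "weak_conv_m \<mu> \<nu>" and I: "finite I"
    and G: "G \<in> borel_measurable (PiM I (\<lambda>_. borel))" "\<And>x. \<bar>G x\<bar> \<le> b"
    and cont: "\<And>x y. (\<And>i. i \<in> I \<Longrightarrow> (\<lambda>n. x n i) \<longlonglongrightarrow> y i) \<Longrightarrow> (\<lambda>n. G (x n)) \<longlonglongrightarrow> G y"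
  shows "(\<lambda>n. integral\<^sup>L (PiM I (\<lambda>_. \<mu> n)) G) \<longlonglongrightarrow> integral\<^sup>L (PiM I (\<lambda>_. \<nu>)) G"
proof -
  obtain \<Omega> :: "real measure" and X Y where \<Omega>: "prob_space \<Omega>"
    and X: "\<And>n. X n \<in> measurable \<Omega> borel" "\<And>n. distr \<Omega> borel (X n) = \<mu> n"
    and Y: "Y \<in> measurable \<Omega> lborel" "distr \<Omega> borel Y = \<nu>"
    and lim: "\<And>x. x \<in> space \<Omega> \<Longrightarrow> (\<lambda>n. X n x) \<longlonglongrightarrow> Y x"
    using Skorohod[OF \<mu> \<nu> conv] by blast
  interpret P: prob_space "PiM I (\<lambda>_. \<Omega>)" by (intro prob_space_PiM \<Omega>)
  have eq: "integral\<^sup>L (PiM I (\<lambda>_. \<rho>)) G = (\<integral>\<omega>. G (compose I f \<omega>) \<partial>PiM I (\<lambda>_. \<Omega>))"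
    and meas: "(\<lambda>\<omega>. G (compose I f \<omega>)) \<in> borel_measurable (PiM I (\<lambda>_. \<Omega>))"
    if \<rho>: "real_distribution \<rho>" and f: "f \<in> borel_measurable \<Omega>" "distr \<Omega> borel f = \<rho>" for \<rho> f
  proof -
    interpret r: real_distribution \<rho> by (rule \<rho>)
    have f': "f \<in> measurable \<Omega> \<rho>" using f(1) by (simp cong: measurable_cong_sets)
    have "distr \<Omega> \<rho> f = \<rho>" using f(2) by (subst distr_cong[OF refl r.events_eq_borel refl]) auto
    then have "PiM I (\<lambda>_. \<rho>) = distr (PiM I (\<lambda>_. \<Omega>)) (PiM I (\<lambda>_. \<rho>)) (compose I f)"
      by (subst distr_PiM_finite_prob_space'[OF I]) (auto intro: \<Omega> r.prob_space_axioms f')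
    moreover have Gm: "G \<in> borel_measurable (PiM I (\<lambda>_. \<rho>))"
    proof -
      have "sets (PiM I (\<lambda>_. \<rho>)) = sets (PiM I (\<lambda>_. borel))" by (intro sets_PiM_cong) auto
      then show ?thesis using G(1) by (simp cong: measurable_cong_sets)
    qed
    moreover have cm: "compose I f \<in> measurable (PiM I (\<lambda>_. \<Omega>)) (PiM I (\<lambda>_. \<rho>))"
      unfolding compose_def using f' by measurable
    ultimately show "integral\<^sup>L (PiM I (\<lambda>_. \<rho>)) G = (\<integral>\<omega>. G (compose I f \<omega>) \<partial>PiM I (\<lambda>_. \<Omega>))"
      by (metis integral_distr)
    show "(\<lambda>\<omega>. G (compose I f \<omega>)) \<in> borel_measurable (PiM I (\<lambda>_. \<Omega>))"
      by (rule measurable_compose[OF cm Gm])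
  qed
  have Y': "Y \<in> borel_measurable \<Omega>" using Y(1) by simp
  show ?thesis
    unfolding eq[OF \<mu> X] eq[OF \<nu> Y' Y(2)]
  proof (rule integral_dominated_convergence[where w="\<lambda>_. b"])
    show "AE \<omega> in PiM I (\<lambda>_. \<Omega>). (\<lambda>n. G (compose I (X n) \<omega>)) \<longlonglongrightarrow> G (compose I Y \<omega>)"
    proof (rule AE_I2)
      fix \<omega> assume \<omega>: "\<omega> \<in> space (PiM I (\<lambda>_. \<Omega>))"
      show "(\<lambda>n. G (compose I (X n) \<omega>)) \<longlonglongrightarrow> G (compose I Y \<omega>)"
        using \<omega> lim by (intro cont) (auto simp: compose_def space_PiM PiE_iff)
    qed
  qed (use meas[OF \<mu> X] meas[OF \<nu> Y' Y(2)] G(2) in auto)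
qed

context white_noise
begin

lemma block_measurable [measurable]: "block N i \<in> borel_measurable M"
  unfolding block_def[abs_def] by measurable

text \<open>The characteristic function of a sum of the noise depends only on the number of terms,
  and it determines the law.\<close>

lemma block_distr:
  assumes ident: "\<And>k. distr M borel (\<epsilon> k) = distr M borel (\<epsilon> 0)"
  shows "distr M borel (block N i) = distr M borel (\<lambda>\<omega>. (\<Sum>j<N. \<epsilon> j \<omega>) / sqrt (real N))"
proof -
  have ch: "char (distr M borel (\<lambda>\<omega>. \<Sum>j\<in>A. \<epsilon> j \<omega>)) t = char (distr M borel (\<epsilon> 0)) t ^ card A" for A t
  proof -
    have "char (distr M borel (\<lambda>\<omega>. \<Sum>j\<in>A. \<epsilon> j \<omega>)) t = (\<Prod>j\<in>A. char (distr M borel (\<epsilon> j)) t)"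
      by (rule char_distr_sum[OF indep_vars_subset[OF indep]]) simp
    also have "\<dots> = (\<Prod>j\<in>A. char (distr M borel (\<epsilon> 0)) t)"
      by (intro prod.cong refl) (subst ident, rule refl)
    finally show ?thesis by simp
  qed
  have rd: "real_distribution (distr M borel (\<lambda>\<omega>. \<Sum>j\<in>A. \<epsilon> j \<omega>))" for A
    by (rule real_distribution_distr) measurable
  have "distr M borel (\<lambda>\<omega>. \<Sum>j\<in>{i * N..<i * N + N}. \<epsilon> j \<omega>) = distr M borel (\<lambda>\<omega>. \<Sum>j<N. \<epsilon> j \<omega>)"
    by (rule Levy_uniqueness[OF rd rd]) (simp add: fun_eq_iff ch)
  then have "distr (distr M borel (\<lambda>\<omega>. \<Sum>j\<in>{i * N..<i * N + N}. \<epsilon> j \<omega>)) borel (\<lambda>x. x / sqrt (real N))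
      = distr (distr M borel (\<lambda>\<omega>. \<Sum>j<N. \<epsilon> j \<omega>)) borel (\<lambda>x. x / sqrt (real N))" by simp
  then show ?thesis by (simp add: distr_distr o_def block_def[abs_def])
qed

lemma block_clt:
  assumes ident: "\<And>k. distr M borel (\<epsilon> k) = distr M borel (\<epsilon> 0)"
  shows "weak_conv_m (\<lambda>N. distr M borel (block N 0)) std_normal_distribution"
proof -
  have "weak_conv_m (\<lambda>n. distr M borel (\<lambda>x. (\<Sum>i<n. \<epsilon> i x) / sqrt (real n * 1\<^sup>2))) std_normal_distribution"
    by (rule central_limit_theorem_zero_mean[OF indep centered _ integrable(2) _ ident])
       (simp_all add: centered unit_variance)
  then show ?thesis unfolding block_distr[OF ident] by simp
qed

lemma block_indep: "indep_vars (\<lambda>_. borel) (block N) {..<K}"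
proof -
  define A where "A i = {i * N..<i * N + N}" for i
  have disj: "disjoint_family_on A {..<K}"
    unfolding disjoint_family_on_def
  proof (intro ballI impI)
    fix i i' :: nat assume "i \<noteq> i'"
    have "j div N = i" if "j \<in> A i" for i j
      using that by (intro div_nat_eqI) (auto simp: A_def mult.commute)
    with \<open>i \<noteq> i'\<close> show "A i \<inter> A i' = {}" by blast
  qed
  have "indep_vars (\<lambda>i. PiM (A i) (\<lambda>_. borel)) (\<lambda>i \<omega>. restrict (\<lambda>j. \<epsilon> j \<omega>) (A i)) {..<K}"
    by (rule indep_vars_restrict[OF indep _ disj]) simp
  then have "indep_vars (\<lambda>_. borel) (\<lambda>i \<omega>. (\<Sum>j\<in>A i. restrict (\<lambda>j. \<epsilon> j \<omega>) (A i) j) / sqrt (real N)) {..<K}"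
    by (rule indep_vars_compose2) measurable
  then show ?thesis
    by (rule indep_vars_cong[THEN iffD1, rotated -1]) (auto simp: block_def[abs_def] A_def fun_eq_iff)
qed

text \<open>Independence makes the joint law of the blocks a power of one law, and likewise for the
  increments of \<open>W\<close>. The limit is written with the increments of the given
  \<open>W\<close> so that it can be evaluated pathwise afterwards.\<close>

lemma joint_block_limit:
  fixes N :: "'b measure" and G :: "(nat \<Rightarrow> real) \<Rightarrow> real"
  assumes ident: "\<And>k. distr M borel (\<epsilon> k) = distr M borel (\<epsilon> 0)"
    and W: "std_brownian_motion N W" and K: "K \<ge> 1"
    and G: "G \<in> borel_measurable (PiM {..<K} (\<lambda>_. borel))" "\<And>x. \<bar>G x\<bar> \<le> b"
    and cont: "\<And>x y. (\<And>i. i \<in> {..<K} \<Longrightarrow> (\<lambda>n. x n i) \<longlonglongrightarrow> y i) \<Longrightarrow> (\<lambda>n. G (x n)) \<longlonglongrightarrow> G y"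
  shows "(\<lambda>n. expectation (\<lambda>\<omega>. G (\<lambda>i. block (n div K) i \<omega>)))
    \<longlonglongrightarrow> (\<integral>\<omega>. G (\<lambda>i. sqrt (real K) * (W (real (Suc i) / real K) \<omega> - W (real i / real K) \<omega>)) \<partial>N)"
proof -
  \<comment> \<open>Applying \<open>cont\<close> to a constant sequence shows that \<open>G\<close>
    reads only the coordinates below \<open>K\<close>; points of the product space are restricted to
    these.\<close>
  have Gr: "G (restrict x {..<K}) = G x" for x
  proof -
    have "(\<lambda>_::nat. G (restrict x {..<K})) \<longlonglongrightarrow> G x" by (rule cont) simp
    then show ?thesis by (simp add: LIMSEQ_const_iff)
  qed
  have joint: "(\<integral>\<omega>. G (\<lambda>i. X i \<omega>) \<partial>Q) = integral\<^sup>L (PiM {..<K} (\<lambda>_. \<rho>)) G"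
    if Q: "prob_space Q" and X: "prob_space.indep_vars Q (\<lambda>_. borel) X {..<K}"
      and \<rho>: "\<And>i. i < K \<Longrightarrow> distr Q borel (X i) = \<rho>"
    for Q :: "'c measure" and X :: "nat \<Rightarrow> 'c \<Rightarrow> real" and \<rho>
  proof -
    interpret Q: prob_space Q by (rule Q)
    have Xm: "X i \<in> borel_measurable Q" if "i \<in> {..<K}" for i
      using X that unfolding Q.indep_vars_def by simp
    have "distr Q (PiM {..<K} (\<lambda>_. borel)) (\<lambda>\<omega>. \<lambda>i\<in>{..<K}. X i \<omega>) = PiM {..<K} (\<lambda>i. distr Q borel (X i))"
      using X K by (subst (asm) Q.indep_vars_iff_distr_eq_PiM') (auto intro: Xm simp: lessThan_empty_iff)
    also have "\<dots> = PiM {..<K} (\<lambda>_. \<rho>)" by (intro PiM_cong) (auto simp: \<rho>)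
    finally have "integral\<^sup>L (PiM {..<K} (\<lambda>_. \<rho>)) G
        = integral\<^sup>L (distr Q (PiM {..<K} (\<lambda>_. borel)) (\<lambda>\<omega>. \<lambda>i\<in>{..<K}. X i \<omega>)) G" by simp
    also have "\<dots> = (\<integral>\<omega>. G (\<lambda>i\<in>{..<K}. X i \<omega>) \<partial>Q)"
      by (rule integral_distr[OF measurable_restrict[OF Xm] G(1)])
    finally show ?thesis by (simp add: Gr)
  qed
  interpret N: brownian N W
    using W by (simp add: brownian_def brownian_axioms_def std_brownian_motion_def)
  have "(\<lambda>n. integral\<^sup>L (PiM {..<K} (\<lambda>_. distr M borel (block n 0))) G)
      \<longlonglongrightarrow> integral\<^sup>L (PiM {..<K} (\<lambda>_. std_normal_distribution)) G"
    by (rule product_weak_conv[OF _ real_dist_normal_dist block_clt[OF ident] _ G cont])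
       (auto intro!: real_distribution_distr)
  moreover have "integral\<^sup>L (PiM {..<K} (\<lambda>_. distr M borel (block n 0))) G = expectation (\<lambda>\<omega>. G (\<lambda>i. block n i \<omega>))" for n
    by (rule joint[symmetric, OF prob_space_axioms block_indep]) (simp add: block_distr[OF ident])
  moreover have "integral\<^sup>L (PiM {..<K} (\<lambda>_. std_normal_distribution)) G
      = (\<integral>\<omega>. G (\<lambda>i. sqrt (real K) * (W (real (Suc i) / real K) \<omega> - W (real i / real K) \<omega>)) \<partial>N)"
  proof (rule joint[symmetric, OF N.prob_space_axioms])
    have "N.indep_vars (\<lambda>_. borel) (\<lambda>i \<omega>. W (real (Suc i) / real K) \<omega> - W (real i / real K) \<omega>) {..<K}"
      by (rule N.incr_indep) (use K in \<open>auto simp: divide_strict_right_mono\<close>)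
    then show "N.indep_vars (\<lambda>_. borel) (\<lambda>i \<omega>. sqrt (real K) * (W (real (Suc i) / real K) \<omega> - W (real i / real K) \<omega>)) {..<K}"
      by (rule N.indep_vars_compose2) measurable
    fix i assume "i < K"
    let ?D = "\<lambda>\<omega>. W (real (Suc i) / real K) \<omega> - W (real i / real K) \<omega>"
    have diff: "real (Suc i) / real K - real i / real K = 1 / real K" by (simp add: diff_divide_distrib[symmetric])
    have "0 \<le> real i / real K" "real i / real K < real (Suc i) / real K" using K by (auto simp: divide_strict_right_mono)
    then have "distributed N lborel ?D (normal_density 0 (sqrt (1 / real K)))"
      using N.incr_distributed[of "real i / real K" "real (Suc i) / real K"] unfolding diff by blast
    then have "distributed N lborel (\<lambda>\<omega>. (?D \<omega> - 0) / sqrt (1 / real K)) std_normal_density"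
      using K by (subst (asm) N.normal_standard_normal_convert) auto
    then have "distributed N lborel (\<lambda>\<omega>. sqrt (real K) * ?D \<omega>) std_normal_density"
      using K by (simp add: real_sqrt_divide mult.commute)
    then have "distr N lborel (\<lambda>\<omega>. sqrt (real K) * ?D \<omega>) = std_normal_distribution"
      by (rule distributed_distr_eq_density)
    then show "distr N borel (\<lambda>\<omega>. sqrt (real K) * ?D \<omega>) = std_normal_distribution"
      by (subst distr_cong[OF refl sets_lborel[symmetric] refl]) auto
  qed
  ultimately have "(\<lambda>n. expectation (\<lambda>\<omega>. G (\<lambda>i. block n i \<omega>)))
      \<longlonglongrightarrow> (\<integral>\<omega>. G (\<lambda>i. sqrt (real K) * (W (real (Suc i) / real K) \<omega> - W (real i / real K) \<omega>)) \<partial>N)" by simp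
  moreover have "filterlim (\<lambda>n. n div K) at_top sequentially"
    unfolding filterlim_at_top
  proof (intro allI)
    fix Z show "\<forall>\<^sub>F n in sequentially. Z \<le> n div K"
      using eventually_ge_at_top[of "Z * K"] by eventually_elim (use K in \<open>simp add: less_eq_div_iff_mult_less_eq\<close>)
  qed
  ultimately show ?thesis by (rule filterlim_compose)
qed

end

section \<open>Convergence in law\<close>

lemma bounded_lipschitz_tendsto:
  assumes F: "bounded_lipschitz F L b" and x: "x \<in> mspace C01" "\<And>n. y n \<in> mspace C01"
    and lim: "(\<lambda>n. mdist C01 x (y n)) \<longlonglongrightarrow> 0"
  shows "(\<lambda>n. F (y n)) \<longlonglongrightarrow> F x"
proof -
  have "(\<lambda>n. L * mdist C01 x (y n)) \<longlonglongrightarrow> L * 0" by (intro tendsto_intros lim)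
  then have lim': "(\<lambda>n. L * mdist C01 x (y n)) \<longlonglongrightarrow> 0" by simp
  have "\<bar>F (y n) - F x\<bar> \<le> L * mdist C01 x (y n)" for n
    using F x unfolding bounded_lipschitz_def by (metis mdist_commute)
  then have "(\<lambda>n. F (y n) - F x) \<longlonglongrightarrow> 0"
    by (intro Lim_null_comparison[OF _ lim']) (simp add: always_eventually)
  then show ?thesis by (simp add: LIM_zero_iff)
qed

lemma bounded_lipschitz_bernstein_tendsto:
  assumes F: "bounded_lipschitz F L b" and lim: "\<And>i. i \<le> k \<Longrightarrow> (\<lambda>n. x n i) \<longlonglongrightarrow> y i"
  shows "(\<lambda>n. F (bernstein_path k (x n))) \<longlonglongrightarrow> F (bernstein_path k y)"
proof (rule bounded_lipschitz_tendsto[OF F])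
  have "(\<lambda>n. \<Sum>i\<le>k. \<bar>y i - x n i\<bar>) \<longlonglongrightarrow> (\<Sum>i\<le>k. \<bar>y i - y i\<bar>)"
    by (intro tendsto_intros lim) auto
  then have lim': "(\<lambda>n. \<Sum>i\<le>k. \<bar>y i - x n i\<bar>) \<longlonglongrightarrow> 0" by simp
  show "(\<lambda>n. mdist C01 (bernstein_path k y) (bernstein_path k (x n))) \<longlonglongrightarrow> 0"
    by (rule tendsto_sandwich[OF _ _ tendsto_const lim'])
       (use mdist_bernstein_path in \<open>auto intro: always_eventually\<close>)
qed auto

locale functional_limit = rescaled_ar M \<epsilon> \<phi> m a l + B: brownian N W
  for M :: "'a measure" and \<epsilon> \<phi> m a l and N :: "'b measure" and W +
  assumes ident: "\<And>k. distr M borel (\<epsilon> k) = distr M borel (\<epsilon> 0)"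
begin

definition bm_incr :: "nat \<Rightarrow> 'b \<Rightarrow> nat \<Rightarrow> real" where
  "bm_incr K \<omega> i = sqrt (real K) * (W (real (Suc i) / real K) \<omega> - W (real i / real K) \<omega>)"

lemma step_path_measurable:
  assumes "\<And>i. i < K \<Longrightarrow> X i \<in> borel_measurable Q"
  shows "(\<lambda>\<omega>. step_path K (\<lambda>i. X i \<omega>) t) \<in> borel_measurable Q"
  unfolding step_path_def using assms by (intro borel_measurable_sum borel_measurable_times) auto

lemma bm_incr_measurable: "(\<lambda>\<omega>. bm_incr K \<omega> i) \<in> borel_measurable N"
  unfolding bm_incr_def
  by (intro borel_measurable_times borel_measurable_diff B.W_measurable borel_measurable_const) auto

lemma block_limit:
  assumes F: "bounded_lipschitz F L b" and K: "K \<ge> 1"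
  shows "(\<lambda>n. expectation (\<lambda>\<omega>. F (bernstein_op k (step_path K (\<lambda>i. block (n div K) i \<omega>)))))
     \<longlonglongrightarrow> (\<integral>\<omega>. F (bernstein_op k (step_path K (bm_incr K \<omega>))) \<partial>N)"
proof -
  let ?G = "\<lambda>x. F (bernstein_op k (step_path K x))"
  have "(\<lambda>n. expectation (\<lambda>\<omega>. ?G (\<lambda>i. block (n div K) i \<omega>)))
     \<longlonglongrightarrow> (\<integral>\<omega>. ?G (\<lambda>i. sqrt (real K) * (W (real (Suc i) / real K) \<omega> - W (real i / real K) \<omega>)) \<partial>N)"
  proof (rule joint_block_limit[OF ident B.bm K])
    show "?G \<in> borel_measurable (PiM {..<K} (\<lambda>_. borel))"
      by (intro measurable_compose[OF bernstein_path_measurable bounded_lipschitz_measurable[OF F]] step_path_measurable) measurable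
    show "\<bar>?G x\<bar> \<le> b" for x using F by (simp add: bounded_lipschitz_def)
    fix x y assume lim: "\<And>i. i \<in> {..<K} \<Longrightarrow> (\<lambda>n. x n i) \<longlonglongrightarrow> (y i :: real)"
    show "(\<lambda>n. ?G (x n)) \<longlonglongrightarrow> ?G y"
      unfolding step_path_def by (intro bounded_lipschitz_bernstein_tendsto[OF F] tendsto_intros lim)
  qed
  then show ?thesis by (simp add: bm_incr_def[abs_def])
qed

section \<open>Convergence to a given continuous version of the limit\<close>

context
  fixes Z :: "real \<Rightarrow> 'b \<Rightarrow> real"
  assumes Zc: "\<And>\<omega>. \<omega> \<in> space N \<Longrightarrow> continuous_on {0..1} (\<lambda>t. Z t \<omega>)"
    and Zm: "\<And>t. t \<in> {0..1} \<Longrightarrow> Z t \<in> borel_measurable N"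
    and Zlim: "AE \<omega> in N. \<forall>t\<in>{0..1}. (\<lambda>n. kernel_step_sum \<beta> (\<lambda>s. W s \<omega>) n t) \<longlonglongrightarrow> Z t \<omega>"
begin

lemma path_Z_measurable: "path01 Z \<in> measurable N borel_C01"
  by (rule path01_measurable[OF Zm Zc])

lemma bm_step_limit:
  assumes F: "bounded_lipschitz F L b" and k: "k \<ge> 1"
  shows "(\<lambda>n. \<integral>\<omega>. F (bernstein_op k (step_path (Suc n) (bm_incr (Suc n) \<omega>))) \<partial>N)
     \<longlonglongrightarrow> (\<integral>\<omega>. F (bernstein_op k (\<lambda>t. Z t \<omega>)) \<partial>N)"
proof (rule integral_dominated_convergence[where w="\<lambda>_. b"])
  show "(\<lambda>\<omega>. F (bernstein_op k (\<lambda>t. Z t \<omega>))) \<in> borel_measurable N"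
    using k by (intro measurable_compose[OF bernstein_path_measurable bounded_lipschitz_measurable[OF F]] Zm) (auto simp: divide_le_eq_1)
  show "(\<lambda>\<omega>. F (bernstein_op k (step_path (Suc n) (bm_incr (Suc n) \<omega>)))) \<in> borel_measurable N" for n
    by (intro measurable_compose[OF bernstein_path_measurable bounded_lipschitz_measurable[OF F]] step_path_measurable bm_incr_measurable)
  show "AE \<omega> in N. (\<lambda>n. F (bernstein_op k (step_path (Suc n) (bm_incr (Suc n) \<omega>))))
      \<longlonglongrightarrow> F (bernstein_op k (\<lambda>t. Z t \<omega>))"
    using Zlim
  proof eventually_elim
    case (elim \<omega>)
    \<comment> \<open>The factor \<open>sqrt (real K)\<close> in \<open>bm_incr\<close> cancels the
      one in \<open>step_path\<close>, leaving a Riemann-Stieltjes sum against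
      \<open>W\<close>.\<close>
    have eq: "step_path (Suc n) (bm_incr (Suc n) \<omega>) t = kernel_step_sum \<beta> (\<lambda>s. W s \<omega>) n t" for n t
      unfolding step_path_def bm_incr_def limit_kernel_def kernel_step_sum_def
      by (intro sum.cong refl) (simp del: of_nat_Suc)
    show ?case
    proof (rule bounded_lipschitz_bernstein_tendsto[OF F])
      fix i assume "i \<le> k"
      then have "real i / real k \<in> {0..1}" using k by (auto simp: divide_le_eq_1)
      with elim show "(\<lambda>n. step_path (Suc n) (bm_incr (Suc n) \<omega>) (real i / real k)) \<longlonglongrightarrow> Z (real i / real k) \<omega>"
        unfolding eq by blast
    qed
  qed
qed (use F in \<open>auto simp: bounded_lipschitz_def\<close>)

lemma bernstein_limit:
  assumes F: "bounded_lipschitz F L b"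
  shows "(\<lambda>k. \<integral>\<omega>. F (bernstein_op k (\<lambda>t. Z t \<omega>)) \<partial>N) \<longlonglongrightarrow> (\<integral>\<omega>. F (path01 Z \<omega>) \<partial>N)"
proof (rule integral_dominated_convergence[where w="\<lambda>_. b"])
  show "(\<lambda>\<omega>. F (path01 Z \<omega>)) \<in> borel_measurable N"
    by (rule measurable_compose[OF path_Z_measurable bounded_lipschitz_measurable[OF F]])
  show "(\<lambda>\<omega>. F (bernstein_op k (\<lambda>t. Z t \<omega>))) \<in> borel_measurable N" for k
    by (intro measurable_compose[OF bernstein_path_measurable bounded_lipschitz_measurable[OF F]] Zm) (auto simp: divide_le_eq_1)
  show "AE \<omega> in N. (\<lambda>k. F (bernstein_op k (\<lambda>t. Z t \<omega>))) \<longlonglongrightarrow> F (path01 Z \<omega>)"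
  proof (rule AE_I2)
    fix \<omega> assume "\<omega> \<in> space N"
    then show "(\<lambda>k. F (bernstein_op k (\<lambda>t. Z t \<omega>))) \<longlonglongrightarrow> F (path01 Z \<omega>)"
      using bernstein_path_tendsto[OF Zc] path01_in_C01[OF Zc]
      by (intro bounded_lipschitz_tendsto[OF F]) (auto simp: path01_def)
  qed
qed (use F in \<open>auto simp: bounded_lipschitz_def\<close>)

text \<open>The parameters are chosen in the order \<open>\<delta>\<close>, \<open>k\<close>,
  \<open>K\<close>, and only then \<open>n\<close>: the Bernstein bound holds for all large
  \<open>n\<close> once \<open>\<delta>\<close> and \<open>k\<close> are fixed, and \<open>K\<close>
  must beat the factor \<open>k + 1\<close>.\<close>

lemma bounded_lipschitz_convergence:
  assumes F: "bounded_lipschitz F L b"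
  shows "(\<lambda>n. expectation (\<lambda>\<omega>. F (path01 (rescaled_process a \<phi> \<epsilon> n) \<omega>))) \<longlonglongrightarrow> (\<integral>\<omega>. F (path01 Z \<omega>) \<partial>N)"
proof (rule LIMSEQ_I)
  fix e :: real assume e: "e > 0"
  \<comment> \<open>Error budget in eighths: two for the Bernstein error of the rescaled process,
    and one each for the block approximation, the block limit, the Brownian step sums and the
    Bernstein error of \<open>Z\<close>; six in all.\<close>
  have e8: "e / 8 > 0" using e by simp
  define C where "C = L * (2 * (l + 1))"
  have C: "C \<ge> 0" using F l by (simp add: C_def bounded_lipschitz_def)
  \<comment> \<open>\<open>C + 1\<close> keeps the denominator positive when
    \<open>C = 0\<close>.\<close>
  define \<delta> where "\<delta> = e / (8 * (C + 1))"
  have \<delta>: "\<delta> > 0" using e C by (simp add: \<delta>_def)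
  have C\<delta>: "C * \<delta> \<le> e / 8"
  proof -
    have "C * \<delta> \<le> (C + 1) * \<delta>" using \<delta> by (intro mult_right_mono) auto
    also have "\<dots> = e / 8" using C by (simp add: \<delta>_def field_simps)
    finally show ?thesis .
  qed
  have "\<forall>\<^sub>F k in sequentially. (C / \<delta> ^ 3) / real k < e / 8"
    by (rule order_tendstoD(2)[OF lim_const_over_n e8])
  moreover have "\<forall>\<^sub>F k in sequentially. dist (\<integral>\<omega>. F (bernstein_op k (\<lambda>t. Z t \<omega>)) \<partial>N) (\<integral>\<omega>. F (path01 Z \<omega>) \<partial>N) < e / 8"
    by (rule tendstoD[OF bernstein_limit[OF F] e8])
  ultimately have "\<forall>\<^sub>F k in sequentially. k \<ge> 1 \<and> (C / \<delta> ^ 3) / real k < e / 8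
    \<and> dist (\<integral>\<omega>. F (bernstein_op k (\<lambda>t. Z t \<omega>)) \<partial>N) (\<integral>\<omega>. F (path01 Z \<omega>) \<partial>N) < e / 8"
    using eventually_ge_at_top[of 1] by eventually_elim auto
  then obtain k where k: "k \<ge> 1" "(C / \<delta> ^ 3) / real k < e / 8"
    and A1: "dist (\<integral>\<omega>. F (bernstein_op k (\<lambda>t. Z t \<omega>)) \<partial>N) (\<integral>\<omega>. F (path01 Z \<omega>) \<partial>N) < e / 8"
    using eventually_happens'[OF sequentially_bot] by blast
  have "(\<lambda>n. (L * (real (Suc k) * (3 * \<beta>))) / real (Suc n)) \<longlonglongrightarrow> 0"
    using LIMSEQ_Suc[OF lim_const_over_n] by blast
  then have "\<forall>\<^sub>F n in sequentially. (L * (real (Suc k) * (3 * \<beta>))) / real (Suc n) < e / 8"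
    by (rule order_tendstoD(2)[OF _ e8])
  moreover have "\<forall>\<^sub>F n in sequentially.
    dist (\<integral>\<omega>. F (bernstein_op k (step_path (Suc n) (bm_incr (Suc n) \<omega>))) \<partial>N)
      (\<integral>\<omega>. F (bernstein_op k (\<lambda>t. Z t \<omega>)) \<partial>N) < e / 8"
    by (rule tendstoD[OF bm_step_limit[OF F k(1)] e8])
  ultimately have "\<forall>\<^sub>F n in sequentially. (L * (real (Suc k) * (3 * \<beta>))) / real (Suc n) < e / 8
    \<and> dist (\<integral>\<omega>. F (bernstein_op k (step_path (Suc n) (bm_incr (Suc n) \<omega>))) \<partial>N)
      (\<integral>\<omega>. F (bernstein_op k (\<lambda>t. Z t \<omega>)) \<partial>N) < e / 8"
    by eventually_elim auto
  then obtain K' where K': "(L * (real (Suc k) * (3 * \<beta>))) / real (Suc K') < e / 8"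
    and A2: "dist (\<integral>\<omega>. F (bernstein_op k (step_path (Suc K') (bm_incr (Suc K') \<omega>))) \<partial>N)
      (\<integral>\<omega>. F (bernstein_op k (\<lambda>t. Z t \<omega>)) \<partial>N) < e / 8"
    using eventually_happens'[OF sequentially_bot] by blast
  have K: "Suc K' \<ge> 1" by simp
  have "\<forall>\<^sub>F n in sequentially.
    norm (expectation (\<lambda>\<omega>. F (path01 (rescaled_process a \<phi> \<epsilon> n) \<omega>)) - (\<integral>\<omega>. F (path01 Z \<omega>) \<partial>N)) < e"
    using tightness[OF F k(1) \<delta>] fdd_approx_functional[OF F K k(1)] tendstoD[OF block_limit[OF F K, of k] e8]
  proof eventually_elim
    case (elim n)
    have "L * (2 * (l + 1) * (\<delta> + 1 / (real k * \<delta> ^ 3))) = C * \<delta> + (C / \<delta> ^ 3) / real k"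
      by (simp add: C_def field_simps)
    then have 1: "L * (2 * (l + 1) * (\<delta> + 1 / (real k * \<delta> ^ 3))) \<le> e / 8 + e / 8" using C\<delta> k(2) by linarith
    have 2: "L * (real (Suc k) * (3 * \<beta> / real (Suc K'))) \<le> e / 8" using K' by (simp add: mult.assoc)
    show ?case
      using elim 1 2 A1 A2 e unfolding dist_real_def real_norm_def by linarith
  qed
  then show "\<exists>no. \<forall>n\<ge>no. norm (expectation (\<lambda>\<omega>. F (path01 (rescaled_process a \<phi> \<epsilon> n) \<omega>)) - (\<integral>\<omega>. F (path01 Z \<omega>) \<partial>N)) < e"
    by (simp add: eventually_sequentially)
qed

lemma convergence_in_law: "converges_in_law_C01 M (rescaled_process a \<phi> \<epsilon>) N Z"
  unfolding converges_in_law_C01_def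
proof (intro conjI allI path_Zn_measurable path_Z_measurable weak_conv_C01I)
  show "prob_space (law_C01 M (rescaled_process a \<phi> \<epsilon> n))" for n
    unfolding law_C01_def by (rule prob_space_distr[OF path_Zn_measurable])
  show "prob_space (law_C01 N Z)"
    unfolding law_C01_def by (rule B.prob_space_distr[OF path_Z_measurable])
  fix F L b assume F: "bounded_lipschitz F L b"
  show "(\<lambda>n. integral\<^sup>L (law_C01 M (rescaled_process a \<phi> \<epsilon> n)) F) \<longlonglongrightarrow> integral\<^sup>L (law_C01 N Z) F"
    unfolding law_C01_def integral_distr[OF path_Zn_measurable bounded_lipschitz_measurable[OF F]]
      integral_distr[OF path_Z_measurable bounded_lipschitz_measurable[OF F]]
    by (rule bounded_lipschitz_convergence[OF F])
qed (simp_all add: law_C01_def)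

end

end

theorem theorem4p1:
  fixes \<phi> a :: "nat \<Rightarrow> real" and m l :: real
    and M :: "'a measure" and \<epsilon> :: "nat \<Rightarrow> 'a \<Rightarrow> real"
    and N :: "'b measure" and W :: "real \<Rightarrow> 'b \<Rightarrow> real"
  assumes \<phi>_nonneg: "\<And>i. i \<ge> 1 \<Longrightarrow> \<phi> i \<ge> 0"
    and \<phi>_sum: "(\<lambda>i. \<phi> (Suc i)) sums 1"
    and \<phi>_mean: "(\<lambda>i. real (Suc i) * \<phi> (Suc i)) sums m"
    and a_bounds: "\<And>n. n \<ge> 1 \<Longrightarrow> 0 \<le> a n \<and> a n < 1"
    and l_pos: "l > 0"
    and a_lim: "(\<lambda>n. real n * (1 - a n)) \<longlonglongrightarrow> l"
    and M_prob: "prob_space M"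
    and \<epsilon>_indep: "prob_space.indep_vars M (\<lambda>_. borel) \<epsilon> UNIV"
    and \<epsilon>_ident: "\<And>k. distr M borel (\<epsilon> k) = distr M borel (\<epsilon> 0)"
    and \<epsilon>_integrable: "\<And>k. integrable M (\<epsilon> k)" "\<And>k. integrable M (\<lambda>\<omega>. (\<epsilon> k \<omega>)\<^sup>2)"
    and \<epsilon>_centered: "\<And>k. integral\<^sup>L M (\<epsilon> k) = 0"
    and \<epsilon>_variance: "\<And>k. (\<integral>\<omega>. (\<epsilon> k \<omega>)\<^sup>2 \<partial>M) = 1"
    and W_bm: "std_brownian_motion N W"
  shows "(\<exists>Z. continuous_wiener_process N W (\<lambda>t s. 1 - exp (- (l / m) * (t - s))) Z) \<and>
         (\<exists>X. continuous_wiener_process N W (\<lambda>s u. l / m * exp (- (l / m) * (s - u))) X) \<and>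
         (\<forall>Z X. continuous_wiener_process N W (\<lambda>t s. 1 - exp (- (l / m) * (t - s))) Z \<and>
                continuous_wiener_process N W (\<lambda>s u. l / m * exp (- (l / m) * (s - u))) X \<longrightarrow>
            (AE \<omega> in N. \<forall>t\<in>{0..1}. Z t \<omega> = (LBINT s:{0..t}. X s \<omega>)) \<and>
            converges_in_law_C01 M (rescaled_process a \<phi> \<epsilon>) N Z)"
proof -
  interpret P: prob_space M by (rule M_prob)
  interpret Q: prob_space N using W_bm by (simp add: std_brownian_motion_def)
  interpret R: functional_limit M \<epsilon> \<phi> m a l N W
    by unfold_locales (fact | use assms in simp)+
  obtain Z0 X0 where
    Z0: "continuous_wiener_process N W (\<lambda>t s. 1 - exp (- R.\<beta> * (t - s))) Z0" and
    X0: "continuous_wiener_process N W (\<lambda>s u. R.\<beta> * exp (- R.\<beta> * (s - u))) X0" and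
    ZX: "\<And>\<omega> t. \<omega> \<in> space N \<Longrightarrow> t \<in> {0..1} \<Longrightarrow> Z0 t \<omega> = (LBINT s:{0..t}. X0 s \<omega>)" and
    lim: "AE \<omega> in N. \<forall>t\<in>{0..1}. (\<lambda>n. kernel_step_sum R.\<beta> (\<lambda>s. W s \<omega>) n t) \<longlonglongrightarrow> Z0 t \<omega>"
    using R.B.explicit_wiener_processes[OF R.\<beta>_pos] by blast
  note Z0 = Z0[unfolded R.\<beta>_def] and X0 = X0[unfolded R.\<beta>_def]
  show ?thesis
  proof (intro conjI allI impI)
    fix Z X assume "continuous_wiener_process N W (\<lambda>t s. 1 - exp (- (l / m) * (t - s))) Z \<and>
      continuous_wiener_process N W (\<lambda>s u. l / m * exp (- (l / m) * (s - u))) X"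
    then have Z: "continuous_wiener_process N W (\<lambda>t s. 1 - exp (- (l / m) * (t - s))) Z"
      and X: "continuous_wiener_process N W (\<lambda>s u. l / m * exp (- (l / m) * (s - u))) X" by auto
    \<comment> \<open>Wiener integrals are fixed only almost surely; uniqueness carries the pathwise
      relation and the limit of the step sums from the explicit versions to arbitrary ones.\<close>
    have ZZ: "AE \<omega> in N. \<forall>t\<in>{0..1}. Z t \<omega> = Z0 t \<omega>" by (rule R.B.wiener_process_unique[OF Z Z0])
    have XX: "AE \<omega> in N. \<forall>t\<in>{0..1}. X t \<omega> = X0 t \<omega>" by (rule R.B.wiener_process_unique[OF X X0])
    show "AE \<omega> in N. \<forall>t\<in>{0..1}. Z t \<omega> = (LBINT s:{0..t}. X s \<omega>)"
      using ZZ XX AE_space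
    proof eventually_elim
      case (elim \<omega>)
      show ?case
      proof
        fix t :: real assume t: "t \<in> {0..1}"
        have "(LBINT s:{0..t}. X s \<omega>) = (LBINT s:{0..t}. X0 s \<omega>)"
          by (intro set_lebesgue_integral_cong) (use elim t in auto)
        then show "Z t \<omega> = (LBINT s:{0..t}. X s \<omega>)" using elim ZX t by simp
      qed
    qed
    show "converges_in_law_C01 M (rescaled_process a \<phi> \<epsilon>) N Z"
    proof (rule R.convergence_in_law)
      show "continuous_on {0..1} (\<lambda>t. Z t \<omega>)" if "\<omega> \<in> space N" for \<omega>
        using Z that by (simp add: continuous_wiener_process_def)
      show "Z t \<in> borel_measurable N" if "t \<in> {0..1}" for t
        using Z that by (simp add: continuous_wiener_process_def has_wiener_integral_def)
      show "AE \<omega> in N. \<forall>t\<in>{0..1}. (\<lambda>n. kernel_step_sum R.\<beta> (\<lambda>s. W s \<omega>) n t) \<longlonglongrightarrow> Z t \<omega>"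
        using ZZ lim by eventually_elim simp
    qed
  qed (use Z0 X0 in blast)+
qed

end
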